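(* (K\"ahler version of the Duistermaat–Heckman theorem.) There exist, for each $\lambda\in\Lambda$, a globally defined $2$-form $\mu_\lambda$ on $M_{\mathrm{red}}$ and, for each pair $\lambda_1,\lambda_2\in\Lambda$ (here $\lambda_1,\lambda_2$ denote two elements of $\mathbb{R}^n$), a globally defined $1$-form $\nu_{1,2}$ on $M_{\mathrm{red}}$ such that on every convex coordinate patch $U\subset M_{\mathrm{red}}$ over which $\pi$ is trivial, and for every admissible potential $\rho$ on $\pi^{-1}(U)$, $$\mu_\lambda|_U=\sqrt{-1}\,\partial\bar\partial\,\iota_\lambda^*\rho,\qquad \nu_{1,2}|_U=\sqrt{-1}\,\bar\partial\,\iota_{\lambda_1}^*\rho-\sqrt{-1}\,\bar\partial\,\iota_{\lambda_2}^*\rho$$ (in particular these do not depend on the choice of $\rho$ or of the trivialization), and $\mu_{\lambda_1}-\mu_{\lambda_2}=d\nu_{1,2}$. The curvature forms $\mu_{i,\lambda}$ of the line bundles $\mathbb{L}_i$ satisfy, for $\lambda_1,\lambda_2\in\Lambda$, $$\mu_{i,\lambda_1}-\mu_{i,\lambda_2}=\sqrt{-1}\,d(\partial\log\kappa_i),$$ where $\kappa_i:M_{\mathrm{red}}\to\mathbb{R}_{>0}$ is the function with $\langle\cdot,\cdot\rangle_{\lambda_1}=\kappa_i\langle\cdot,\cdot\rangle_{\lambda_2}$ on $\mathbb{L}_i$. Finally, for every $\lambda=(\lambda^{(1)},\dots,\lambda^{(n)})\in\Lambda$, the reduced K\"ahler form satisfies the Duistermaat–Heckman equation $$\omega_\lambda=\mu+\sum_{i=1}^n\lambda^{(i)}\,\mu_i,\qquad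 \mu=\mu_\lambda,\quad \mu_i=\mu_{i,\lambda}.$$ The forms $\mu$ and $\mu_i$ are canonically defined $2$-forms on $M_{\mathrm{red}}$; though they depend on $\lambda$, they are, for different choices of $\lambda$, canonically cohomologous by the two difference identities above.
   Context: Setting. $T=(S^1)^n$, $T_{\mathbb{C}}=(\mathbb{C}^* )^n$. $M$ is the total space of a holomorphic principal $T_{\mathbb{C}}$-bundle $\pi:M\to M_{\mathrm{red}}$ over a complex manifold $M_{\mathrm{red}}$, and $\omega$ is a $T$-invariant K\"ahler form on $M$ for which the $T$-action is Hamiltonian, with moment map $\Phi=(\phi_1,\dots,\phi_n):M\to\mathbb{R}^n$, $\iota(\partial/\partial\theta_j)\omega=-d\phi_j$, where $\partial/\partial\theta_j$ generates the $j$-th circle factor. $\Lambda\subset\mathbb{R}^n$ is the set of $\lambda$ such that $\Phi^{-1}(\lambda)\hookrightarrow M\xrightarrow{\pi}M_{\mathrm{red}}$ induces a biholomorphism of the symplectic quotient $M_\lambda=\Phi^{-1}(\lambda)/T$ (with its K\"ahler quotient structure) onto $M_{\mathrm{red}}$. For $\lambda\in\Lambda$, $\omega_\lambda$ denotes the reduced K\"ahler form, viewed as a form on $M_{\mathrm{red}}$. $\iota_\lambda$ is the inclusion of $\Phi^{-1}(\lambda)$ in $M$; for a $T$-invariant function $u$ on $\pi^{-1}(U)$, $\iota_\lambda^*u$ is regarded as a function on $U$ via $\Phi^{-1}(\lambda)/T\cong M_{\mathrm{red}}$. Admissible potential: given a trivialization $\pi^{-1}(U)\cong(\mathbb{C}^*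 )^n\times U$ with coordinates $(z,w)$, an admissible potential is a real-valued $T$-invariant smooth function $\rho$ on $\pi^{-1}(U)$ with $\omega=\sqrt{-1}\,\partial\bar\partial\rho$ and $\phi_j=z_j\,\partial\rho/\partial z_j$ for $j=1,\dots,n$ (such $\rho$ exist). Line bundles: let $\chi_i:T_{\mathbb{C}}\to\mathbb{C}^*$ be projection onto the $i$-th factor. $\mathbb{L}_i$ is the holomorphic line bundle on $M_{\mathrm{red}}$ whose sections are maps $s:M\to\mathbb{C}$ with $s(ap)=\chi_i(a)^{-1}s(p)$ for $a\in T_{\mathbb{C}}$. For $\lambda\in\Lambda$ it carries the Hermitian metric $\langle s,s\rangle_\lambda=\iota_\lambda^*|s|^2$, and its curvature form is $\mu_{i,\lambda}=-\sqrt{-1}\,\partial\bar\partial\log\langle s_i,s_i\rangle_\lambda$ for any local non-vanishing holomorphic section $s_i$ (e.g. $s_i=z_i^{-1}$ in a trivialization).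
   Formalization: The sign in the Duistermaat–Heckman equation is corrected: with the stated conventions for the line bundles and their curvature it reads ω_λ = μ − Σ λ^(i) μ_i; the printed plus fails for C²∖{0} → CP¹ with ω = √-1 ∂∂̄|v|². Also n ≥ 1 and dim M_red ≥ 1. *)

theory Defs
  imports "HOL-Analysis.Analysis"
begin

section \<open>Calculus on complex coordinate space\<close>

text \<open>The predicates below are only used on open sets.\<close>

primrec Ck_on :: "nat \<Rightarrow> 'a::euclidean_space set \<Rightarrow> ('a \<Rightarrow> 'b::real_normed_vector) \<Rightarrow> bool" where
  "Ck_on 0 S f \<longleftrightarrow> continuous_on S f"
| "Ck_on (Suc k) S f \<longleftrightarrow> (\<forall>x\<in>S. f differentiable (at x)) \<and>
     (\<forall>v. Ck_on k S (\<lambda>x. frechet_derivative f (at x) v))"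

definition smooth_on :: "'a::euclidean_space set \<Rightarrow> ('a \<Rightarrow> 'b::real_normed_vector) \<Rightarrow> bool" where
  "smooth_on S f \<longleftrightarrow> (\<forall>k. Ck_on k S f)"

definition holo_on :: "(complex^'k) set \<Rightarrow> (complex^'k \<Rightarrow> complex^'l) \<Rightarrow> bool" where
  "holo_on S f \<longleftrightarrow>
     (\<forall>x\<in>S. \<exists>D. (f has_derivative D) (at x) \<and> (\<forall>a v. D (a *s v) = a *s D v))"

text \<open>Wirtinger derivatives \<open>\<partial>/\<partial>z\<^sub>j\<close> and \<open>\<partial>/\<partial>z\<^sub>j\<close>-bar.\<close>

definition dz :: "'k::finite \<Rightarrow> (complex^'k \<Rightarrow> complex) \<Rightarrow> complex^'k \<Rightarrow> complex" where
  "dz j f x = (frechet_derivative f (at x) (axis j 1)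
      - \<i> * frechet_derivative f (at x) (axis j \<i>)) / 2"

definition dzbar :: "'k::finite \<Rightarrow> (complex^'k \<Rightarrow> complex) \<Rightarrow> complex^'k \<Rightarrow> complex" where
  "dzbar j f x = (frechet_derivative f (at x) (axis j 1)
      + \<i> * frechet_derivative f (at x) (axis j \<i>)) / 2"

section \<open>Complex manifolds\<close>

text \<open>A complex manifold is given by its maximal atlas. The map of a chart is a total function of
  which only the restriction to the chart domain matters. Points and topology are recovered from
  the atlas; since the atlas is maximal, the chart domains form a basis of the topology.\<close>

type_synonym ('a, 'k) chart = "'a set \<times> ('a \<Rightarrow> complex^'k)"

abbreviation dom_of :: "('a, 'k) chart \<Rightarrow> 'a set" where "dom_of c \<equiv> fst c"

abbreviation img_of :: "('a, 'k::finite) chart \<Rightarrow> (complex^'k) set" where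
  "img_of c \<equiv> snd c ` fst c"

abbreviation chart_inv :: "('a, 'k::finite) chart \<Rightarrow> complex^'k \<Rightarrow> 'a" where
  "chart_inv c \<equiv> inv_into (fst c) (snd c)"

definition points :: "('a, 'k::finite) chart set \<Rightarrow> 'a set" where
  "points A = (\<Union>c\<in>A. dom_of c)"

definition atlas_topology :: "('a, 'k::finite) chart set \<Rightarrow> 'a topology" where
  "atlas_topology A = topology_generated_by (dom_of ` A)"

definition is_chart :: "('a, 'k::finite) chart \<Rightarrow> bool" where
  "is_chart c \<longleftrightarrow> inj_on (snd c) (dom_of c) \<and> open (img_of c)"

definition holo_transition :: "('a, 'k::finite) chart \<Rightarrow> ('a, 'k) chart \<Rightarrow> bool" where
  "holo_transition c d \<longleftrightarrow> open (snd c ` (dom_of c \<inter> dom_of d)) \<and>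
     holo_on (snd c ` (dom_of c \<inter> dom_of d)) (snd d \<circ> chart_inv c)"

definition compatible :: "('a, 'k::finite) chart \<Rightarrow> ('a, 'k) chart \<Rightarrow> bool" where
  "compatible c d \<longleftrightarrow> holo_transition c d \<and> holo_transition d c"

definition complex_manifold :: "('a, 'k::finite) chart set \<Rightarrow> bool" where
  "complex_manifold A \<longleftrightarrow>
     (\<forall>c\<in>A. is_chart c) \<and>
     (\<forall>c\<in>A. \<forall>d\<in>A. compatible c d) \<and>
     (\<forall>c. is_chart c \<and> dom_of c \<subseteq> points A \<and> (\<forall>d\<in>A. compatible c d) \<longrightarrow> c \<in> A) \<and>
     Hausdorff_space (atlas_topology A) \<and> second_countable (atlas_topology A)"

definition holomorphic_map ::
    "('a, 'k::finite) chart set \<Rightarrow> ('b, 'l::finite) chart set \<Rightarrow> ('a \<Rightarrow> 'b) \<Rightarrow> bool" where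
  "holomorphic_map A B f \<longleftrightarrow> f ` points A \<subseteq> points B \<and>
     (\<forall>c\<in>A. \<forall>d\<in>B. open (snd c ` (dom_of c \<inter> f -` dom_of d)) \<and>
        holo_on (snd c ` (dom_of c \<inter> f -` dom_of d)) (snd d \<circ> f \<circ> chart_inv c))"

definition biholomorphic_map ::
    "('a, 'k::finite) chart set \<Rightarrow> ('b, 'l::finite) chart set \<Rightarrow> ('a \<Rightarrow> 'b) \<Rightarrow> bool" where
  "biholomorphic_map A B f \<longleftrightarrow> bij_betw f (points A) (points B) \<and>
     holomorphic_map A B f \<and> holomorphic_map B A (inv_into (points A) f)"

definition holomorphic_function ::
    "('a, 'k::finite) chart set \<Rightarrow> 'a set \<Rightarrow> ('a \<Rightarrow> complex) \<Rightarrow> bool" where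
  "holomorphic_function A V f \<longleftrightarrow>
     (\<forall>c\<in>A. \<forall>x\<in>snd c ` (dom_of c \<inter> V). \<exists>D. ((f \<circ> chart_inv c) has_derivative D) (at x) \<and>
        (\<forall>a v. D (a *s v) = a * D v))"

definition smooth_function ::
    "('a, 'k::finite) chart set \<Rightarrow> ('a \<Rightarrow> 'c::real_normed_vector) \<Rightarrow> bool" where
  "smooth_function A f \<longleftrightarrow> (\<forall>c\<in>A. smooth_on (img_of c) (f \<circ> chart_inv c))"

text \<open>The tangent map of \<open>F\<close> in the charts \<open>c\<close> and \<open>d\<close>, at the point with \<open>c\<close>-coordinate \<open>x\<close>.\<close>

definition tmap :: "('a, 'k::finite) chart \<Rightarrow> ('b, 'l::finite) chart \<Rightarrow> ('a \<Rightarrow> 'b) \<Rightarrow>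
    complex^'k \<Rightarrow> complex^'k \<Rightarrow> complex^'l" where
  "tmap c d F x = frechet_derivative (snd d \<circ> F \<circ> chart_inv c) (at x)"

section \<open>Complex-valued differential forms\<close>

text \<open>A form is the family of its coordinate expressions: \<open>\<alpha> c x\<close> is the (real-linear) form on
  coordinate vectors at the point with coordinate \<open>x\<close> in the chart \<open>c\<close>. Values at charts outside
  the atlas, or at \<open>x\<close> outside the image of \<open>c\<close>, are irrelevant.\<close>

type_synonym ('a, 'k) form1 = "('a, 'k) chart \<Rightarrow> complex^'k \<Rightarrow> complex^'k \<Rightarrow> complex"
type_synonym ('a, 'k) form2 =
  "('a, 'k) chart \<Rightarrow> complex^'k \<Rightarrow> complex^'k \<Rightarrow> complex^'k \<Rightarrow> complex"

definition one_form :: "('a, 'k::finite) chart set \<Rightarrow> ('a, 'k) form1 \<Rightarrow> bool" where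
  "one_form A \<alpha> \<longleftrightarrow>
     (\<forall>c\<in>A. \<forall>x\<in>img_of c. linear (\<alpha> c x)) \<and>
     (\<forall>c\<in>A. \<forall>v. smooth_on (img_of c) (\<lambda>x. \<alpha> c x v)) \<and>
     (\<forall>c\<in>A. \<forall>d\<in>A. \<forall>p\<in>dom_of c \<inter> dom_of d. \<forall>v.
        \<alpha> c (snd c p) v = \<alpha> d (snd d p) (tmap c d id (snd c p) v))"

definition two_form :: "('a, 'k::finite) chart set \<Rightarrow> ('a, 'k) form2 \<Rightarrow> bool" where
  "two_form A \<alpha> \<longleftrightarrow>
     (\<forall>c\<in>A. \<forall>x\<in>img_of c. bilinear (\<alpha> c x) \<and> (\<forall>u. \<alpha> c x u u = 0)) \<and>
     (\<forall>c\<in>A. \<forall>u v. smooth_on (img_of c) (\<lambda>x. \<alpha> c x u v)) \<and>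
     (\<forall>c\<in>A. \<forall>d\<in>A. \<forall>p\<in>dom_of c \<inter> dom_of d. \<forall>u v.
        \<alpha> c (snd c p) u v =
        \<alpha> d (snd d p) (tmap c d id (snd c p) u) (tmap c d id (snd c p) v))"

definition form2_eq :: "('a, 'k::finite) chart set \<Rightarrow> ('a, 'k) form2 \<Rightarrow> ('a, 'k) form2 \<Rightarrow> bool" where
  "form2_eq A \<alpha> \<beta> \<longleftrightarrow> (\<forall>c\<in>A. \<forall>x\<in>img_of c. \<forall>u v. \<alpha> c x u v = \<beta> c x u v)"

definition ext_d :: "('a, 'k::finite) form1 \<Rightarrow> ('a, 'k) form2" where
  "ext_d \<alpha> = (\<lambda>c x u v. frechet_derivative (\<lambda>y. \<alpha> c y v) (at x) u
                      - frechet_derivative (\<lambda>y. \<alpha> c y u) (at x) v)"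

definition closed_form :: "('a, 'k::finite) chart set \<Rightarrow> ('a, 'k) form2 \<Rightarrow> bool" where
  "closed_form A \<alpha> \<longleftrightarrow> (\<forall>c\<in>A. \<forall>x\<in>img_of c. \<forall>u v w.
      frechet_derivative (\<lambda>y. \<alpha> c y v w) (at x) u
    - frechet_derivative (\<lambda>y. \<alpha> c y u w) (at x) v
    + frechet_derivative (\<lambda>y. \<alpha> c y u v) (at x) w = 0)"

text \<open>\<open>\<partial>f = \<Sum> (\<partial>f/\<partial>z\<^sub>j) dz\<^sub>j\<close>, its conjugate analogue, and \<open>\<partial>\<partial>\<close>-bar, where
  \<open>(\<alpha> \<and> \<beta>)(u,v) = \<alpha>(u) \<beta>(v) - \<alpha>(v) \<beta>(u)\<close>, the convention also used by \<^const>\<open>ext_d\<close>.\<close>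

definition del :: "('a \<Rightarrow> complex) \<Rightarrow> ('a, 'k::finite) form1" where
  "del f = (\<lambda>c x v. \<Sum>j\<in>UNIV. dz j (f \<circ> chart_inv c) x * v $ j)"

definition delbar :: "('a \<Rightarrow> complex) \<Rightarrow> ('a, 'k::finite) form1" where
  "delbar f = (\<lambda>c x v. \<Sum>j\<in>UNIV. dzbar j (f \<circ> chart_inv c) x * cnj (v $ j))"

definition deldelbar :: "('a \<Rightarrow> complex) \<Rightarrow> ('a, 'k::finite) form2" where
  "deldelbar f = (\<lambda>c x u v. \<Sum>j\<in>UNIV. \<Sum>k\<in>UNIV.
      dz j (dzbar k (f \<circ> chart_inv c)) x * (u $ j * cnj (v $ k) - v $ j * cnj (u $ k)))"

definition kaehler_form :: "('a, 'k::finite) chart set \<Rightarrow> ('a, 'k) form2 \<Rightarrow> bool" where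
  "kaehler_form A \<omega> \<longleftrightarrow> two_form A \<omega> \<and> closed_form A \<omega> \<and>
     (\<forall>c\<in>A. \<forall>x\<in>img_of c.
        (\<forall>u v. \<omega> c x u v \<in> \<real>) \<and>
        (\<forall>u v. \<omega> c x (\<i> *s u) (\<i> *s v) = \<omega> c x u v) \<and>
        (\<forall>u. u \<noteq> 0 \<longrightarrow> 0 < Re (\<omega> c x u (\<i> *s u))))"

section \<open>Holomorphic principal torus bundles\<close>

text \<open>\<open>(\<complex>\<^sup>*)\<^sup>n\<close> and \<open>(S\<^sup>1)\<^sup>n\<close>; the componentwise product of vectors is the group multiplication.\<close>

definition complex_torus :: "(complex^'n) set" where
  "complex_torus = {a. \<forall>j. a $ j \<noteq> 0}"

definition compact_torus :: "(complex^'n) set" where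
  "compact_torus = {a. \<forall>j. cmod (a $ j) = 1}"

text \<open>A trivialization over the domain of the chart \<open>c\<close> of the base is given by the fibre coordinate
  \<open>z\<close>; together with the base coordinate \<open>w = c (\<pi> p)\<close> it is a chart of the total space, whose
  coordinates \<open>Inl j\<close> are the \<open>z\<^sub>j\<close> and \<open>Inr k\<close> the \<open>w\<^sub>k\<close>.\<close>

definition bundle_chart :: "('a, 'n::finite + 'm::finite) chart set \<Rightarrow> ('a \<Rightarrow> 'b) \<Rightarrow> ('b, 'm) chart \<Rightarrow>
    ('a \<Rightarrow> complex^'n) \<Rightarrow> ('a, 'n + 'm) chart" where
  "bundle_chart M \<pi> c z =
     (points M \<inter> \<pi> -` dom_of c,
      \<lambda>p. \<chi> s. case s of Inl j \<Rightarrow> z p $ j | Inr k \<Rightarrow> snd c (\<pi> p) $ k)"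

definition trivialization :: "('a, 'n::finite + 'm::finite) chart set \<Rightarrow>
    (complex^'n \<Rightarrow> 'a \<Rightarrow> 'a) \<Rightarrow> ('a \<Rightarrow> 'b) \<Rightarrow> ('b, 'm) chart \<Rightarrow> ('a \<Rightarrow> complex^'n) \<Rightarrow> bool" where
  "trivialization M act \<pi> c z \<longleftrightarrow>
     bundle_chart M \<pi> c z \<in> M \<and>
     img_of (bundle_chart M \<pi> c z) = {x. (\<forall>j. x $ Inl j \<noteq> 0) \<and> (\<chi> k. x $ Inr k) \<in> img_of c} \<and>
     (\<forall>a\<in>complex_torus. \<forall>p\<in>points M \<inter> \<pi> -` dom_of c. z (act a p) = a * z p)"

definition principal_bundle :: "('a, 'n::finite + 'm::finite) chart set \<Rightarrow> ('b, 'm) chart set \<Rightarrow>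
    (complex^'n \<Rightarrow> 'a \<Rightarrow> 'a) \<Rightarrow> ('a \<Rightarrow> 'b) \<Rightarrow> bool" where
  "principal_bundle M B act \<pi> \<longleftrightarrow>
     complex_manifold M \<and> complex_manifold B \<and>
     \<pi> ` points M \<subseteq> points B \<and>
     (\<forall>p\<in>points M. act 1 p = p) \<and>
     (\<forall>a\<in>complex_torus. \<forall>p\<in>points M. act a p \<in> points M \<and> \<pi> (act a p) = \<pi> p) \<and>
     (\<forall>a\<in>complex_torus. \<forall>b\<in>complex_torus. \<forall>p\<in>points M. act a (act b p) = act (a * b) p) \<and>
     (\<forall>w\<in>points B. \<exists>c\<in>B. w \<in> dom_of c \<and> (\<exists>z. trivialization M act \<pi> c z))"

section \<open>Hamiltonian torus action and reduction\<close>

definition invariant_form2 :: "('a, 'k::finite) chart set \<Rightarrow> (complex^'n \<Rightarrow> 'a \<Rightarrow> 'a) \<Rightarrow>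
    ('a, 'k) form2 \<Rightarrow> bool" where
  "invariant_form2 A act \<omega> \<longleftrightarrow>
     (\<forall>a\<in>compact_torus. \<forall>c\<in>A. \<forall>d\<in>A. \<forall>p\<in>dom_of c. act a p \<in> dom_of d \<longrightarrow>
        (\<forall>u v. \<omega> d (snd d (act a p)) (tmap c d (act a) (snd c p) u) (tmap c d (act a) (snd c p) v)
              = \<omega> c (snd c p) u v))"

definition circle_elt :: "'n::finite \<Rightarrow> real \<Rightarrow> complex^'n" where
  "circle_elt j t = (\<chi> i. if i = j then cis t else 1)"

text \<open>The vector field \<open>\<partial>/\<partial>\<theta>\<^sub>j\<close> at \<open>p\<close>, in the chart \<open>c\<close>.\<close>

definition gen :: "(complex^'n \<Rightarrow> 'a \<Rightarrow> 'a) \<Rightarrow> ('a, 'k::finite) chart \<Rightarrow> 'n::finite \<Rightarrow> 'a \<Rightarrow> complex^'k" where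
  "gen act c j p = vector_derivative (\<lambda>t. snd c (act (circle_elt j t) p)) (at 0)"

definition dmoment :: "('a \<Rightarrow> real^'n) \<Rightarrow> ('a, 'k::finite) chart \<Rightarrow> 'n::finite \<Rightarrow> complex^'k \<Rightarrow>
    complex^'k \<Rightarrow> real" where
  "dmoment \<Phi> c j x = frechet_derivative ((\<lambda>p. \<Phi> p $ j) \<circ> chart_inv c) (at x)"

definition moment_map :: "('a, 'k::finite) chart set \<Rightarrow> (complex^'n \<Rightarrow> 'a \<Rightarrow> 'a) \<Rightarrow>
    ('a, 'k) form2 \<Rightarrow> ('a \<Rightarrow> real^'n::finite) \<Rightarrow> bool" where
  "moment_map A act \<omega> \<Phi> \<longleftrightarrow>
     smooth_function A \<Phi> \<and>
     (\<forall>a\<in>compact_torus. \<forall>p\<in>points A. \<Phi> (act a p) = \<Phi> p) \<and>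
     (\<forall>j. \<forall>c\<in>A. \<forall>p\<in>dom_of c. \<forall>v.
        \<omega> c (snd c p) (gen act c j p) v = - complex_of_real (dmoment \<Phi> c j (snd c p) v))"

definition level :: "('a, 'k::finite) chart set \<Rightarrow> ('a \<Rightarrow> real^'n) \<Rightarrow> real^'n \<Rightarrow> 'a set" where
  "level A \<Phi> l = {p \<in> points A. \<Phi> p = l}"

definition torus_orbit :: "(complex^'n \<Rightarrow> 'a \<Rightarrow> 'a) \<Rightarrow> 'a \<Rightarrow> 'a set" where
  "torus_orbit act p = (\<lambda>a. act a p) ` compact_torus"

definition quotient_points :: "('a, 'k::finite) chart set \<Rightarrow> (complex^'n \<Rightarrow> 'a \<Rightarrow> 'a) \<Rightarrow>
    ('a \<Rightarrow> real^'n) \<Rightarrow> real^'n \<Rightarrow> 'a set set" where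
  "quotient_points A act \<Phi> l = torus_orbit act ` level A \<Phi> l"

text \<open>Tangent space of the level set; the action is free, so every value of \<open>\<Phi>\<close> is regular.\<close>

definition level_tangent :: "('a \<Rightarrow> real^'n) \<Rightarrow> ('a, 'k::finite) chart \<Rightarrow> 'a \<Rightarrow> (complex^'k) set" where
  "level_tangent \<Phi> c p = {u. \<forall>j. dmoment \<Phi> c j (snd c p) u = 0}"

text \<open>Horizontal space: orthogonal complement of the orbit direction in the tangent space of the
  level set, for the Kaehler metric \<open>g(u,v) = \<omega>(u, iv)\<close>. It is a complex subspace.\<close>

definition horizontal :: "(complex^'n \<Rightarrow> 'a \<Rightarrow> 'a) \<Rightarrow> ('a, 'k) form2 \<Rightarrow>
    ('a \<Rightarrow> real^'n) \<Rightarrow> ('a, 'k::finite) chart \<Rightarrow> 'a \<Rightarrow> (complex^'k) set" where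
  "horizontal act \<omega> \<Phi> c p =
     {u \<in> level_tangent \<Phi> c p. \<forall>j. \<omega> c (snd c p) u (\<i> *s gen act c j p) = 0}"

text \<open>The holomorphic charts of the Kaehler quotient \<open>\<Phi>\<^sup>-\<^sup>1(l)/T\<close>: those \<open>(V, \<psi>)\<close> for which the
  \<open>T\<close>-invariant function \<open>p \<mapsto> \<psi> (T p)\<close> on the level set is smooth (locally the restriction of a
  smooth function \<open>F\<close>) with differential inducing a complex-linear isomorphism of each horizontal
  space onto the model space. The condition on \<open>N\<close> makes \<open>V\<close> open in the quotient topology.\<close>

definition kaehler_quotient :: "('a, 'n::finite + 'm::finite) chart set \<Rightarrow>
    (complex^'n \<Rightarrow> 'a \<Rightarrow> 'a) \<Rightarrow> ('a, 'n + 'm) form2 \<Rightarrow> ('a \<Rightarrow> real^'n) \<Rightarrow> real^'n \<Rightarrow>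
    ('a set, 'm) chart set" where
  "kaehler_quotient M act \<omega> \<Phi> l =
     {(V, \<psi>). V \<subseteq> quotient_points M act \<Phi> l \<and> inj_on \<psi> V \<and> open (\<psi> ` V) \<and>
        (\<forall>p\<in>level M \<Phi> l. torus_orbit act p \<in> V \<longrightarrow>
          (\<exists>c\<in>M. \<exists>N F. p \<in> dom_of c \<and> open N \<and> snd c p \<in> N \<and> N \<subseteq> img_of c \<and> smooth_on N F \<and>
             (\<forall>q\<in>level M \<Phi> l \<inter> dom_of c. snd c q \<in> N \<longrightarrow>
                 torus_orbit act q \<in> V \<and> F (snd c q) = \<psi> (torus_orbit act q)) \<and>
             (\<forall>u\<in>horizontal act \<omega> \<Phi> c p.
                 frechet_derivative F (at (snd c p)) (\<i> *s u) =
                 \<i> *s frechet_derivative F (at (snd c p)) u) \<and>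
             bij_betw (frechet_derivative F (at (snd c p))) (horizontal act \<omega> \<Phi> c p) UNIV))}"

definition induced_map :: "('a \<Rightarrow> 'b) \<Rightarrow> 'a set \<Rightarrow> 'b" where
  "induced_map \<pi> O' = \<pi> (SOME p. p \<in> O')"

definition Lambda :: "('a, 'n::finite + 'm::finite) chart set \<Rightarrow> ('b, 'm) chart set \<Rightarrow>
    (complex^'n \<Rightarrow> 'a \<Rightarrow> 'a) \<Rightarrow> ('a \<Rightarrow> 'b) \<Rightarrow> ('a, 'n + 'm) form2 \<Rightarrow> ('a \<Rightarrow> real^'n) \<Rightarrow>
    (real^'n) set" where
  "Lambda M B act \<pi> \<omega> \<Phi> =
     {l. points (kaehler_quotient M act \<omega> \<Phi> l) = quotient_points M act \<Phi> l \<and>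
         biholomorphic_map (kaehler_quotient M act \<omega> \<Phi> l) B (induced_map \<pi>)}"

text \<open>The restriction of a \<open>T\<close>-invariant function to the level set, as a function on the base.\<close>

definition restr :: "('a, 'k::finite) chart set \<Rightarrow> ('a \<Rightarrow> 'b) \<Rightarrow> ('a \<Rightarrow> real^'n) \<Rightarrow> real^'n \<Rightarrow>
    ('a \<Rightarrow> 'c) \<Rightarrow> 'b \<Rightarrow> 'c" where
  "restr M \<pi> \<Phi> l u w = u (SOME p. p \<in> level M \<Phi> l \<and> \<pi> p = w)"

text \<open>The reduced form, seen on the base: its pullback along \<open>\<pi> \<circ> \<iota>\<close> is the pullback of \<open>\<omega>\<close> along
  the inclusion \<open>\<iota>\<close> of the level set. For \<open>l \<in> \<Lambda>\<close> this determines it on all charts.\<close>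

definition is_reduced_form :: "('a, 'k::finite) chart set \<Rightarrow> ('b, 'm::finite) chart set \<Rightarrow>
    ('a \<Rightarrow> 'b) \<Rightarrow> ('a, 'k) form2 \<Rightarrow> ('a \<Rightarrow> real^'n) \<Rightarrow> real^'n \<Rightarrow> ('b, 'm) form2 \<Rightarrow> bool" where
  "is_reduced_form M B \<pi> \<omega> \<Phi> l \<sigma> \<longleftrightarrow> two_form B \<sigma> \<and>
     (\<forall>b\<in>M. \<forall>c\<in>B. \<forall>p\<in>level M \<Phi> l \<inter> dom_of b. \<pi> p \<in> dom_of c \<longrightarrow>
        (\<forall>u\<in>level_tangent \<Phi> b p. \<forall>v\<in>level_tangent \<Phi> b p.
           \<sigma> c (snd c (\<pi> p)) (tmap b c \<pi> (snd b p) u) (tmap b c \<pi> (snd b p) v)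
           = \<omega> b (snd b p) u v))"

definition reduced_form :: "('a, 'k::finite) chart set \<Rightarrow> ('b, 'm::finite) chart set \<Rightarrow>
    ('a \<Rightarrow> 'b) \<Rightarrow> ('a, 'k) form2 \<Rightarrow> ('a \<Rightarrow> real^'n) \<Rightarrow> real^'n \<Rightarrow> ('b, 'm) form2" where
  "reduced_form M B \<pi> \<omega> \<Phi> l = (SOME \<sigma>. is_reduced_form M B \<pi> \<omega> \<Phi> l \<sigma>)"

section \<open>Admissible potentials\<close>

definition admissible_potential :: "('a, 'n::finite + 'm::finite) chart set \<Rightarrow>
    (complex^'n \<Rightarrow> 'a \<Rightarrow> 'a) \<Rightarrow> ('a \<Rightarrow> 'b) \<Rightarrow> ('a, 'n + 'm) form2 \<Rightarrow> ('a \<Rightarrow> real^'n) \<Rightarrow>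
    ('b, 'm) chart \<Rightarrow> ('a \<Rightarrow> complex^'n) \<Rightarrow> ('a \<Rightarrow> real) \<Rightarrow> bool" where
  "admissible_potential M act \<pi> \<omega> \<Phi> c z \<rho> \<longleftrightarrow>
     (let b = bundle_chart M \<pi> c z; \<rho>c = (\<lambda>p. complex_of_real (\<rho> p)) in
       (\<forall>a\<in>compact_torus. \<forall>p\<in>dom_of b. \<rho> (act a p) = \<rho> p) \<and>
       smooth_on (img_of b) (\<rho> \<circ> chart_inv b) \<and>
       (\<forall>x\<in>img_of b. \<forall>u v. \<omega> b x u v = \<i> * deldelbar \<rho>c b x u v) \<and>
       (\<forall>p\<in>dom_of b. \<forall>j. complex_of_real (\<Phi> p $ j) =
           z p $ j * dz (Inl j) (\<rho>c \<circ> chart_inv b) (snd b p)))"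

section \<open>The line bundles and their curvature\<close>

text \<open>Sections over \<open>U\<close> of the line bundle attached to the character \<open>a \<mapsto> a\<^sub>i\<close>, without regularity
  condition; for \<open>U = {w}\<close> this is the fibre at \<open>w\<close>.\<close>

definition line_section :: "('a, 'k::finite) chart set \<Rightarrow> (complex^'n \<Rightarrow> 'a \<Rightarrow> 'a) \<Rightarrow> ('a \<Rightarrow> 'b) \<Rightarrow>
    'n::finite \<Rightarrow> 'b set \<Rightarrow> ('a \<Rightarrow> complex) \<Rightarrow> bool" where
  "line_section M act \<pi> i U s \<longleftrightarrow>
     (\<forall>p\<in>points M \<inter> \<pi> -` U. \<forall>a\<in>complex_torus. s (act a p) = inverse (a $ i) * s p)"

definition hermitian :: "('a, 'k::finite) chart set \<Rightarrow> ('a \<Rightarrow> 'b) \<Rightarrow> ('a \<Rightarrow> real^'n) \<Rightarrow> real^'n \<Rightarrow>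
    ('a \<Rightarrow> complex) \<Rightarrow> ('a \<Rightarrow> complex) \<Rightarrow> 'b \<Rightarrow> complex" where
  "hermitian M \<pi> \<Phi> l s t = restr M \<pi> \<Phi> l (\<lambda>p. s p * cnj (t p))"

text \<open>The curvature form \<open>-i\<partial>\<partial>\<close>-bar \<open>log \<langle>s,s\<rangle>\<close> represents \<open>2\<pi>c\<^sub>1\<close>. Mind its sign: for
  \<open>M = \<complex>\<^sup>2 - {0} \<rightarrow> \<complex>P\<^sup>1\<close> with \<open>\<omega> = i\<partial>\<partial>\<close>-bar \<open>|v|\<^sup>2\<close> and \<open>\<Phi> = |v|\<^sup>2\<close>, sections of the line bundle
  are functions homogeneous of degree \<open>-1\<close>, so that it is \<open>O(-1)\<close> with negative curvature
  \<open>-\<omega>\<^sub>F\<^sub>S\<close>, where \<open>\<omega>\<^sub>F\<^sub>S\<close> is \<open>i\<partial>\<partial>\<close>-bar \<open>log |v|\<^sup>2\<close>, whereas the reduced form is \<open>l \<omega>\<^sub>F\<^sub>S\<close>.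
  With these conventions the Duistermaat-Heckman equation is therefore
  \<open>\<omega>\<^sub>l = \<mu> - \<Sum> l\<^sub>i \<mu>\<^sub>i\<close>; the form with a plus sign goes with the dual line bundles.\<close>

definition is_curvature_form :: "('a, 'k::finite) chart set \<Rightarrow> ('b, 'm::finite) chart set \<Rightarrow>
    (complex^'n \<Rightarrow> 'a \<Rightarrow> 'a) \<Rightarrow> ('a \<Rightarrow> 'b) \<Rightarrow> ('a \<Rightarrow> real^'n) \<Rightarrow> 'n::finite \<Rightarrow> real^'n \<Rightarrow>
    ('b, 'm) form2 \<Rightarrow> bool" where
  "is_curvature_form M B act \<pi> \<Phi> i l \<eta> \<longleftrightarrow> two_form B \<eta> \<and>
     (\<forall>U s. openin (atlas_topology B) U \<and> line_section M act \<pi> i U s \<and>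
            holomorphic_function M (points M \<inter> \<pi> -` U) s \<and>
            (\<forall>p\<in>points M \<inter> \<pi> -` U. s p \<noteq> 0) \<longrightarrow>
        (\<forall>c\<in>B. \<forall>x\<in>snd c ` (dom_of c \<inter> U). \<forall>u v.
           \<eta> c x u v =
           - \<i> * deldelbar (\<lambda>w. complex_of_real (ln (Re (hermitian M \<pi> \<Phi> l s s w)))) c x u v))"

definition curvature_form :: "('a, 'k::finite) chart set \<Rightarrow> ('b, 'm::finite) chart set \<Rightarrow>
    (complex^'n \<Rightarrow> 'a \<Rightarrow> 'a) \<Rightarrow> ('a \<Rightarrow> 'b) \<Rightarrow> ('a \<Rightarrow> real^'n) \<Rightarrow> 'n::finite \<Rightarrow> real^'n \<Rightarrow>
    ('b, 'm) form2" where
  "curvature_form M B act \<pi> \<Phi> i l = (SOME \<eta>. is_curvature_form M B act \<pi> \<Phi> i l \<eta>)"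

definition metric_ratio :: "('a, 'k::finite) chart set \<Rightarrow> ('b, 'm::finite) chart set \<Rightarrow>
    (complex^'n \<Rightarrow> 'a \<Rightarrow> 'a) \<Rightarrow> ('a \<Rightarrow> 'b) \<Rightarrow> ('a \<Rightarrow> real^'n) \<Rightarrow> 'n::finite \<Rightarrow> real^'n \<Rightarrow> real^'n \<Rightarrow>
    ('b \<Rightarrow> real) \<Rightarrow> bool" where
  "metric_ratio M B act \<pi> \<Phi> i l1 l2 \<kappa> \<longleftrightarrow>
     (\<forall>w\<in>points B. 0 < \<kappa> w \<and>
        (\<forall>s t. line_section M act \<pi> i {w} s \<and> line_section M act \<pi> i {w} t \<longrightarrow>
           hermitian M \<pi> \<Phi> l1 s t w = complex_of_real (\<kappa> w) * hermitian M \<pi> \<Phi> l2 s t w))"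

end

theory Submission
  imports Defs "HOL-Complex_Analysis.Cauchy_Integral_Formula"
begin

text \<open>Over a chart of the base on which the bundle is trivial, write \<open>z\<^sub>j = exp (t\<^sub>j + i \<theta>\<^sub>j)\<close>. In the
coordinates \<open>(t + i \<theta>, w)\<close> the \<open>T\<close>-action is translation in \<open>\<theta>\<close>, and because \<open>\<omega>\<close> is of type
\<open>(1,1)\<close> the moment map determines every component of \<open>\<omega>\<close> with at least one fibre direction:
\<open>\<omega>(\<partial>/\<partial>\<theta>\<^sub>j, v) = - d\<phi>\<^sub>j v\<close> and \<open>\<omega>(\<partial>/\<partial>t\<^sub>j, v) = - d\<phi>\<^sub>j (i v)\<close>. In particular \<open>\<partial>\<phi>/\<partial>t\<close> is
symmetric and positive definite. Hence a level set \<open>\<Phi> = l\<close> that meets every fibre is, up to the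
action, the graph \<open>t = \<sigma>(w)\<close> of a smooth function \<open>\<sigma>\<close> (lemma \<open>section_smooth\<close>), and the reduced
form is the pullback of \<open>\<omega>\<close> along this graph (lemma \<open>level_form_eq_reduced_coeff\<close>).

Symmetry of \<open>\<partial>\<phi>/\<partial>t\<close> also gives a function \<open>\<rho>\<close> of \<open>(t, w)\<close> with \<open>\<partial>\<rho>/\<partial>t\<^sub>j = 2 \<phi>\<^sub>j\<close>, by integration
along rays in the fibre (lemma \<open>fibre_potential_exists\<close>). Then \<open>\<omega> - i \<partial>\<partial>\<close>-bar \<open>\<rho>\<close> vanishes on fibre
directions, and since it is closed it is the pullback of a form \<open>\<beta>\<close> on the base (lemma
\<open>basic_part_base\<close>); admissible potentials are the case \<open>\<beta> = 0\<close>. With \<open>s(w) = (\<sigma>(w), w)\<close> the chain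
rule gives
\<open>s\<^sup>*\<omega> = \<beta> + i \<partial>\<partial>\<close>-bar \<open>(\<rho> \<circ> s) - \<Sum> l\<^sub>j (2 i \<partial>\<partial>\<close>-bar \<open>\<sigma>\<^sub>j)\<close>
(lemma \<open>graph_form_decomposition\<close>): the last sum arises because \<open>d\<rho>\<close> has the constant value
\<open>2 l\<^sub>j\<close> in the direction \<open>\<partial>/\<partial>t\<^sub>j\<close> along the level set, and it multiplies the second derivatives
of \<open>\<sigma>\<^sub>j\<close>.

The metric of the \<open>j\<close>-th line bundle is \<open>exp (- 2 \<sigma>\<^sub>j)\<close> in the frame \<open>1/z\<^sub>j\<close> (lemma
\<open>hermitian_section\<close>), so that \<open>2 i \<partial>\<partial>\<close>-bar \<open>\<sigma>\<^sub>j\<close> is its curvature and the displayed identity is the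
Duistermaat-Heckman equation with \<open>\<mu> = \<beta> + i \<partial>\<partial>\<close>-bar \<open>(\<rho> \<circ> s)\<close>. Read backwards, this equation
defines \<open>\<mu>\<close> globally as \<open>\<omega>\<^sub>l + \<Sum> l\<^sub>j \<mu>\<^sub>j\<close>. For two levels the form \<open>\<beta>\<close> is the same, so
\<open>\<mu>\<^sub>1 - \<mu>\<^sub>2 = i \<partial>\<partial>\<close>-bar \<open>(\<rho> \<circ> s\<^sub>1 - \<rho> \<circ> s\<^sub>2)\<close>; and \<open>\<rho> \<circ> s\<^sub>1 - \<rho> \<circ> s\<^sub>2\<close> is a global function, the integral
of \<open>2 \<Sum> \<phi>\<^sub>j dt\<^sub>j\<close> along the fibre from one level to the other (lemma \<open>potential_gap_potential\<close>).
Thus \<open>\<nu>\<close> is \<open>i\<close> times \<open>\<partial>\<close>-bar of this function.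

Two analytic facts are proved on the way: complex differentiable functions of several variables
are smooth, by Cauchy's formula on complex lines, and mixed derivatives commute.\<close>

section \<open>Smooth maps\<close>

text \<open>Derivative of \<open>f\<close> at \<open>x\<close> in the direction \<open>v\<close>; all second order calculus below is done with
  iterated directional derivatives for constant directions.\<close>

abbreviation dd :: "('a::real_normed_vector \<Rightarrow> 'b::real_normed_vector) \<Rightarrow> 'a \<Rightarrow> 'a \<Rightarrow> 'b" where
  "dd f x v \<equiv> frechet_derivative f (at x) v"

lemma has_derivative_dd:
  "f differentiable (at x) \<Longrightarrow> (f has_derivative dd f x) (at x)"
  by (simp add: frechet_derivative_works)

lemma dd_eqI: "(f has_derivative f') (at x) \<Longrightarrow> dd f x v = f' v"
  by (metis frechet_derivative_at)

lemma linear_dd: "f differentiable (at x) \<Longrightarrow> linear (dd f x)"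
  using has_derivative_dd has_derivative_linear by blast

lemma differentiable_eq_open:
  assumes "open S" "x \<in> S" "\<And>y. y \<in> S \<Longrightarrow> f y = g y" "f differentiable (at x)"
  shows "g differentiable (at x)"
  using assms has_derivative_transform_within_open unfolding differentiable_def by blast

lemma has_derivative_eq_open:
  assumes "open S" "x \<in> S" "\<And>y. y \<in> S \<Longrightarrow> f y = g y"
  shows "(f has_derivative D) (at x) \<longleftrightarrow> (g has_derivative D) (at x)"
  using assms by (metis has_derivative_transform_within_open)

lemma dd_eq_open:
  assumes "open S" "x \<in> S" "\<And>y. y \<in> S \<Longrightarrow> f y = g y"
  shows "dd f x = dd g x"
  using has_derivative_eq_open[OF assms] by (simp add: frechet_derivative_def)

lemma Ck_on_eq:
  assumes "open S" "\<And>x. x \<in> S \<Longrightarrow> f x = g x" "Ck_on k S f"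
  shows "Ck_on k S g"
  using assms(2,3)
proof (induction k arbitrary: f g)
  case 0 then show ?case by (simp cong: continuous_on_cong)
next
  case (Suc k)
  have "Ck_on k S (\<lambda>x. dd g x v)" for v
  proof (rule Suc.IH[of "\<lambda>x. dd f x v"])
    show "dd f x v = dd g x v" if "x \<in> S" for x
      using dd_eq_open[OF assms(1) that, of f g] Suc.prems(1) by simp
    show "Ck_on k S (\<lambda>x. dd f x v)" using Suc.prems(2) by simp
  qed
  with Suc.prems show ?case
    using differentiable_eq_open[OF assms(1)] by (simp, blast)
qed

text \<open>Smoothness is shown by exhibiting a derivative whose value in each fixed direction is of class
  \<open>C\<^sup>k\<close>; uniqueness of the derivative connects it with the choice made by \<^const>\<open>frechet_derivative\<close>.\<close>

lemma Ck_on_SucI: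
  assumes "open S" "\<And>x. x \<in> S \<Longrightarrow> (f has_derivative f' x) (at x)"
    "\<And>v. Ck_on k S (\<lambda>x. f' x v)"
  shows "Ck_on (Suc k) S f"
proof -
  have "Ck_on k S (\<lambda>x. dd f x v)" for v
    by (rule Ck_on_eq[OF assms(1) _ assms(3)]) (simp add: dd_eqI[OF assms(2)])
  then show ?thesis using assms(2) by (auto simp: differentiable_def)
qed

lemma Ck_on_continuous: "Ck_on k S f \<Longrightarrow> continuous_on S f"
  by (cases k) (auto intro!: differentiable_imp_continuous_on differentiable_at_imp_differentiable_on)

lemma Ck_on_Suc_imp: "Ck_on (Suc k) S f \<Longrightarrow> Ck_on k S f"
proof (induction k arbitrary: f)
  case 0 then show ?case using Ck_on_continuous[of "Suc 0"] by simp
next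
  case (Suc k) then show ?case by (metis Ck_on.simps(2))
qed

lemma Ck_on_subset: "Ck_on k S f \<Longrightarrow> T \<subseteq> S \<Longrightarrow> Ck_on k T f"
  by (induction k arbitrary: f) (auto intro: continuous_on_subset)

lemma Ck_on_local:
  assumes "\<And>x. x \<in> S \<Longrightarrow> \<exists>N. open N \<and> x \<in> N \<and> Ck_on k N f"
  shows "Ck_on k S f"
  using assms
proof (induction k arbitrary: f)
  case 0
  then show ?case
    by (metis Ck_on.simps(1) continuous_at_imp_continuous_on continuous_on_eq_continuous_at)
next
  case (Suc k) then show ?case by (simp, metis)
qed

lemma Ck_on_const [intro]: "Ck_on k S (\<lambda>x. c)"
proof (induction k arbitrary: c)
  case 0 show ?case by simp
next
  case (Suc k) then show ?case by (simp add: frechet_derivative_const)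
qed

lemma Ck_on_bounded_linear:
  assumes "bounded_linear L" "open S" "Ck_on k S f"
  shows "Ck_on k S (\<lambda>x. L (f x))"
  using assms(3)
proof (induction k arbitrary: f)
  case 0 then show ?case using assms(1) by (simp add: linear_continuous_on_compose
      bounded_linear.continuous_on)
next
  case (Suc k)
  show ?case
    by (rule Ck_on_SucI[OF assms(2), where f' = "\<lambda>x v. L (dd f x v)"])
       (use Suc in \<open>auto intro!: bounded_linear.has_derivative[OF assms(1)] has_derivative_dd\<close>)
qed

lemma Ck_on_id: "open S \<Longrightarrow> Ck_on k S (\<lambda>x. x)"
proof (cases k)
  case (Suc k') assume "open S" then show ?thesis unfolding Suc
    by (intro Ck_on_SucI[where f' = "\<lambda>x v. v"]) auto
qed simp

lemma Ck_on_add: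
  assumes "open S" "Ck_on k S f" "Ck_on k S g"
  shows "Ck_on k S (\<lambda>x. f x + g x)"
  using assms(2,3)
proof (induction k arbitrary: f g)
  case 0 then show ?case by (simp add: continuous_on_add)
next
  case (Suc k)
  show ?case
    by (rule Ck_on_SucI[OF assms(1), where f' = "\<lambda>x v. dd f x v + dd g x v"])
       (use Suc in \<open>auto intro!: has_derivative_add has_derivative_dd\<close>)
qed

lemma Ck_on_bilinear:
  assumes B: "bounded_bilinear B" and "open S" "Ck_on k S f" "Ck_on k S g"
  shows "Ck_on k S (\<lambda>x. B (f x) (g x))"
  using assms(3,4)
proof (induction k arbitrary: f g)
  case 0 then show ?case by (simp add: bounded_bilinear.continuous_on[OF B])
next
  case (Suc k)
  have "Ck_on k S f" "Ck_on k S g" using Suc.prems Ck_on_Suc_imp by blast+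
  then show ?case
    by (intro Ck_on_SucI[OF assms(2), where f' = "\<lambda>x v. B (f x) (dd g x v) + B (dd f x v) (g x)"]
        Ck_on_add assms Suc.IH bounded_bilinear.FDERIV[OF B] has_derivative_dd)
       (use Suc.prems in auto)
qed

lemma smooth_on_bounded_linear:
  "bounded_linear L \<Longrightarrow> open S \<Longrightarrow> smooth_on S f \<Longrightarrow> smooth_on S (\<lambda>x. L (f x))"
  by (simp add: smooth_on_def Ck_on_bounded_linear)

lemma smooth_on_linear:
  fixes L :: "'a::euclidean_space \<Rightarrow> 'b::real_normed_vector"
  assumes "linear L" "open S" shows "smooth_on S L"
  using smooth_on_bounded_linear[of L S "\<lambda>x. x"] assms
  by (simp add: linear_conv_bounded_linear smooth_on_def Ck_on_id)

named_theorems smooth_intros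

lemma smooth_on_id [smooth_intros]: "open S \<Longrightarrow> smooth_on S (\<lambda>x. x)"
  by (simp add: smooth_on_def Ck_on_id)

lemma smooth_on_const [smooth_intros]: "smooth_on S (\<lambda>x. c)"
  by (auto simp add: smooth_on_def)

lemma smooth_on_add [smooth_intros]: "open S \<Longrightarrow> smooth_on S f \<Longrightarrow> smooth_on S g
    \<Longrightarrow> smooth_on S (\<lambda>x. f x + g x)"
  by (simp add: smooth_on_def Ck_on_add)

lemma smooth_on_mult [smooth_intros]:
  fixes f g :: "'a::euclidean_space \<Rightarrow> 'b::real_normed_algebra"
  shows "open S \<Longrightarrow> smooth_on S f \<Longrightarrow> smooth_on S g \<Longrightarrow> smooth_on S (\<lambda>x. f x * g x)"
  by (simp add: smooth_on_def Ck_on_bilinear[OF bounded_bilinear_mult])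

lemma smooth_on_scaleR [smooth_intros]:
  shows "open S \<Longrightarrow> smooth_on S f \<Longrightarrow> smooth_on S g \<Longrightarrow> smooth_on S (\<lambda>x. f x *\<^sub>R g x)"
  by (simp add: smooth_on_def Ck_on_bilinear[OF bounded_bilinear_scaleR])

lemma smooth_on_minus [smooth_intros]: "open S \<Longrightarrow> smooth_on S f \<Longrightarrow> smooth_on S (\<lambda>x. - f x)"
  by (rule smooth_on_bounded_linear[OF bounded_linear_minus[OF bounded_linear_ident]])

lemma smooth_on_diff [smooth_intros]: "open S \<Longrightarrow> smooth_on S f \<Longrightarrow> smooth_on S g
    \<Longrightarrow> smooth_on S (\<lambda>x. f x - g x)"
  using smooth_on_add[of S f "\<lambda>x. - g x"] by (simp add: smooth_on_minus)

lemma Ck_on_sum: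
  assumes "open S" "\<And>i. i \<in> I \<Longrightarrow> Ck_on k S (f i)"
  shows "Ck_on k S (\<lambda>x. \<Sum>i\<in>I. f i x)"
  using assms(2)
  by (induction I rule: infinite_finite_induct) (auto intro: Ck_on_add[OF assms(1)])

lemma Ck_on_prod:
  fixes f :: "_ \<Rightarrow> 'a::euclidean_space \<Rightarrow> 'b::{real_normed_algebra_1,comm_monoid_mult}"
  assumes "open S" "\<And>i. i \<in> I \<Longrightarrow> Ck_on k S (f i)"
  shows "Ck_on k S (\<lambda>x. \<Prod>i\<in>I. f i x)"
  using assms(2)
  by (induction I rule: infinite_finite_induct)
      (auto intro: Ck_on_bilinear[OF bounded_bilinear_mult assms(1)])

lemma smooth_on_sum [smooth_intros]:
  "open S \<Longrightarrow> (\<And>i. i \<in> I \<Longrightarrow> smooth_on S (f i)) \<Longrightarrow> smooth_on S (\<lambda>x. \<Sum>i\<in>I. f i x)"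
  by (simp add: smooth_on_def Ck_on_sum)

text \<open>In the chain rule the direction \<open>dd f x v\<close> depends on the point, so the derivative is not itself
  of the form covered by the induction hypothesis; expanding the direction in the standard basis
  turns it into a sum of products to which the hypothesis applies.\<close>

lemma Ck_on_compose:
  fixes f :: "'a::euclidean_space \<Rightarrow> 'b::euclidean_space"
  assumes "open S" "open T" "f ` S \<subseteq> T" "Ck_on k S f" "Ck_on k T g"
  shows "Ck_on k S (\<lambda>x. g (f x))"
  using assms(4,5)
proof (induction k arbitrary: g)
  case 0 then show ?case using assms(3) by (auto intro: continuous_on_compose2)
next
  case (Suc k)
  have *: "Ck_on k S f" "\<And>v. Ck_on k S (\<lambda>x. dd f x v)" using Suc.prems Ck_on_Suc_imp by auto
  have "dd g (f x) (dd f x v) = (\<Sum>i\<in>Basis. (dd f x v \<bullet> i) *\<^sub>R dd g (f x) i)" if "x \<in> S" for x v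
  proof -
    have lin: "linear (dd g (f x))" using Suc.prems that assms(3) by (intro linear_dd) auto
    have "dd g (f x) (dd f x v) = dd g (f x) (\<Sum>i\<in>Basis. (dd f x v \<bullet> i) *\<^sub>R i)"
      by (simp only: euclidean_representation)
    then show ?thesis by (simp add: linear_sum[OF lin] linear_scale[OF lin])
  qed
  moreover have "Ck_on k S (\<lambda>x. \<Sum>i\<in>Basis. (dd f x v \<bullet> i) *\<^sub>R dd g (f x) i)" for v
  proof (intro Ck_on_sum assms(1) Ck_on_bilinear[OF bounded_bilinear_scaleR])
    show "Ck_on k S (\<lambda>x. dd f x v \<bullet> i)" for i
      by (rule Ck_on_bounded_linear[OF bounded_linear_inner_left assms(1) *(2)])
    show "Ck_on k S (\<lambda>x. dd g (f x) i)" for i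
      by (rule Suc.IH[OF *(1)]) (use Suc.prems in auto)
  qed
  ultimately have "Ck_on k S (\<lambda>x. dd g (f x) (dd f x v))" for v
    using Ck_on_eq[OF assms(1)] by (metis (no_types, lifting))
  then show ?case
  proof (intro Ck_on_SucI[OF assms(1), where f' = "\<lambda>x v. dd g (f x) (dd f x v)"])
    fix x assume x: "x \<in> S"
    then have "f x \<in> T" using assms(3) by auto
    then show "((\<lambda>x. g (f x)) has_derivative (\<lambda>v. dd g (f x) (dd f x v))) (at x)"
      using Suc.prems x by (intro has_derivative_compose[OF has_derivative_dd has_derivative_dd]) auto
  qed
qed

lemma smooth_on_compose:
  fixes f :: "'a::euclidean_space \<Rightarrow> 'b::euclidean_space"
  assumes "open S" "open T" "f ` S \<subseteq> T" "smooth_on S f" "smooth_on T g"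
  shows "smooth_on S (\<lambda>x. g (f x))"
  using assms Ck_on_compose unfolding smooth_on_def by blast

lemma smooth_on_subset: "smooth_on S f \<Longrightarrow> T \<subseteq> S \<Longrightarrow> smooth_on T f"
  using Ck_on_subset unfolding smooth_on_def by blast

lemma smooth_on_eq:
  "open S \<Longrightarrow> (\<And>x. x \<in> S \<Longrightarrow> f x = g x) \<Longrightarrow> smooth_on S f \<Longrightarrow> smooth_on S g"
  using Ck_on_eq unfolding smooth_on_def by blast

lemma smooth_on_local:
  assumes "\<And>x. x \<in> S \<Longrightarrow> \<exists>N. open N \<and> x \<in> N \<and> smooth_on N f"
  shows "smooth_on S f"
  unfolding smooth_on_def using assms by (meson Ck_on_local smooth_on_def)

lemma smooth_on_differentiable: "smooth_on S f \<Longrightarrow> x \<in> S \<Longrightarrow> f differentiable (at x)"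
  unfolding smooth_on_def by (metis Ck_on.simps(2))

lemma smooth_on_dd [smooth_intros]: "smooth_on S f \<Longrightarrow> smooth_on S (\<lambda>x. dd f x v)"
  unfolding smooth_on_def by (metis Ck_on.simps(2))

lemma smooth_on_continuous: "smooth_on S f \<Longrightarrow> continuous_on S f"
  unfolding smooth_on_def by (metis Ck_on.simps(1))

lemma smooth_on_has_derivative: "smooth_on S f \<Longrightarrow> x \<in> S \<Longrightarrow> (f has_derivative dd f x) (at x)"
  by (simp add: has_derivative_dd smooth_on_differentiable)

lemma smooth_on_vec_nth:
  fixes f :: "'a::euclidean_space \<Rightarrow> 'b::euclidean_space^'n"
  shows "open S \<Longrightarrow> smooth_on S f \<Longrightarrow> smooth_on S (\<lambda>x. f x $ i)"
  by (rule smooth_on_bounded_linear[OF bounded_linear_vec_nth])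

lemma bounded_linear_axis: "bounded_linear (\<lambda>b::'b::euclidean_space. axis (i::'n::finite) b)"
proof -
  have "linear (\<lambda>b::'b. axis i b)"
    by (rule linearI) (simp_all add: vec_eq_iff axis_def)
  then show ?thesis by (simp add: linear_conv_bounded_linear)
qed

lemma Ck_on_vec:
  fixes f :: "'n::finite \<Rightarrow> 'a::euclidean_space \<Rightarrow> 'b::euclidean_space"
  assumes "open S" "\<And>i. Ck_on k S (f i)"
  shows "Ck_on k S (\<lambda>x. \<chi> i. f i x)"
proof -
  have "Ck_on k S (\<lambda>x. \<Sum>i\<in>UNIV. axis i (f i x))"
    by (intro Ck_on_sum assms Ck_on_bounded_linear[OF bounded_linear_axis])
  moreover have "(\<Sum>i\<in>UNIV. axis i (f i x)) = (\<chi> i. f i x)" for x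
    by (simp add: vec_eq_iff axis_def)
  ultimately show ?thesis by simp
qed

lemma smooth_on_vec:
  fixes f :: "'n::finite \<Rightarrow> 'a::euclidean_space \<Rightarrow> 'b::euclidean_space"
  shows "open S \<Longrightarrow> (\<And>i. smooth_on S (f i)) \<Longrightarrow> smooth_on S (\<lambda>x. \<chi> i. f i x)"
  by (simp add: Ck_on_vec smooth_on_def)

text \<open>The derivative of the inverse is a product containing the inverse itself, so that the class of
  differentiability increases by one in each step.\<close>

lemma Ck_on_inverse:
  fixes f :: "'a::euclidean_space \<Rightarrow> 'b::real_normed_field"
  assumes "open S" "\<And>x. x \<in> S \<Longrightarrow> f x \<noteq> 0" "Ck_on k S f"
  shows "Ck_on k S (\<lambda>x. inverse (f x))"
  using assms(3)
proof (induction k)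
  case 0 then show ?case using assms(2) by (simp add: continuous_on_inverse)
next
  case (Suc k)
  then have *: "Ck_on k S (\<lambda>x. inverse (f x))" using Ck_on_Suc_imp by blast
  have m: "bounded_linear (\<lambda>y::'b. - y)" by (rule bounded_linear_minus[OF bounded_linear_ident])
  show ?case
  proof (rule Ck_on_SucI[OF assms(1), where f' = "\<lambda>x v. - (inverse (f x) * dd f x v * inverse (f x))"])
    show "((\<lambda>x. inverse (f x)) has_derivative (\<lambda>v. - (inverse (f x) * dd f x v * inverse (f x))))
        (at x)"
      if "x \<in> S" for x
      using Suc.prems assms(2) that by (intro Deriv.has_derivative_inverse has_derivative_dd) auto
    show "Ck_on k S (\<lambda>x. - (inverse (f x) * dd f x v * inverse (f x)))" for v
      using Suc.prems * by (intro Ck_on_bounded_linear[OF m]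
          Ck_on_bilinear[OF bounded_bilinear_mult] assms(1)) auto
  qed
qed

lemma smooth_on_inverse:
  fixes f :: "'a::euclidean_space \<Rightarrow> 'b::real_normed_field"
  shows "open S \<Longrightarrow> (\<And>x. x \<in> S \<Longrightarrow> f x \<noteq> 0) \<Longrightarrow> smooth_on S f \<Longrightarrow> smooth_on S (\<lambda>x. inverse (f x))"
  by (simp add: Ck_on_inverse smooth_on_def)

lemma Ck_on_exp:
  fixes f :: "'a::euclidean_space \<Rightarrow> 'b::{banach,real_normed_field}"
  assumes "open S" "Ck_on k S f"
  shows "Ck_on k S (\<lambda>x. exp (f x))"
  using assms(2)
proof (induction k)
  case 0 then show ?case by (simp add: continuous_on_exp)
next
  case (Suc k)
  then have *: "Ck_on k S (\<lambda>x. exp (f x))" using Ck_on_Suc_imp by blast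
  show ?case
    by (rule Ck_on_SucI[OF assms(1), where f' = "\<lambda>x v. exp (f x) * dd f x v"])
       (use Suc.prems * in \<open>auto intro!: Ck_on_bilinear[OF bounded_bilinear_mult] assms(1)
          has_derivative_compose[OF has_derivative_dd DERIV_exp[unfolded has_field_derivative_def]]\<close>)
qed

lemma smooth_on_exp:
  fixes f :: "'a::euclidean_space \<Rightarrow> 'b::{banach,real_normed_field}"
  shows "open S \<Longrightarrow> smooth_on S f \<Longrightarrow> smooth_on S (\<lambda>x. exp (f x))"
  by (simp add: Ck_on_exp smooth_on_def)

lemma Ck_on_ln:
  fixes f :: "'a::euclidean_space \<Rightarrow> real"
  assumes "open S" "\<And>x. x \<in> S \<Longrightarrow> f x > 0" "Ck_on k S f"
  shows "Ck_on k S (\<lambda>x. ln (f x))"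
proof (cases k)
  case 0 then show ?thesis using assms(2,3) by (force intro!: continuous_on_ln)
next
  case (Suc k')
  then have f: "Ck_on k' S f" "\<And>x. x \<in> S \<Longrightarrow> f differentiable at x" "\<And>v. Ck_on k' S (\<lambda>x. dd f x v)"
    using assms(3) Ck_on_Suc_imp by auto
  have d: "((\<lambda>x. ln (f x)) has_derivative (\<lambda>v. inverse (f x) * dd f x v)) (at x)" if "x \<in> S" for x
  proof -
    have "(ln has_derivative (*) (inverse (f x))) (at (f x))"
      using DERIV_ln[OF assms(2)[OF that]] by (simp add: has_field_derivative_def)
    from has_derivative_compose[OF has_derivative_dd[OF f(2)[OF that]] this]
    show ?thesis by simp
  qed
  show ?thesis unfolding Suc
    by (rule Ck_on_SucI[OF assms(1), where f' = "\<lambda>x v. inverse (f x) * dd f x v"])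
       (use d f Ck_on_inverse[OF assms(1) _ f(1)] assms(2) in 
         \<open>force intro!: Ck_on_bilinear[OF bounded_bilinear_mult] assms(1)\<close>)+
qed

lemma smooth_on_ln:
  fixes f :: "'a::euclidean_space \<Rightarrow> real"
  shows "open S \<Longrightarrow> (\<And>x. x \<in> S \<Longrightarrow> f x > 0) \<Longrightarrow> smooth_on S f \<Longrightarrow> smooth_on S (\<lambda>x. ln (f x))"
  by (simp add: Ck_on_ln smooth_on_def)

section \<open>Mixed derivatives, parameter integrals and smoothness of holomorphic maps\<close>

lemma dd_line:
  assumes "f differentiable (at (x + t *\<^sub>R v))"
  shows "((\<lambda>t. f (x + t *\<^sub>R v)) has_vector_derivative dd f (x + t *\<^sub>R v) v) (at t)"
proof -
  have "((\<lambda>t. x + t *\<^sub>R v) has_derivative (\<lambda>h. h *\<^sub>R v)) (at t)"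
    by (auto intro!: derivative_eq_intros)
  from has_derivative_compose[OF this has_derivative_dd[OF assms]]
  show ?thesis unfolding has_vector_derivative_def
    by (simp add: linear_scale[OF linear_dd[OF assms]])
qed

text \<open>The mean value theorem in the direction \<open>u\<close> and then in the direction \<open>v\<close>. The second difference
  is symmetric in \<open>u\<close> and \<open>v\<close>, which is what makes the mixed derivatives agree in the limit.\<close>

lemma second_difference:
  fixes f :: "'a::euclidean_space \<Rightarrow> real"
  assumes "0 < h" "smooth_on S f"
    and S: "\<And>s t. \<lbrakk>0 \<le> s; s \<le> h; 0 \<le> t; t \<le> h\<rbrakk> \<Longrightarrow> x + s *\<^sub>R u + t *\<^sub>R v \<in> S"
  shows "\<exists>s t. 0 \<le> s \<and> s \<le> h \<and> 0 \<le> t \<and> t \<le> h \<and>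
    f (x + h *\<^sub>R u + h *\<^sub>R v) - f (x + h *\<^sub>R u) - f (x + h *\<^sub>R v) + f x
    = h * h * dd (\<lambda>y. dd f y u) (x + s *\<^sub>R u + t *\<^sub>R v) v"
proof -
  define a where "a s = f (x + h *\<^sub>R v + s *\<^sub>R u) - f (x + s *\<^sub>R u)" for s
  have da: "(a has_real_derivative dd f (x + h *\<^sub>R v + s *\<^sub>R u) u - dd f (x + s *\<^sub>R u) u) (at s)"
    if "0 \<le> s" "s \<le> h" for s
    unfolding a_def has_real_derivative_iff_has_vector_derivative
    by (intro has_vector_derivative_diff dd_line smooth_on_differentiable[OF assms(2)])
       (use S[OF that, of h] S[OF that, of 0] \<open>0 < h\<close> in \<open>auto simp: algebra_simps\<close>)
  obtain s where s: "0 < s" "s < h"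
    "a h - a 0 = (h - 0) * (dd f (x + h *\<^sub>R v + s *\<^sub>R u) u - dd f (x + s *\<^sub>R u) u)"
    using MVT2[OF \<open>0 < h\<close> da] by blast
  have db: "((\<lambda>t. dd f (x + s *\<^sub>R u + t *\<^sub>R v) u) has_real_derivative
        dd (\<lambda>y. dd f y u) (x + s *\<^sub>R u + t *\<^sub>R v) v) (at t)" if "0 \<le> t" "t \<le> h" for t
    unfolding has_real_derivative_iff_has_vector_derivative
    by (intro dd_line smooth_on_differentiable[OF smooth_on_dd[OF assms(2)]] S)
       (use s that in auto)
  obtain t where t: "0 < t" "t < h"
    "dd f (x + s *\<^sub>R u + h *\<^sub>R v) u - dd f (x + s *\<^sub>R u + 0 *\<^sub>R v) u
      = (h - 0) * dd (\<lambda>y. dd f y u) (x + s *\<^sub>R u + t *\<^sub>R v) v"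
    using MVT2[OF \<open>0 < h\<close> db] by blast
  have "f (x + h *\<^sub>R u + h *\<^sub>R v) - f (x + h *\<^sub>R u) - f (x + h *\<^sub>R v) + f x = a h - a 0"
    by (simp add: a_def algebra_simps)
  also have "\<dots> = h * (h * dd (\<lambda>y. dd f y u) (x + s *\<^sub>R u + t *\<^sub>R v) v)"
    using s(3) t(3) by (simp add: algebra_simps)
  finally show ?thesis using s t by (intro exI[of _ s] exI[of _ t]) auto
qed

lemma dd_symmetric_real:
  fixes f :: "'a::euclidean_space \<Rightarrow> real"
  assumes "open S" "smooth_on S f" "x \<in> S"
  shows "dd (\<lambda>y. dd f y v) x u = dd (\<lambda>y. dd f y u) x v"
proof (rule ccontr)
  define A where "A = (\<lambda>y. dd (\<lambda>y. dd f y v) y u)"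
  define B where "B = (\<lambda>y. dd (\<lambda>y. dd f y u) y v)"
  assume "dd (\<lambda>y. dd f y v) x u \<noteq> dd (\<lambda>y. dd f y u) x v"
  then have ne: "A x \<noteq> B x" by (simp add: A_def B_def)
  define e where "e = \<bar>A x - B x\<bar> / 2"
  have e: "e > 0" using ne by (simp add: e_def)
  have "isCont A x" "isCont B x"
    using smooth_on_continuous[OF smooth_on_dd[OF smooth_on_dd[OF assms(2)]]] assms
    by (auto simp: A_def B_def continuous_on_eq_continuous_at)
  then have "\<exists>d>0. \<forall>y. dist y x < d \<longrightarrow> dist (A y) (A x) < e"
    "\<exists>d>0. \<forall>y. dist y x < d \<longrightarrow> dist (B y) (B x) < e"
    using e unfolding continuous_at_eps_delta by blast+
  then obtain d1 d2 where d1: "d1 > 0" "\<And>y. dist y x < d1 \<Longrightarrow> dist (A y) (A x) < e"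
    and d2: "d2 > 0" "\<And>y. dist y x < d2 \<Longrightarrow> dist (B y) (B x) < e" by blast
  obtain r where r: "r > 0" "ball x r \<subseteq> S" using assms openE by blast
  define d where "d = min r (min d1 d2)"
  define h where "h = d / (2 * (norm u + norm v + 1))"
  have d: "d > 0" using d1 d2 r by (simp add: d_def)
  have nn: "norm u + norm v + 1 > 0" by (simp add: add_nonneg_pos)
  have h: "h > 0" unfolding h_def using d nn by simp
  have close: "dist (x + s *\<^sub>R u + t *\<^sub>R v) x < d" if "0 \<le> s" "s \<le> h" "0 \<le> t" "t \<le> h" for s t
  proof -
    have "dist (x + s *\<^sub>R u + t *\<^sub>R v) x = norm (s *\<^sub>R u + t *\<^sub>R v)" by (simp add: dist_norm)
    also have "\<dots> \<le> s * norm u + t * norm v"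
      using norm_triangle_ineq[of "s *\<^sub>R u" "t *\<^sub>R v"] that by simp
    also have "\<dots> \<le> h * norm u + h * norm v"
      using that by (intro add_mono mult_right_mono) auto
    also have "\<dots> \<le> h * (norm u + norm v + 1)" using h by (simp add: algebra_simps)
    also have "\<dots> = d / 2" using nn by (simp add: h_def field_simps)
    also have "\<dots> < d" using d by simp
    finally show ?thesis .
  qed
  have inS: "x + s *\<^sub>R u + t *\<^sub>R v \<in> S" if "0 \<le> s" "s \<le> h" "0 \<le> t" "t \<le> h" for s t
    using close[OF that] r(2) by (auto simp: d_def dist_commute)
  have inS': "x + s *\<^sub>R v + t *\<^sub>R u \<in> S" if "0 \<le> s" "s \<le> h" "0 \<le> t" "t \<le> h" for s t
    using inS[of t s] that by (simp add: algebra_simps)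
  obtain s t where 1: "0 \<le> s" "s \<le> h" "0 \<le> t" "t \<le> h"
    "f (x + h *\<^sub>R u + h *\<^sub>R v) - f (x + h *\<^sub>R u) - f (x + h *\<^sub>R v) + f x
        = h * h * B (x + s *\<^sub>R u + t *\<^sub>R v)"
    using second_difference[OF h assms(2) inS] unfolding B_def by blast
  obtain t' s' where 2: "0 \<le> s'" "s' \<le> h" "0 \<le> t'" "t' \<le> h"
    "f (x + h *\<^sub>R v + h *\<^sub>R u) - f (x + h *\<^sub>R v) - f (x + h *\<^sub>R u) + f x
        = h * h * A (x + t' *\<^sub>R v + s' *\<^sub>R u)"
    using second_difference[OF h assms(2) inS'] unfolding A_def by blast
  have "h * h * A (x + s' *\<^sub>R u + t' *\<^sub>R v) = h * h * B (x + s *\<^sub>R u + t *\<^sub>R v)"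
    using 1(5) 2(5) by (auto simp add: algebra_simps)
  then have "A (x + s' *\<^sub>R u + t' *\<^sub>R v) = B (x + s *\<^sub>R u + t *\<^sub>R v)"
    using mult_left_cancel[of "h * h"] h by (metis less_irrefl mult_eq_0_iff)
  moreover have "\<bar>A (x + s' *\<^sub>R u + t' *\<^sub>R v) - A x\<bar> < e"
    using d1(2)[of "x + s' *\<^sub>R u + t' *\<^sub>R v"] close[OF 2(1-4)] by (simp add: d_def dist_real_def)
  moreover have "\<bar>B (x + s *\<^sub>R u + t *\<^sub>R v) - B x\<bar> < e"
    using d2(2)[of "x + s *\<^sub>R u + t *\<^sub>R v"] close[OF 1(1-4)] by (simp add: d_def dist_real_def)
  ultimately show False unfolding e_def by (simp add: abs_if split: if_splits)
qed

lemma dd_bounded_linear: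
  assumes "bounded_linear L" "f differentiable (at x)"
  shows "dd (\<lambda>x. L (f x)) x v = L (dd f x v)"
  by (rule dd_eqI[OF bounded_linear.has_derivative[OF assms(1) has_derivative_dd[OF assms(2)]]])

lemma dd_symmetric:
  fixes f :: "'a::euclidean_space \<Rightarrow> 'b::euclidean_space"
  assumes "open S" "smooth_on S f" "x \<in> S"
  shows "dd (\<lambda>y. dd f y v) x u = dd (\<lambda>y. dd f y u) x v"
proof (rule euclidean_eqI)
  fix i :: 'b
  have L: "bounded_linear (\<lambda>y::'b. y \<bullet> i)" by (rule bounded_linear_inner_left)
  have *: "dd (\<lambda>y. dd f y v) x u \<bullet> i = dd (\<lambda>y. dd (\<lambda>y. f y \<bullet> i) y v) x u" for u v
  proof -
    have "dd (\<lambda>y. dd f y v) x u \<bullet> i = dd (\<lambda>y. dd f y v \<bullet> i) x u"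
      by (rule dd_bounded_linear[OF L, symmetric])
         (rule smooth_on_differentiable[OF smooth_on_dd[OF assms(2)] assms(3)])
    also have "\<dots> = dd (\<lambda>y. dd (\<lambda>y. f y \<bullet> i) y v) x u"
      by (rule fun_cong[OF dd_eq_open[OF assms(1,3)]])
         (simp add: dd_bounded_linear[OF L] smooth_on_differentiable[OF assms(2)])
    finally show ?thesis .
  qed
  show "dd (\<lambda>y. dd f y v) x u \<bullet> i = dd (\<lambda>y. dd f y u) x v \<bullet> i"
    unfolding * by (rule dd_symmetric_real[OF assms(1) smooth_on_bounded_linear[OF L assms(1,2)]
        assms(3)])
qed

text \<open>The integrand is a function on the product of the parameter interval and the space, so that one
  notion of smoothness covers joint smoothness; its partial derivatives are those in the directions
  \<open>(0, v)\<close>.\<close>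

lemma has_derivative_integral:
  fixes f :: "real \<times> 'a::euclidean_space \<Rightarrow> 'b::euclidean_space"
  assumes "open S" and sub: "{0..1} \<times> S \<subseteq> W" and Ck: "Ck_on (Suc k) W f" and x: "x \<in> S"
  shows "((\<lambda>x. integral {0..1} (\<lambda>t. f (t, x))) has_derivative
        (\<lambda>v. integral {0..1} (\<lambda>t. dd f (t, x) (0, v)))) (at x)"
proof -
  have df: "f differentiable (at p)" if "p \<in> W" for p using Ck that by simp
  have cdf: "continuous_on W (\<lambda>p. dd f p v)" for v
    using Ck by (intro Ck_on_continuous[of k]) (simp only: Ck_on.simps)
  define fx where "fx x t = Blinfun (\<lambda>v. dd f (t, x) (0, v))" for x t
  have bl: "bounded_linear (\<lambda>v. dd f (t, x) (0, v))" if "t \<in> {0..1}" "x \<in> S" for t x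
  proof -
    have l1: "linear (dd f (t, x))" using sub that by (intro linear_dd df) auto
    have l2: "linear (\<lambda>v::'a. (0::real, v))" by (rule linearI) simp_all
    have "linear (\<lambda>v. dd f (t, x) (0, v))" using linear_compose[OF l2 l1] by (simp add: o_def)
    then show ?thesis by (simp add: linear_conv_bounded_linear)
  qed
  have fx: "blinfun_apply (fx x t) v = dd f (t, x) (0, v)" if "t \<in> {0..1}" "x \<in> S" for t x v
    unfolding fx_def using bounded_linear_Blinfun_apply[OF bl[OF that]] by simp
  obtain r where r: "r > 0" "ball x r \<subseteq> S" using assms(1) x openE by blast
  have rW: "(t, y) \<in> W" if "t \<in> {0..1}" "y \<in> ball x r" for t y
    using r(2) sub that by blast
  have c: "continuous_on (ball x r \<times> cbox 0 1) (\<lambda>(x, t). fx x t)"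
  proof (rule continuous_on_blinfun_componentwise)
    fix i :: 'a
    have "continuous_on (ball x r \<times> cbox 0 1) (\<lambda>p. dd f (snd p, fst p) (0, i))"
      by (rule continuous_on_compose2[OF cdf]) (use rW in \<open>auto intro!: continuous_intros\<close>)
    then show "continuous_on (ball x r \<times> cbox 0 1) (\<lambda>p. blinfun_apply (case p of (x, t) \<Rightarrow> fx x t) i)"
      using r(2) by (subst continuous_on_cong[OF refl]) (auto simp: fx)
  qed
  have c0: "continuous_on (cbox 0 1) (\<lambda>t. f (t, y))" if "y \<in> S" for y
    by (rule continuous_on_compose2[of W f])
        (use Ck[THEN Ck_on_continuous] sub that in \<open>auto intro!: continuous_intros\<close>)
  have "((\<lambda>x. integral (cbox 0 1) (\<lambda>t. f (t, x))) has_derivative integral (cbox 0 1) (fx x))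
      (at x within ball x r)"
  proof (rule leibniz_rule[OF _ _ c])
    fix y t assume y: "y \<in> ball x r" and t: "t \<in> cbox (0::real) 1"
    then have yS: "y \<in> S" using r by auto
    have "((\<lambda>x. (t, x)) has_derivative (\<lambda>v. (0, v))) (at y within ball x r)"
      by (auto intro!: derivative_eq_intros)
    moreover have "(f has_derivative dd f (t, y)) (at (t, y) within UNIV)"
      using has_derivative_dd[OF df[OF rW[OF _ y]]] t by simp
    ultimately have "((\<lambda>x. f (t, x)) has_derivative (\<lambda>v. dd f (t, y) (0, v))) (at y within ball x r)"
      using has_derivative_compose[of "\<lambda>x. (t, x)" _ y "ball x r" f] by blast
    moreover have "blinfun_apply (fx y t) = (\<lambda>v. dd f (t, y) (0, v))"
      using fx[OF _ yS] t by (intro ext) simp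
    ultimately show "((\<lambda>x. f (t, x)) has_derivative blinfun_apply (fx y t)) (at y within ball x r)"
      by simp
  next
    fix y assume "y \<in> ball x r"
    then show "(\<lambda>t. f (t, y)) integrable_on cbox 0 1"
      using c0 r by (intro integrable_continuous) auto
  qed (use r in auto)
  then have "((\<lambda>x. integral {0..1} (\<lambda>t. f (t, x))) has_derivative integral {0..1} (fx x)) (at x)"
    unfolding at_within_open[OF centre_in_ball[THEN iffD2, OF r(1)] open_ball] by simp
  moreover have "blinfun_apply (integral {0..1} (fx x))
      = (\<lambda>v. integral {0..1} (\<lambda>t. dd f (t, x) (0, v)))"
  proof
    fix v
    have "continuous_on {0..1} (\<lambda>t. (case (x, t) of (x, t) \<Rightarrow> fx x t))"
      by (rule continuous_on_compose2[OF c]) (use r in \<open>auto intro!: continuous_intros\<close>)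
    then have "fx x integrable_on {0..1}"
      by (intro integrable_continuous_interval) simp
    from blinfun_apply_integral[OF this, of v]
    have "blinfun_apply (integral {0..1} (fx x)) v = integral {0..1} (\<lambda>t. blinfun_apply (fx x t) v)" .
    also have "\<dots> = integral {0..1} (\<lambda>t. dd f (t, x) (0, v))"
      by (rule integral_cong) (rule fx[OF _ x])
    finally show "blinfun_apply (integral {0..1} (fx x)) v = integral {0..1} (\<lambda>t. dd f (t, x) (0, v))" .
  qed
  ultimately show ?thesis by simp
qed

lemma Ck_on_integral:
  fixes f :: "real \<times> 'a::euclidean_space \<Rightarrow> 'b::euclidean_space"
  assumes "open S" and sub: "{0..1} \<times> S \<subseteq> W" and "Ck_on k W f"
  shows "Ck_on k S (\<lambda>x. integral {0..1} (\<lambda>t. f (t, x)))"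
  using assms(3)
proof (induction k arbitrary: f)
  case 0
  have "continuous_on (S \<times> cbox 0 1) (\<lambda>p. f (snd p, fst p))"
    by (rule continuous_on_compose2[of W f]) (use 0 sub in \<open>auto intro!: continuous_intros\<close>)
  then have "continuous_on (S \<times> cbox 0 1) (\<lambda>(x, t). f (t, x))" by (simp add: case_prod_beta')
  from integral_continuous_on_param[OF this] show ?case by simp
next
  case (Suc k)
  have "Ck_on k S (\<lambda>x. integral {0..1} (\<lambda>t. dd f (t, x) (0, v)))" for v
    using Suc.IH[of "\<lambda>p. dd f p (0, v)"] Suc.prems by simp
  then show ?case
    using Ck_on_SucI[OF assms(1) has_derivative_integral[OF assms(1) sub Suc.prems]] by blast
qed

lemma bounded_linear_vector_scalar: "bounded_linear (\<lambda>a::complex. a *s (v::complex^'k))"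
proof -
  have "linear (\<lambda>a::complex. a *s v)"
    by (rule linearI) (simp_all add: vector_add_ldistrib vector_sadd_rdistrib vec_eq_iff)
  then show ?thesis by (simp add: linear_conv_bounded_linear)
qed

text \<open>On the complex line through \<open>x\<close> in the direction \<open>v\<close>, Cauchy's formula expresses \<open>dd f x v\<close> as an
  integral over a circle of values of \<open>f\<close>. Hence \<open>dd f x v\<close> is as smooth in \<open>x\<close> as \<open>f\<close> is, and
  starting from continuity \<open>f\<close> is smooth.\<close>

lemma complex_differentiable_smooth_on:
  fixes f :: "complex^'k \<Rightarrow> complex"
  assumes S: "open S"
    and holo: "\<And>x. x \<in> S \<Longrightarrow> \<exists>D. (f has_derivative D) (at x) \<and> (\<forall>a v. D (a *s v) = a * D v)"
  shows "smooth_on S f"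
proof -
  have df: "f differentiable (at x)" "dd f x (a *s v) = a * dd f x v" if "x \<in> S" for x a v
    using holo[OF that] by (auto simp: differentiable_def dd_eqI)
  have line: "((\<lambda>a. f (x + a *s v)) has_field_derivative dd f (x + a *s v) v) (at a)"
    if "x + a *s v \<in> S" for x v a
  proof -
    have "((\<lambda>a. x + a *s v) has_derivative (\<lambda>h. h *s v)) (at a)"
      using bounded_linear_imp_has_derivative[OF bounded_linear_vector_scalar[of v]]
      by (subst add.commute) (rule has_derivative_add_const)
    from has_derivative_compose[OF this has_derivative_dd[OF df(1)[OF that]]]
    moreover have "(\<lambda>h. dd f (x + a *s v) (h *s v)) = (*) (dd f (x + a *s v) v)"
      using df(2)[OF that] by (auto simp: mult.commute)
    ultimately show ?thesis unfolding has_field_derivative_def by simp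
  qed
  have cont: "continuous_on S f"
    by (intro differentiable_imp_continuous_on differentiable_at_imp_differentiable_on df)
  have "Ck_on k S f" for k
  proof (induction k)
    case 0 then show ?case using cont by simp
  next
    case (Suc k)
    have "\<exists>N. open N \<and> x0 \<in> N \<and> Ck_on k N (\<lambda>x. dd f x v)" if x0: "x0 \<in> S" for x0 v
    proof -
      obtain R where R: "R > 0" "ball x0 R \<subseteq> S" using S x0 openE by blast
      obtain K where K: "K > 0" "\<And>a. norm (a *s v) \<le> norm a * K"
        using bounded_linear.pos_bounded[OF bounded_linear_vector_scalar[of v]] by blast
      \<comment> \<open>For every centre in the smaller ball the circle of this radius in the direction of v stays
          in S.\<close>
      define r where "r = R / (2 * K)"
      have r: "r > 0" using R K by (simp add: r_def)
      have inS: "x + a *s v \<in> S" if "x \<in> ball x0 (R/2)" "norm a \<le> r" for x a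
      proof -
        have "norm (a *s v) \<le> r * K" using K that(2) mult_right_mono[OF that(2), of K]
            order_trans[OF K(2)] by simp
        also have "\<dots> = R / 2" using K by (simp add: r_def)
        finally have "norm (a *s v) \<le> R / 2" .
        moreover have "dist x0 (x + a *s v) \<le> dist x0 x + norm (a *s v)"
          using dist_triangle[of x0 "x + a *s v" x] by (simp add: dist_norm)
        ultimately have "x + a *s v \<in> ball x0 R" using that(1) by simp
        then show ?thesis using R by blast
      qed
      define c where "c t = of_real r * exp (2 * of_real pi * \<i> * of_real t)" for t :: real
      have c: "norm (c t) = r" "c t \<noteq> 0" for t
        using r by (auto simp: c_def norm_mult mult.assoc mult.left_commute)
      define F where "F p = f (snd p + c (fst p) *s v) * inverse (c (fst p))" for p
      define W where "W = {p. snd p + c (fst p) *s v \<in> S}"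
      have smc: "smooth_on UNIV c"
        unfolding c_def
        by (intro smooth_intros smooth_on_exp open_UNIV smooth_on_linear)
           (rule bounded_linear.linear[OF bounded_linear_of_real])
      have fst: "smooth_on UNIV (\<lambda>p::real \<times> (complex^'k). c (fst p))"
        by (rule smooth_on_compose[OF open_UNIV open_UNIV _ _ smc])
           (auto intro: smooth_on_linear linear_fst)
      have arg: "smooth_on UNIV (\<lambda>p::real \<times> (complex^'k). snd p + c (fst p) *s v)"
        by (intro smooth_intros open_UNIV smooth_on_linear linear_snd
            smooth_on_bounded_linear[OF bounded_linear_vector_scalar _ fst])
      have oW: "open W"
        using open_vimage[OF S smooth_on_continuous[OF arg]] by (simp add: W_def vimage_def)
      have "Ck_on k W (\<lambda>p. f (snd p + c (fst p) *s v))"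
      proof (rule Ck_on_compose[OF oW S _ _ Suc.IH])
        have "Ck_on k UNIV (\<lambda>p. snd p + c (fst p) *s v)"
          using arg unfolding smooth_on_def by blast
        then show "Ck_on k W (\<lambda>p. snd p + c (fst p) *s v)"
          by (rule Ck_on_subset) simp
      qed (auto simp: W_def)
      moreover have "Ck_on k W (\<lambda>p. inverse (c (fst p)))"
      proof (rule Ck_on_inverse[OF oW])
        have "Ck_on k UNIV (\<lambda>p::real \<times> (complex^'k). c (fst p))"
          using fst unfolding smooth_on_def by blast
        then show "Ck_on k W (\<lambda>p. c (fst p))" by (rule Ck_on_subset) simp
      qed (rule c(2))
      ultimately have "Ck_on k W F"
        unfolding F_def by (intro Ck_on_bilinear[OF bounded_bilinear_mult oW])
      then have "Ck_on k (ball x0 (R/2)) (\<lambda>x. integral {0..1} (\<lambda>t. F (t, x)))"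
        by (rule Ck_on_integral[rotated 2]) (use inS c in \<open>auto simp: W_def\<close>)
      moreover have "integral {0..1} (\<lambda>t. F (t, x)) = dd f x v" if x: "x \<in> ball x0 (R/2)" for x
      proof -
        let ?g = "\<lambda>a. f (x + a *s v)"
        have g: "(?g has_field_derivative dd f (x + a *s v) v) (at a)" if "norm a \<le> r" for a
          by (rule line[OF inS[OF x that]])
        have gc: "continuous_on (cball 0 r) ?g"
          by (rule DERIV_continuous_on, rule has_field_derivative_at_within, rule g) simp
        have gh: "?g holomorphic_on ball 0 r"
        proof (rule holomorphic_onI)
          fix a :: complex assume "a \<in> ball 0 r"
          then have "norm a \<le> r" by simp
          then show "?g field_differentiable at a within ball 0 r"
            using has_field_derivative_at_within[OF g] unfolding field_differentiable_def by blast
        qed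
        have "dd f (x + 0 *s v) v = 1 / (2 * of_real pi * \<i>) * contour_integral (circlepath 0 r)
            (\<lambda>u. ?g u / (u - 0)^2)"
          by (rule DERIV_unique[OF g Cauchy_derivative_integral_circlepath(2)[OF gc gh]])
              (use r in auto)
        also have "\<dots> = 1 / (2 * of_real pi * \<i>) * integral {0..1} (\<lambda>t. 2 * of_real pi * \<i> * F (t, x))"
        proof -
          have "?g (circlepath 0 r t) / (circlepath 0 r t - 0)\<^sup>2 * vector_derivative
              (circlepath 0 r) (at t)
            = 2 * of_real pi * \<i> * F (t, x)" for t
          proof -
            have 1: "circlepath 0 r t = c t" by (simp add: circlepath c_def)
            have 2: "vector_derivative (circlepath 0 r) (at t) = 2 * of_real pi * \<i> * c t"
              by (simp add: vector_derivative_circlepath c_def)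
            show ?thesis
              unfolding 1 2 using c(2)[of t] by (simp add: F_def power2_eq_square field_simps)
          qed
          then show ?thesis unfolding contour_integral_integral by simp
        qed
        also have "\<dots> = integral {0..1} (\<lambda>t. F (t, x))" by simp
        finally show ?thesis by simp
      qed
      ultimately have "Ck_on k (ball x0 (R/2)) (\<lambda>x. dd f x v)"
        by (rule Ck_on_eq[OF open_ball, rotated])
      then show ?thesis using R by (intro exI[of _ "ball x0 (R/2)"]) auto
    qed
    then have "Ck_on k S (\<lambda>x. dd f x v)" for v by (intro Ck_on_local) blast
    then show ?case using df by simp
  qed
  then show ?thesis by (simp add: smooth_on_def)
qed

lemma holo_on_smooth_on:
  fixes f :: "complex^'k \<Rightarrow> complex^'l"
  assumes "open S" "holo_on S f"
  shows "smooth_on S f"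
proof -
  have "smooth_on S (\<lambda>x. f x $ i)" for i
  proof (rule complex_differentiable_smooth_on[OF assms(1)])
    fix x assume "x \<in> S"
    then obtain D where "(f has_derivative D) (at x)" "\<forall>a v. D (a *s v) = a *s D v"
      using assms(2) unfolding holo_on_def by blast
    then show "\<exists>D. ((\<lambda>x. f x $ i) has_derivative D) (at x) \<and> (\<forall>a v. D (a *s v) = a * D v)"
      by (intro exI[of _ "\<lambda>v. D v $ i"]) (auto
          intro: bounded_linear.has_derivative[OF bounded_linear_vec_nth])
  qed
  from smooth_on_vec[of S "\<lambda>i x. f x $ i", OF assms(1) this] show ?thesis by simp
qed

section \<open>The Levi form of a function\<close>

lemma dd_add: "f differentiable (at x) \<Longrightarrow> g differentiable (at x) \<Longrightarrow>
    dd (\<lambda>y. f y + g y) x v = dd f x v + dd g x v"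
  by (rule dd_eqI[OF has_derivative_add]) (auto intro: has_derivative_dd)

lemma dd_diff: "f differentiable (at x) \<Longrightarrow> g differentiable (at x) \<Longrightarrow>
    dd (\<lambda>y. f y - g y) x v = dd f x v - dd g x v"
  by (rule dd_eqI[OF has_derivative_diff]) (auto intro: has_derivative_dd)

lemma dd_mult:
  fixes f g :: "'a::real_normed_vector \<Rightarrow> 'b::real_normed_algebra"
  shows "f differentiable (at x) \<Longrightarrow> g differentiable (at x) \<Longrightarrow>
    dd (\<lambda>y. f y * g y) x v = f x * dd g x v + dd f x v * g x"
  by (rule dd_eqI[OF has_derivative_mult]) (auto intro: has_derivative_dd)

lemma dd_sum: "(\<And>i. i \<in> I \<Longrightarrow> f i differentiable (at x)) \<Longrightarrow>
    dd (\<lambda>y. \<Sum>i\<in>I. f i y) x v = (\<Sum>i\<in>I. dd (f i) x v)"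
  by (rule dd_eqI[OF has_derivative_sum]) (auto intro: has_derivative_dd)

lemma dd_compose:
  "f differentiable (at x) \<Longrightarrow> g differentiable (at (f x)) \<Longrightarrow> dd (\<lambda>y. g (f y)) x v = dd g (f x) (dd f x v)"
  by (rule dd_eqI[OF has_derivative_compose[OF has_derivative_dd has_derivative_dd]])

lemma dd_cmult:
  fixes c :: "'b::real_normed_algebra"
  shows "f differentiable (at x) \<Longrightarrow> dd (\<lambda>y. c * f y) x v = c * dd f x v"
  by (rule dd_bounded_linear[OF bounded_linear_mult_right])

lemma dd_linear: "bounded_linear L \<Longrightarrow> dd L x v = L v"
  by (rule dd_eqI[OF bounded_linear_imp_has_derivative])

lemma dd_vec_nth: "f differentiable (at x) \<Longrightarrow> dd (\<lambda>y. f y $ i) x v = dd f x v $ i"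
  for f :: "_ \<Rightarrow> 'b::euclidean_space^'n"
  by (rule dd_bounded_linear[OF bounded_linear_vec_nth])

text \<open>Product rule for a linear map depending on a point, applied to a vector depending on a point.\<close>

lemma dd_linear_family:
  fixes h :: "'a::euclidean_space \<Rightarrow> 'b::euclidean_space" and w :: "'a \<Rightarrow> 'c::euclidean_space"
    and \<alpha> :: "'b \<Rightarrow> 'c \<Rightarrow> 'd::real_normed_vector"
  assumes "open T" "h x \<in> T" and lin: "\<And>q. q \<in> T \<Longrightarrow> linear (\<alpha> q)"
    and d\<alpha>: "\<And>v. (\<lambda>q. \<alpha> q v) differentiable (at (h x))"
    and dh: "h differentiable (at x)" and dw: "w differentiable (at x)"
  shows "(\<lambda>y. \<alpha> (h y) (w y)) differentiable (at x)"
    and "dd (\<lambda>y. \<alpha> (h y) (w y)) x a = dd (\<lambda>q. \<alpha> q (w x)) (h x) (dd h x a) + \<alpha> (h x) (dd w x a)"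
proof -
  have exp: "\<alpha> q v = (\<Sum>i\<in>Basis. (v \<bullet> i) *\<^sub>R \<alpha> q i)" if "q \<in> T" for q v
  proof -
    have "\<alpha> q v = \<alpha> q (\<Sum>i\<in>Basis. (v \<bullet> i) *\<^sub>R i)" by (simp only: euclidean_representation)
    then show ?thesis by (simp add: linear_sum[OF lin[OF that]] linear_scale[OF lin[OF that]])
  qed
  obtain S where S: "open S" "x \<in> S" "\<And>y. y \<in> S \<Longrightarrow> h y \<in> T"
    using differentiable_imp_continuous_within[OF dh] assms(1,2)
    by (metis continuous_at_open)
  \<comment> \<open>Expanding the vector in the standard basis leaves products of two functions.\<close>
  have dai: "((\<lambda>y. \<alpha> (h y) v) has_derivative (\<lambda>a. dd (\<lambda>q. \<alpha> q v) (h x) (dd h x a))) (at x)" for v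
    by (rule has_derivative_compose[OF has_derivative_dd[OF dh] has_derivative_dd[OF d\<alpha>]])
  have dwi: "((\<lambda>y. w y \<bullet> i) has_derivative (\<lambda>a. dd w x a \<bullet> i)) (at x)" for i
    by (rule bounded_linear.has_derivative[OF bounded_linear_inner_left has_derivative_dd[OF dw]])
  have 1: "((\<lambda>y. \<Sum>i\<in>Basis. (w y \<bullet> i) *\<^sub>R \<alpha> (h y) i) has_derivative
     (\<lambda>a. \<Sum>i\<in>Basis. (w x \<bullet> i) *\<^sub>R dd (\<lambda>q. \<alpha> q i) (h x) (dd h x a) + (dd w x a \<bullet> i) *\<^sub>R \<alpha> (h x) i))
         (at x)"
    by (intro has_derivative_sum has_derivative_scaleR dai dwi)
  have 2: "((\<lambda>q. \<alpha> q (w x)) has_derivative (\<lambda>b. \<Sum>i\<in>Basis. (w x \<bullet> i) *\<^sub>R dd (\<lambda>q. \<alpha> q i) (h x) b))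
      (at (h x))"
  proof -
    have "((\<lambda>q. \<Sum>i\<in>Basis. (w x \<bullet> i) *\<^sub>R \<alpha> q i)
        has_derivative (\<lambda>b. \<Sum>i\<in>Basis. (w x \<bullet> i) *\<^sub>R dd (\<lambda>q. \<alpha> q i) (h x) b)) (at (h x))"
      by (intro has_derivative_sum has_derivative_scaleR_right has_derivative_dd d\<alpha>)
    then show ?thesis
      by (rule iffD1[OF has_derivative_eq_open[OF assms(1,2)], rotated]) (rule exp[symmetric])
  qed
  have 3: "((\<lambda>y. \<alpha> (h y) (w y)) has_derivative
     (\<lambda>a. \<Sum>i\<in>Basis. (w x \<bullet> i) *\<^sub>R dd (\<lambda>q. \<alpha> q i) (h x) (dd h x a) + (dd w x a \<bullet> i) *\<^sub>R \<alpha> (h x) i))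
         (at x)"
    by (rule iffD1[OF has_derivative_eq_open[OF S(1,2)] 1]) (rule exp[symmetric], rule S(3))
  then show "(\<lambda>y. \<alpha> (h y) (w y)) differentiable (at x)" by (auto simp: differentiable_def)
  show "dd (\<lambda>y. \<alpha> (h y) (w y)) x a = dd (\<lambda>q. \<alpha> q (w x)) (h x) (dd h x a) + \<alpha> (h x) (dd w x a)"
    unfolding dd_eqI[OF 3] dd_eqI[OF 2] exp[OF assms(2), of "dd w x a"] by (simp add: sum.distrib)
qed

text \<open>The term with the second derivative of the inner map is the one that vanishes for holomorphic
  coordinate changes after antisymmetrization, and that produces the curvature terms for the graph
  of a section.\<close>

lemma dd_dd_compose:
  fixes h :: "'a::euclidean_space \<Rightarrow> 'b::euclidean_space" and g :: "'b \<Rightarrow> 'c::real_normed_vector"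
  assumes S: "open S" "x \<in> S" "smooth_on S h" and T: "open T" "h ` S \<subseteq> T" "smooth_on T g"
  shows "dd (\<lambda>y. dd (\<lambda>y. g (h y)) y b) x a
    = dd (\<lambda>q. dd g q (dd h x b)) (h x) (dd h x a) + dd g (h x) (dd (\<lambda>y. dd h y b) x a)"
proof -
  have hx: "h x \<in> T" using S T by auto
  have "dd (\<lambda>y. dd (\<lambda>y. g (h y)) y b) x a = dd (\<lambda>y. dd g (h y) (dd h y b)) x a"
  proof (rule fun_cong[OF dd_eq_open[OF S(1,2)]])
    fix y assume y: "y \<in> S"
    then show "dd (\<lambda>y. g (h y)) y b = dd g (h y) (dd h y b)"
      by (intro dd_compose smooth_on_differentiable[OF S(3)] smooth_on_differentiable[OF T(3)])
          (use T(2) in auto)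
  qed
  also have "\<dots> = dd (\<lambda>q. dd g q (dd h x b)) (h x) (dd h x a) + dd g (h x) (dd (\<lambda>y. dd h y b) x a)"
    by (rule dd_linear_family(2)[OF T(1) hx linear_dd[OF smooth_on_differentiable[OF T(3)]]
        smooth_on_differentiable[OF smooth_on_dd[OF T(3)] hx] smooth_on_differentiable[OF S(3,2)]
        smooth_on_differentiable[OF smooth_on_dd[OF S(3)] S(2)]])
  finally show ?thesis .
qed

lemma i_i_vector [simp]: "\<i> *s (\<i> *s v) = - (v :: complex^'k)"
  by (simp add: vec_eq_iff)

lemma complex_vector_expansion:
  assumes "linear (P :: complex^'k \<Rightarrow> 'b::real_vector)"
  shows "P v = (\<Sum>j\<in>UNIV. Re (v $ j) *\<^sub>R P (axis j 1) + Im (v $ j) *\<^sub>R P (axis j \<i>))"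
proof -
  have "v = (\<Sum>j\<in>UNIV. Re (v $ j) *\<^sub>R axis j 1 + Im (v $ j) *\<^sub>R axis j \<i>)"
    by (simp add: vec_eq_iff axis_def complex_eq_iff if_distrib cong: if_cong)
  then have "P v = P (\<Sum>j\<in>UNIV. Re (v $ j) *\<^sub>R axis j 1 + Im (v $ j) *\<^sub>R axis j \<i>)" by simp
  then show ?thesis by (simp add: linear_sum[OF assms] linear_add[OF assms] linear_scale[OF assms])
qed

lemma dz_sum:
  assumes "f differentiable (at x)"
  shows "(\<Sum>j\<in>UNIV. dz j f x * v $ j) = (dd f x v - \<i> * dd f x (\<i> *s v)) / 2"
proof -
  have "(dd f x v - \<i> * dd f x (\<i> *s v)) / 2 = (\<Sum>j\<in>UNIV. dz j f x * v $ j)"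
    unfolding complex_vector_expansion[OF linear_dd[OF assms], of v]
      complex_vector_expansion[OF linear_dd[OF assms], of "\<i> *s v"] sum_distrib_left
          sum_subtractf[symmetric]
      sum_divide_distrib
  proof (intro sum.cong refl)
    fix j
    show "(Re (v $ j) *\<^sub>R dd f x (axis j 1) + Im (v $ j) *\<^sub>R dd f x (axis j \<i>) -
      \<i> * (Re ((\<i> *s v) $ j) *\<^sub>R dd f x (axis j 1) + Im ((\<i> *s v) $ j) *\<^sub>R dd f x (axis j \<i>))) / 2
      = dz j f x * v $ j"
      by (simp add: dz_def complex_eq_iff algebra_simps)
  qed
  then show ?thesis by simp
qed

lemma dzbar_sum:
  assumes "f differentiable (at x)"
  shows "(\<Sum>j\<in>UNIV. dzbar j f x * cnj (v $ j)) = (dd f x v + \<i> * dd f x (\<i> *s v)) / 2"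
proof -
  have "(dd f x v + \<i> * dd f x (\<i> *s v)) / 2 = (\<Sum>j\<in>UNIV. dzbar j f x * cnj (v $ j))"
    unfolding complex_vector_expansion[OF linear_dd[OF assms], of v]
      complex_vector_expansion[OF linear_dd[OF assms], of "\<i> *s v"] sum_distrib_left
          sum.distrib[symmetric]
      sum_divide_distrib
  proof (intro sum.cong refl)
    fix j
    show "(Re (v $ j) *\<^sub>R dd f x (axis j 1) + Im (v $ j) *\<^sub>R dd f x (axis j \<i>) +
      \<i> * (Re ((\<i> *s v) $ j) *\<^sub>R dd f x (axis j 1) + Im ((\<i> *s v) $ j) *\<^sub>R dd f x (axis j \<i>))) / 2
      = dzbar j f x * cnj (v $ j)"
      by (simp add: dzbar_def complex_eq_iff algebra_simps)
  qed
  then show ?thesis by simp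
qed

text \<open>For real-valued \<open>f\<close> this is the value of \<open>i \<partial>\<partial>\<close>-bar \<open>f\<close> on \<open>(u, v)\<close>. In terms of real second
  derivatives there are no index sums and no complex values, and its behaviour under maps follows
  from the chain rule.\<close>

definition levi :: "(complex^'k::finite \<Rightarrow> 'b::real_normed_vector) \<Rightarrow> complex^'k \<Rightarrow> complex^'k
    \<Rightarrow> complex^'k \<Rightarrow> 'b" where
  "levi f x u v = (1/2) *\<^sub>R (dd (\<lambda>y. dd f y (\<i> *s u)) x v - dd (\<lambda>y. dd f y (\<i> *s v)) x u)"

lemma del_eq:
  "f \<circ> chart_inv c differentiable (at x) \<Longrightarrow>
    del f c x v = (dd (f \<circ> chart_inv c) x v - \<i> * dd (f \<circ> chart_inv c) x (\<i> *s v)) / 2"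
  unfolding del_def by (rule dz_sum)

lemma delbar_eq:
  "f \<circ> chart_inv c differentiable (at x) \<Longrightarrow>
    delbar f c x v = (dd (f \<circ> chart_inv c) x v + \<i> * dd (f \<circ> chart_inv c) x (\<i> *s v)) / 2"
  unfolding delbar_def by (rule dzbar_sum)

lemma smooth_on_dzbar:
  assumes "open S" "smooth_on S f" shows "smooth_on S (dzbar k f)"
  unfolding dzbar_def divide_inverse
  by (intro smooth_intros assms)

lemma dz_dzbar_sum:
  assumes S: "open S" "smooth_on S g" "x \<in> S"
  shows "(\<Sum>j\<in>UNIV. \<Sum>k\<in>UNIV. dz j (dzbar k g) x * (u $ j * cnj (v $ k))) =
     (dd (\<lambda>y. dd g y v) x u + \<i> * dd (\<lambda>y. dd g y (\<i> *s v)) x u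
      - \<i> * dd (\<lambda>y. dd g y v) x (\<i> *s u) + dd (\<lambda>y. dd g y (\<i> *s v)) x (\<i> *s u)) / 4"
proof -
  define G where "G y = (\<Sum>k\<in>UNIV. dzbar k g y * cnj (v $ k))" for y
  have dzb: "dzbar k g differentiable (at x)" for k
    by (rule smooth_on_differentiable[OF smooth_on_dzbar[OF S(1,2)] S(3)])
  have dG: "G differentiable (at x)" unfolding G_def
    by (rule differentiable_sum) (auto intro!: differentiable_mult dzb)
  have "dd G x w = (\<Sum>k\<in>UNIV. dd (dzbar k g) x w * cnj (v $ k))" for w
    unfolding G_def by (subst dd_sum) (auto intro!: derivative_intros dzb simp: dd_mult[OF dzb])
  then have dzG: "dz j G x = (\<Sum>k\<in>UNIV. dz j (dzbar k g) x * cnj (v $ k))" for j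
    unfolding dz_def
    by (simp add: sum_distrib_left sum_divide_distrib sum_subtractf[symmetric] left_diff_distrib
        mult.assoc)
  have dd1: "(\<lambda>y. dd g y w) differentiable (at x)" for w
    by (rule smooth_on_differentiable[OF smooth_on_dd[OF S(2)] S(3)])
  have ddG: "dd G x w = (dd (\<lambda>y. dd g y v) x w + \<i> * dd (\<lambda>y. dd g y (\<i> *s v)) x w) / 2" for w
  proof -
    have "dd G x w = dd (\<lambda>y. (dd g y v + \<i> * dd g y (\<i> *s v)) * inverse 2) x w"
    proof (rule fun_cong[OF dd_eq_open[OF S(1,3)]])
      fix y assume y: "y \<in> S"
      show "G y = (dd g y v + \<i> * dd g y (\<i> *s v)) * inverse 2"
        unfolding G_def dzbar_sum[OF smooth_on_differentiable[OF S(2) y]] by (simp only: divide_inverse)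
    qed
    also have "\<dots> = (dd (\<lambda>y. dd g y v) x w + \<i> * dd (\<lambda>y. dd g y (\<i> *s v)) x w) * inverse 2"
    proof -
      have d: "(\<lambda>y. \<i> * dd g y (\<i> *s v)) differentiable (at x)"
        by (intro differentiable_mult dd1 differentiable_const)
      show ?thesis
        by (simp only: dd_bounded_linear[OF bounded_linear_mult_left differentiable_add[OF dd1 d]]
            dd_add[OF dd1 d] dd_cmult[OF dd1])
    qed
    finally show ?thesis by (simp only: divide_inverse)
  qed
  have "(\<Sum>j\<in>UNIV. \<Sum>k\<in>UNIV. dz j (dzbar k g) x * (u $ j * cnj (v $ k))) = (\<Sum>j\<in>UNIV. dz j G x * u $ j)"
    unfolding dzG by (simp add: sum_distrib_left mult_ac)
  also have "\<dots> = (dd G x u - \<i> * dd G x (\<i> *s u)) / 2" by (rule dz_sum[OF dG])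
  also have "\<dots> = (dd (\<lambda>y. dd g y v) x u + \<i> * dd (\<lambda>y. dd g y (\<i> *s v)) x u
      - \<i> * dd (\<lambda>y. dd g y v) x (\<i> *s u) + dd (\<lambda>y. dd g y (\<i> *s v)) x (\<i> *s u)) / 4"
    unfolding ddG by (simp add: complex_eq_iff diff_divide_distrib add_divide_distrib)
  finally show ?thesis .
qed

lemma deldelbar_levi:
  assumes S: "open S" "smooth_on S (f \<circ> chart_inv c)" "x \<in> S"
  shows "\<i> * deldelbar f c x u v = levi (f \<circ> chart_inv c) x u v"
proof -
  let ?g = "f \<circ> chart_inv c"
  let ?H = "\<lambda>a b. dd (\<lambda>y. dd ?g y b) x a"
  have sym: "?H a b = ?H b a" for a b by (rule dd_symmetric[OF S])
  have "deldelbar f c x u v =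
     (\<Sum>j\<in>UNIV. \<Sum>k\<in>UNIV. dz j (dzbar k ?g) x * (u $ j * cnj (v $ k))) -
     (\<Sum>j\<in>UNIV. \<Sum>k\<in>UNIV. dz j (dzbar k ?g) x * (v $ j * cnj (u $ k)))"
    unfolding deldelbar_def by (simp add: sum_subtractf algebra_simps)
  also have "\<dots> = (\<i> * ?H u (\<i> *s v) - \<i> * ?H v (\<i> *s u)) / 2"
    unfolding dz_dzbar_sum[OF S]
    using sym[of u v] sym[of "\<i> *s u" v] sym[of "\<i> *s v" u] sym[of "\<i> *s u" "\<i> *s v"]
    by (simp add: field_simps)
  finally show ?thesis
    unfolding levi_def by (simp add: complex_eq_iff field_simps)
qed

lemma smooth_on_levi:
  fixes f :: "complex^'k \<Rightarrow> 'c::real_normed_vector"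
  assumes "open U" "smooth_on U f" shows "smooth_on U (\<lambda>x. levi f x u v)"
  unfolding levi_def by (intro smooth_intros assms)

lemma levi_eq_open:
  assumes "open S" "x \<in> S" "\<And>y. y \<in> S \<Longrightarrow> f y = g y"
  shows "levi f x u v = levi g x u v"
proof -
  have "dd (\<lambda>y. dd f y w) x = dd (\<lambda>y. dd g y w) x" for w
    by (rule dd_eq_open[OF assms(1,2)]) (simp add: dd_eq_open[OF assms(1) _ assms(3)])
  then show ?thesis by (simp add: levi_def)
qed

lemma dd_dd_bounded_linear:
  assumes L: "bounded_linear L" and S: "open S" "smooth_on S f" "x \<in> S"
  shows "dd (\<lambda>y. dd (\<lambda>y. L (f y)) y w) x v = L (dd (\<lambda>y. dd f y w) x v)"
proof -
  have "dd (\<lambda>y. dd (\<lambda>y. L (f y)) y w) x v = dd (\<lambda>y. L (dd f y w)) x v"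
    by (rule fun_cong[OF dd_eq_open[OF S(1,3)]])
       (simp add: dd_bounded_linear[OF L] smooth_on_differentiable[OF S(2)])
  also have "\<dots> = L (dd (\<lambda>y. dd f y w) x v)"
    by (rule dd_bounded_linear[OF L smooth_on_differentiable[OF smooth_on_dd[OF S(2)] S(3)]])
  finally show ?thesis .
qed

lemma levi_bounded_linear:
  assumes L: "bounded_linear L" and S: "open S" "smooth_on S f" "x \<in> S"
  shows "levi (\<lambda>y. L (f y)) x u v = L (levi f x u v)"
  unfolding levi_def dd_dd_bounded_linear[OF assms]
  by (simp add: bounded_linear.linear[OF L] linear_diff linear_scale)

lemma levi_add:
  assumes S: "open S" "smooth_on S f" "smooth_on S g" "x \<in> S"
  shows "levi (\<lambda>y. f y + g y) x u v = levi f x u v + levi g x u v"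
proof -
  have "dd (\<lambda>y. dd (\<lambda>y. f y + g y) y w) x a = dd (\<lambda>y. dd f y w) x a + dd (\<lambda>y. dd g y w) x a" for w a
  proof -
    have "dd (\<lambda>y. dd (\<lambda>y. f y + g y) y w) x a = dd (\<lambda>y. dd f y w + dd g y w) x a"
      by (rule fun_cong[OF dd_eq_open[OF S(1,4)]])
         (simp add: dd_add smooth_on_differentiable[OF S(2)] smooth_on_differentiable[OF S(3)])
    then show ?thesis
      by (simp add: dd_add smooth_on_differentiable[OF smooth_on_dd[OF S(2)] S(4)]
           smooth_on_differentiable[OF smooth_on_dd[OF S(3)] S(4)])
  qed
  then show ?thesis by (simp add: levi_def algebra_simps)
qed

lemma levi_cmult:
  fixes f :: "_ \<Rightarrow> 'b::real_normed_algebra"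
  assumes S: "open S" "smooth_on S f" "x \<in> S"
  shows "levi (\<lambda>y. c * f y) x u v = c * levi f x u v"
  by (rule levi_bounded_linear[OF bounded_linear_mult_right S])

lemma levi_diff:
  assumes S: "open S" "smooth_on S f" "smooth_on S g" "x \<in> S"
  shows "levi (\<lambda>y. f y - g y) x u v = levi f x u v - levi g x u v"
  using levi_add[OF S(1,2) smooth_on_minus[OF S(1,3)] S(4)]
    levi_bounded_linear[OF bounded_linear_minus[OF bounded_linear_ident] S(1,3,4)] by simp

lemma levi_antisym: "levi f x v u = - levi f x u v"
  by (simp add: levi_def algebra_simps)

lemma levi_of_real:
  assumes "open S" "smooth_on S f" "x \<in> S"
  shows "levi (\<lambda>y. complex_of_real (f y)) x u v = complex_of_real (levi f x u v)"
  by (rule levi_bounded_linear[OF bounded_linear_of_real assms])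

lemma deldelbar_of_real:
  assumes S: "open S" "smooth_on S (f \<circ> chart_inv c)" "x \<in> S"
  shows "\<i> * deldelbar (\<lambda>p. complex_of_real (f p)) c x u v
      = complex_of_real (levi (f \<circ> chart_inv c) x u v)"
proof -
  have "smooth_on S ((\<lambda>p. complex_of_real (f p)) \<circ> chart_inv c)"
    using smooth_on_bounded_linear[OF bounded_linear_of_real S(1,2)] by (simp add: o_def)
  from deldelbar_levi[OF S(1) this S(3)] show ?thesis
    using levi_of_real[OF S] by (simp add: o_def)
qed

lemma holo_on_dd:
  "holo_on S h \<Longrightarrow> x \<in> S \<Longrightarrow> dd h x (a *s v) = a *s dd h x v"
  unfolding holo_on_def by (metis dd_eqI)

lemma holo_on_differentiable: "holo_on S h \<Longrightarrow> x \<in> S \<Longrightarrow> h differentiable (at x)"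
  unfolding holo_on_def differentiable_def by blast

lemma dd_dd_i:
  fixes h :: "complex^'k \<Rightarrow> 'b::real_normed_vector"
  assumes "open S" "x \<in> S" "bounded_linear J" "smooth_on S h"
    and "\<And>y v. y \<in> S \<Longrightarrow> dd h y (\<i> *s v) = J (dd h y v)"
  shows "dd (\<lambda>y. dd h y (\<i> *s v)) x u = J (dd (\<lambda>y. dd h y v) x u)"
proof -
  have "dd (\<lambda>y. dd h y (\<i> *s v)) x u = dd (\<lambda>y. J (dd h y v)) x u"
    by (rule fun_cong[OF dd_eq_open[OF assms(1,2)]]) (rule assms(5))
  then show ?thesis
    by (simp add: dd_bounded_linear[OF assms(3)]
        smooth_on_differentiable[OF smooth_on_dd[OF assms(4)] assms(2)])
qed

lemma bounded_linear_i: "bounded_linear (\<lambda>v::complex^'k. \<i> *s v)"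
proof -
  have "linear (\<lambda>v::complex^'k. \<i> *s v)"
    by (rule linearI) (simp_all add: vec_eq_iff algebra_simps)
  then show ?thesis by (simp add: linear_conv_bounded_linear)
qed

text \<open>The second derivative of a holomorphic map is symmetric and complex bilinear, so it contributes
  the same amount to both terms of the Levi form.\<close>

lemma levi_compose_holo:
  fixes h :: "complex^'k \<Rightarrow> complex^'l" and g :: "complex^'l \<Rightarrow> 'b::real_normed_vector"
  assumes S: "open S" "x \<in> S" "holo_on S h" and T: "open T" "h ` S \<subseteq> T" "smooth_on T g"
  shows "levi (\<lambda>y. g (h y)) x u v = levi g (h x) (dd h x u) (dd h x v)"
proof -
  have sh: "smooth_on S h" by (rule holo_on_smooth_on[OF S(1,3)])
  have i: "dd (\<lambda>y. dd h y (\<i> *s v)) x u = \<i> *s dd (\<lambda>y. dd h y v) x u" for u v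
    by (rule dd_dd_i[OF S(1,2) bounded_linear_i sh]) (rule holo_on_dd[OF S(3)])
  have "dd (\<lambda>y. dd h y u) x v = dd (\<lambda>y. dd h y v) x u" by (rule dd_symmetric[OF S(1) sh S(2)])
  then show ?thesis
    unfolding levi_def dd_dd_compose[OF S(1,2) sh T] i holo_on_dd[OF S(3,2)] by simp
qed

text \<open>The function \<open>log |g|\<^sup>2\<close> is pluriharmonic: its derivative is twice the real part of the
    holomorphic
  form \<open>dg / g\<close>, which is closed. This makes curvature forms independent of the section.\<close>

lemma levi_ln_norm_holo:
  fixes g :: "complex^'k \<Rightarrow> complex"
  assumes S: "open S" "x \<in> S"
    and holo: "\<And>x. x \<in> S \<Longrightarrow> \<exists>D. (g has_derivative D) (at x) \<and> (\<forall>a v. D (a *s v) = a * D v)"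
    and nz: "\<And>x. x \<in> S \<Longrightarrow> g x \<noteq> 0"
  shows "smooth_on S (\<lambda>y. ln (Re (g y * cnj (g y))))"
    and "levi (\<lambda>y. ln (Re (g y * cnj (g y)))) x u v = 0"
proof -
  have sg: "smooth_on S g" by (rule complex_differentiable_smooth_on[OF S(1) holo])
  have gi: "dd g y (\<i> *s v) = \<i> * dd g y v" if "y \<in> S" for y v
    using holo[OF that] by (auto simp: dd_eqI)
  have sgc: "smooth_on S (\<lambda>y. Re (g y * cnj (g y)))"
    by (rule smooth_on_bounded_linear[OF bounded_linear_Re S(1)])
       (intro smooth_on_mult smooth_on_bounded_linear[OF bounded_linear_cnj] S(1) sg)
  have pos: "Re (g y * cnj (g y)) > 0" if "y \<in> S" for y
    using nz[OF that] by (simp add: complex_mult_cnj complex_eq_iff sum_power2_gt_zero_iff)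
  show "smooth_on S (\<lambda>y. ln (Re (g y * cnj (g y))))" by (rule smooth_on_ln[OF S(1) pos sgc])
  define k where "k v y = dd g y v * inverse (g y)" for v y
  have sk: "smooth_on S (k v)" for v
    unfolding k_def by (intro smooth_intros smooth_on_inverse S(1) sg nz)
  have dln: "dd (\<lambda>y. ln (Re (g y * cnj (g y)))) y v = 2 * Re (k v y)" if y: "y \<in> S" for y v
  proof -
    have dg: "g differentiable (at y)" by (rule smooth_on_differentiable[OF sg y])
    have "((\<lambda>y. g y * cnj (g y)) has_derivative (\<lambda>v. g y * cnj (dd g y v) + dd g y v * cnj (g y)))
        (at y)"
      by (intro has_derivative_mult bounded_linear.has_derivative[OF bounded_linear_cnj]
          has_derivative_dd[OF dg])
    from bounded_linear.has_derivative[OF bounded_linear_Re this]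
    have "((\<lambda>y. Re (g y * cnj (g y))) has_derivative
        (\<lambda>v. Re (g y * cnj (dd g y v) + dd g y v * cnj (g y)))) (at y)" .
    from has_derivative_compose[OF this DERIV_ln[OF pos[OF y], unfolded has_field_derivative_def]]
    have "dd (\<lambda>y. ln (Re (g y * cnj (g y)))) y v
      = inverse (Re (g y * cnj (g y))) * Re (g y * cnj (dd g y v) + dd g y v * cnj (g y))"
      by (rule dd_eqI)
    also have "\<dots> = 2 * Re (k v y)"
      by (simp add: k_def power2_eq_square divide_inverse algebra_simps)
    finally show ?thesis .
  qed
  have dd2: "dd (\<lambda>y. dd (\<lambda>y. ln (Re (g y * cnj (g y)))) y (\<i> *s v)) x u = 2 * Re (\<i> * dd (k v) x u)"
      for v u
  proof -
    have "dd (\<lambda>y. dd (\<lambda>y. ln (Re (g y * cnj (g y)))) y (\<i> *s v)) x u = dd (\<lambda>y. 2 * Re (\<i> * k v y)) x u"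
    proof (rule fun_cong[OF dd_eq_open[OF S]])
      fix y assume y: "y \<in> S"
      have "k (\<i> *s v) y = \<i> * k v y" by (simp add: k_def gi[OF y])
      then show "dd (\<lambda>y. ln (Re (g y * cnj (g y)))) y (\<i> *s v) = 2 * Re (\<i> * k v y)"
        unfolding dln[OF y] by (simp only:)
    qed
    also have "\<dots> = 2 * Re (\<i> * dd (k v) x u)"
    proof (rule dd_bounded_linear[of "\<lambda>z. 2 * Re (\<i> * z)"])
      show "bounded_linear (\<lambda>z. 2 * Re (\<i> * z))"
        by (rule bounded_linear_compose[OF bounded_linear_mult_right
            bounded_linear_compose[OF bounded_linear_Re bounded_linear_mult_right]])
    qed (rule smooth_on_differentiable[OF sk S(2)])
    finally show ?thesis .
  qed
  have sym: "dd (k v) x u = dd (k u) x v"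
  proof -
    have "dd (k v) x u = dd g x v * dd (\<lambda>y. inverse (g y)) x u + dd (\<lambda>y. dd g y v) x u * inverse
        (g x)" for u v
      unfolding k_def
      by (intro dd_mult smooth_on_differentiable[OF smooth_on_dd[OF sg] S(2)]
          smooth_on_differentiable[OF smooth_on_inverse[OF S(1) nz sg] S(2)])
    moreover have "dd (\<lambda>y. inverse (g y)) x u = - (inverse (g x) * dd g x u * inverse (g x))" for u
      by (rule dd_eqI[OF Deriv.has_derivative_inverse[OF nz[OF S(2)]
          smooth_on_has_derivative[OF sg S(2)]]])
    moreover have "dd (\<lambda>y. dd g y v) x u = dd (\<lambda>y. dd g y u) x v"
        by (rule dd_symmetric[OF S(1) sg S(2)])
    ultimately show ?thesis by simp
  qed
  show "levi (\<lambda>y. ln (Re (g y * cnj (g y)))) x u v = 0"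
    unfolding levi_def dd2 using sym by simp
qed

text \<open>Here \<open>d (\<partial>\<close>-bar \<open>f) = \<partial>\<partial>\<close>-bar \<open>f\<close>; for \<open>\<partial> f\<close> the sign is the opposite one.\<close>

lemma ext_d_delbar:
  assumes S: "open S" "smooth_on S (f \<circ> chart_inv c)" "x \<in> S"
  shows "ext_d (\<lambda>c x v. \<i> * delbar f c x v) c x u v = levi (f \<circ> chart_inv c) x u v"
proof -
  let ?g = "f \<circ> chart_inv c"
  have dd1: "(\<lambda>y. dd ?g y w) differentiable (at x)" for w
    by (rule smooth_on_differentiable[OF smooth_on_dd[OF S(2)] S(3)])
  have "dd (\<lambda>y. \<i> * delbar f c y v) x u = \<i>/2 * dd (\<lambda>y. dd ?g y v) x u
      - 1/2 * dd (\<lambda>y. dd ?g y (\<i> *s v)) x u" for u v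
  proof -
    have "dd (\<lambda>y. \<i> * delbar f c y v) x u = dd (\<lambda>y. \<i>/2 * dd ?g y v - 1/2 * dd ?g y (\<i> *s v)) x u"
      by (rule fun_cong[OF dd_eq_open[OF S(1,3)]])
         (simp add: delbar_eq smooth_on_differentiable[OF S(2)] diff_divide_distrib algebra_simps)
    then show ?thesis by (simp only: dd_diff dd_cmult dd1 differentiable_mult differentiable_const)
  qed
  then show ?thesis
    unfolding ext_d_def levi_def using dd_symmetric[OF S, of v u]
        by (simp add: complex_eq_iff field_simps)
qed

lemma ext_d_del:
  assumes S: "open S" "smooth_on S (f \<circ> chart_inv c)" "x \<in> S"
  shows "\<i> * ext_d (del f) c x u v = - levi (f \<circ> chart_inv c) x u v"
proof -
  let ?g = "f \<circ> chart_inv c"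
  have dd1: "(\<lambda>y. dd ?g y w) differentiable (at x)" for w
    by (rule smooth_on_differentiable[OF smooth_on_dd[OF S(2)] S(3)])
  have "dd (\<lambda>y. del f c y v) x u = 1/2 * dd (\<lambda>y. dd ?g y v) x u - \<i>/2 * dd (\<lambda>y. dd ?g y (\<i> *s v)) x
      u" for u v
  proof -
    have "dd (\<lambda>y. del f c y v) x u = dd (\<lambda>y. 1/2 * dd ?g y v - \<i>/2 * dd ?g y (\<i> *s v)) x u"
      by (rule fun_cong[OF dd_eq_open[OF S(1,3)]])
         (simp add: del_eq smooth_on_differentiable[OF S(2)] algebra_simps diff_divide_distrib)
    then show ?thesis by (simp only: dd_diff dd_cmult dd1 differentiable_mult differentiable_const)
  qed
  then show ?thesis
    unfolding ext_d_def levi_def using dd_symmetric[OF S, of v u]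
        by (simp add: complex_eq_iff field_simps)
qed

section \<open>Torus fibrations in logarithmic coordinates\<close>

definition base :: "complex^('n::finite + 'm::finite) \<Rightarrow> complex^'m" where
  "base x = (\<chi> k. x $ Inr k)"

definition fib :: "complex^('n::finite + 'm::finite) \<Rightarrow> complex^'n" where
  "fib x = (\<chi> j. x $ Inl j)"

text \<open>The coordinates of the total space split into the fibre part, indexed by \<open>Inl\<close>, and the base
  part, indexed by \<open>Inr\<close>.\<close>

definition join :: "complex^'n::finite \<Rightarrow> complex^'m::finite \<Rightarrow> complex^('n + 'm)" where
  "join a y = (\<chi> s. case s of Inl j \<Rightarrow> a $ j | Inr k \<Rightarrow> y $ k)"

definition cvec :: "real^'n::finite \<Rightarrow> complex^'n" where
  "cvec t = (\<chi> j. complex_of_real (t $ j))"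

lemma join_nth [simp]: "join a y $ Inl j = a $ j" "join a y $ Inr k = y $ k"
  by (simp_all add: join_def)

lemma base_nth [simp]: "base x $ k = x $ Inr k" and fib_nth [simp]: "fib x $ j = x $ Inl j"
  and cvec_nth [simp]: "cvec t $ j = complex_of_real (t $ j)"
  by (simp_all add: base_def fib_def cvec_def)

lemma sum_vec_eq_iff: "x = y \<longleftrightarrow> (\<forall>j. x $ Inl j = y $ Inl j) \<and> (\<forall>k. x $ Inr k = y $ Inr k)"
  for x y :: "'a^('n::finite + 'm::finite)"
  by (metis vec_eq_iff sum.exhaust)

lemma base_join [simp]: "base (join a y) = y" and fib_join [simp]: "fib (join a y) = a"
  
  by (simp_all add: vec_eq_iff)

lemma join_fib_base [simp]: "join (fib x) (base x) = x"
  by (simp add: sum_vec_eq_iff)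

lemma linear_base: "linear base" and linear_fib: "linear fib" and linear_cvec: "linear cvec"
  by (rule linearI; simp add: vec_eq_iff complex_eq_iff)+

lemma join_add: "join a y + join b z = join (a + b) (y + z)"
  and join_diff: "join a y - join b z = join (a - b) (y - z)"
  and join_scalar: "c *s join a y = join (c *s a) (c *s y)"
  by (simp_all add: sum_vec_eq_iff)

lemma base_scalar [simp]: "base (c *s x) = c *s base x"
  by (simp add: vec_eq_iff)

lemma linear_join: "linear (\<lambda>p. join (fst p) (snd p))"
  by (rule linearI) (simp_all add: sum_vec_eq_iff)

lemma bounded_linear_base: "bounded_linear base" and bounded_linear_fib: "bounded_linear fib"
  and bounded_linear_cvec: "bounded_linear cvec"
  using linear_base linear_fib linear_cvec by (simp_all add: linear_conv_bounded_linear)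

lemma linear_join_pair:
  assumes "linear f" "linear g" shows "linear (\<lambda>x. join (f x) (g x))"
  by (rule linearI) (simp_all add: sum_vec_eq_iff linear_add[OF assms(1)] linear_add[OF assms(2)]
      linear_scale[OF assms(1)] linear_scale[OF assms(2)])

lemma Ck_on_join:
  fixes f :: "'a::euclidean_space \<Rightarrow> complex^'n::finite" and g :: "'a \<Rightarrow> complex^'m::finite"
  assumes "open S" "Ck_on k S f" "Ck_on k S g"
  shows "Ck_on k S (\<lambda>x. join (f x) (g x))"
proof -
  have "linear (\<lambda>a. join a 0)" "linear (\<lambda>y. join 0 y)"
    by (rule linearI; simp add: sum_vec_eq_iff)+
  then have "Ck_on k S (\<lambda>x. join (f x) 0 + join 0 (g x))"
    by (intro Ck_on_add assms Ck_on_bounded_linear[OF _ assms(1,2)]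
        Ck_on_bounded_linear[OF _ assms(1,3)])
       (simp_all add: linear_conv_bounded_linear)
  then show ?thesis by (simp add: join_add)
qed

text \<open>In logarithmic coordinates \<open>t\<^sub>j + i \<theta>\<^sub>j\<close> this is \<open>\<partial>/\<partial>t\<^sub>j\<close>, and \<open>\<i> *s vert j\<close> is \<open>\<partial>/\<partial>\<theta>\<^sub>j\<close>.\<close>

abbreviation vert :: "'n::finite \<Rightarrow> complex^('n + 'm::finite)" where
  "vert j \<equiv> join (axis j 1) 0"

lemma join_vert: "join a 0 = (\<Sum>j\<in>UNIV. Re (a $ j) *\<^sub>R vert j + Im (a $ j) *\<^sub>R (\<i> *s vert j))"
  by (simp add: sum_vec_eq_iff axis_def complex_eq_iff if_distrib cong: if_cong)

lemma linear_vertical: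
  assumes "linear P"
  shows "P (join a 0) = (\<Sum>j\<in>UNIV. Re (a $ j) *\<^sub>R P (vert j) + Im (a $ j) *\<^sub>R P (\<i> *s vert j))"
  unfolding join_vert[of a] by (simp add: linear_sum[OF assms] linear_add[OF assms]
      linear_scale[OF assms])

text \<open>The point over \<open>y\<close> with logarithmic fibre coordinate \<open>t = \<sigma>(y)\<close> and \<open>\<theta> = 0\<close>.\<close>

definition graph_of :: "(complex^'m::finite \<Rightarrow> real^'n::finite) \<Rightarrow> complex^'m \<Rightarrow> complex^('n + 'm)" where
  "graph_of \<sigma> y = join (cvec (\<sigma> y)) y"

lemma base_graph_of [simp]: "base (graph_of \<sigma> y) = y"
  by (simp add: graph_of_def)

lemma dd_graph_of:
  assumes "\<sigma> differentiable (at y)"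
  shows "(graph_of \<sigma> has_derivative (\<lambda>v. join (cvec (dd \<sigma> y v)) v)) (at y)"
    and "dd (graph_of \<sigma>) y v = join (cvec (dd \<sigma> y v)) v"
proof -
  have l: "bounded_linear (\<lambda>p::(real^_) \<times> (complex^_). join (cvec (fst p)) (snd p))"
    by (simp add: linear_conv_bounded_linear[symmetric])
       (rule linear_join_pair[OF linear_compose[OF linear_fst linear_cvec, unfolded o_def] linear_snd])
  show "(graph_of \<sigma> has_derivative (\<lambda>v. join (cvec (dd \<sigma> y v)) v)) (at y)"
    using bounded_linear.has_derivative[OF l
        has_derivative_Pair[OF has_derivative_dd[OF assms] has_derivative_ident]]
    by (simp add: graph_of_def[abs_def])
  then show "dd (graph_of \<sigma>) y v = join (cvec (dd \<sigma> y v)) v" by (rule dd_eqI)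
qed

lemma smooth_on_graph_of:
  assumes "open S" "smooth_on S \<sigma>" shows "smooth_on S (graph_of \<sigma>)"
  unfolding graph_of_def smooth_on_def using assms
  by (auto intro!: Ck_on_join Ck_on_bounded_linear[OF bounded_linear_cvec] Ck_on_id simp: smooth_on_def)

lemma open_base: "open S \<Longrightarrow> open (base -` S)"
  by (rule open_vimage[OF _ linear_continuous_on[OF bounded_linear_base]])

lemma dd_const_family:
  assumes "open S" "x \<in> S" "\<And>y. y \<in> S \<Longrightarrow> f y = c"
  shows "dd f x v = 0"
  using dd_eq_open[OF assms(1,2), of f "\<lambda>_. c"] assms(3) by (simp add: frechet_derivative_const)

lemma bilinear_expansion:
  fixes f :: "'a::euclidean_space \<Rightarrow> 'b::euclidean_space \<Rightarrow> real"
  assumes "\<And>u. linear (f u)" "\<And>v. linear (\<lambda>u. f u v)"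
  shows "f a b = (\<Sum>i\<in>Basis. \<Sum>j\<in>Basis. (a \<bullet> i) * ((b \<bullet> j) * f i j))"
proof -
  have "f a b = f (\<Sum>i\<in>Basis. (a \<bullet> i) *\<^sub>R i) b" by (simp only: euclidean_representation)
  also have "\<dots> = (\<Sum>i\<in>Basis. (a \<bullet> i) * f i b)"
    by (simp only: linear_sum[OF assms(2)] linear_scale[OF assms(2)] real_scaleR_def)
  also have "\<dots> = (\<Sum>i\<in>Basis. (a \<bullet> i) * f i (\<Sum>j\<in>Basis. (b \<bullet> j) *\<^sub>R j))"
    by (simp only: euclidean_representation)
  also have "\<dots> = (\<Sum>i\<in>Basis. \<Sum>j\<in>Basis. (a \<bullet> i) * ((b \<bullet> j) * f i j))"
    by (simp only: linear_sum[OF assms(1)] linear_scale[OF assms(1)] real_scaleR_def sum_distrib_left)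
  finally show ?thesis .
qed

text \<open>The bundle over the coordinate domain \<open>S\<close> in logarithmic fibre coordinates, with the moment map
  \<open>\<phi>\<close> and the Kaehler form \<open>w\<close>; the fibre is the universal cover of the torus.\<close>

locale log_model =
  fixes S :: "(complex^'m::finite) set" and \<phi> :: "complex^('n::finite + 'm) \<Rightarrow> real^'n"
    and w :: "complex^('n + 'm) \<Rightarrow> complex^('n + 'm) \<Rightarrow> complex^('n + 'm) \<Rightarrow> real"
  assumes open_S: "open S"
    and smooth_\<phi>: "smooth_on (base -` S) \<phi>"
    and smooth_w: "\<And>u v. smooth_on (base -` S) (\<lambda>x. w x u v)"
    and bilinear_w: "\<And>x. base x \<in> S \<Longrightarrow> bilinear (w x)"
    and w_alt: "\<And>x u. base x \<in> S \<Longrightarrow> w x u u = 0"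
    and w_J: "\<And>x u v. base x \<in> S \<Longrightarrow> w x (\<i> *s u) (\<i> *s v) = w x u v"
    and w_pos: "\<And>x u. base x \<in> S \<Longrightarrow> u \<noteq> 0 \<Longrightarrow> 0 < w x u (\<i> *s u)"
    and w_closed: "\<And>x u v z. base x \<in> S \<Longrightarrow>
        dd (\<lambda>y. w y v z) x u - dd (\<lambda>y. w y u z) x v + dd (\<lambda>y. w y u v) x z = 0"
    and w_moment: "\<And>x j v. base x \<in> S \<Longrightarrow> w x (\<i> *s vert j) v = - (dd \<phi> x v $ j)"
    and \<phi>_invariant: "\<And>x j. base x \<in> S \<Longrightarrow> dd \<phi> x (\<i> *s vert j) = 0"
begin

abbreviation \<Omega> :: "(complex^('n + 'm)) set" where "\<Omega> \<equiv> base -` S"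

lemma open_\<Omega>: "open \<Omega>" by (rule open_base[OF open_S])

lemma lin_w: "base x \<in> S \<Longrightarrow> linear (w x u)" and lin_w': "base x \<in> S \<Longrightarrow> linear (\<lambda>u. w x u v)"
  using bilinear_w unfolding bilinear_def by auto

lemma w_antisym: assumes x: "base x \<in> S" shows "w x v u = - w x u v"
proof -
  have "w x (u + v) (u + v) = 0" by (rule w_alt[OF x])
  then have "w x u u + w x u v + (w x v u + w x v v) = 0"
    by (simp add: linear_add[OF lin_w[OF x]] linear_add[OF lin_w'[OF x]])
  then show ?thesis using w_alt[OF x] by simp
qed

lemma \<phi>_diff: "base x \<in> S \<Longrightarrow> \<phi> differentiable (at x)"
  by (rule smooth_on_differentiable[OF smooth_\<phi>]) simp

lemma lin_\<phi>: "base x \<in> S \<Longrightarrow> linear (dd \<phi> x)"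
  by (rule linear_dd[OF \<phi>_diff])

lemma w_vert: "base x \<in> S \<Longrightarrow> w x (vert j) v = - (dd \<phi> x (\<i> *s v) $ j)"
  using w_J[of x "vert j" v] w_moment[of x j "\<i> *s v"] by simp

text \<open>Both sides are \<open>w(\<partial>/\<partial>t\<^sub>j, \<partial>/\<partial>\<theta>\<^sub>k)\<close> up to sign: \<open>\<phi>\<close> is a gradient in the variables \<open>t\<close>.\<close>

lemma \<phi>_symmetric: assumes x: "base x \<in> S" shows "dd \<phi> x (vert k) $ j = dd \<phi> x (vert j) $ k"
proof -
  have "dd \<phi> x (vert k) $ j = - w x (\<i> *s vert j) (vert k)" by (simp add: w_moment[OF x])
  also have "\<dots> = - w x (\<i> *s (\<i> *s vert j)) (\<i> *s vert k)" by (simp only: w_J[OF x])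
  also have "\<dots> = w x (vert j) (\<i> *s vert k)"
    by (simp add: linear_neg[OF lin_w'[OF x]])
  also have "\<dots> = - w x (\<i> *s vert k) (vert j)" by (rule w_antisym[OF x])
  also have "\<dots> = dd \<phi> x (vert j) $ k" by (simp add: w_moment[OF x])
  finally show ?thesis .
qed

lemma \<phi>_vertical:
  assumes x: "base x \<in> S" shows "dd \<phi> x (join a 0) = dd \<phi> x (join (cvec (\<chi> j. Re (a $ j))) 0)"
  using linear_vertical[OF lin_\<phi>[OF x], of a]
    linear_vertical[OF lin_\<phi>[OF x], of "cvec (\<chi> j. Re (a $ j))"]
  by (simp add: \<phi>_invariant[OF x])

text \<open>The derivative of \<open>\<phi>\<close> in the variables \<open>t\<close> is the Gram matrix of the \<open>\<partial>/\<partial>t\<^sub>j\<close> for the Kaehler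
  metric.\<close>

lemma \<phi>_positive:
  assumes x: "base x \<in> S" and t: "t \<noteq> 0"
  shows "0 < dd \<phi> x (join (cvec t) 0) \<bullet> t"
proof -
  let ?u = "join (cvec t) 0 :: complex^('n + 'm)"
  have "?u \<noteq> 0"
    using t by (auto simp: sum_vec_eq_iff vec_eq_iff)
  then have "0 < w x ?u (\<i> *s ?u)" by (rule w_pos[OF x])
  also have "w x ?u (\<i> *s ?u) = (\<Sum>j\<in>UNIV. t $ j * w x (vert j) (\<i> *s ?u))"
    using linear_vertical[OF lin_w'[OF x, of "\<i> *s ?u"], of "cvec t"] by simp
  also have "\<dots> = dd \<phi> x ?u \<bullet> t"
    by (simp add: w_vert[OF x] linear_neg[OF lin_\<phi>[OF x]] inner_vec_def mult.commute)
  finally show ?thesis .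
qed

text \<open>Along the segment from \<open>t'\<close> to \<open>t\<close> the function \<open>\<phi> \<bullet> (t - t')\<close> is strictly increasing.\<close>

lemma \<phi>_injective:
  assumes y: "y \<in> S" and eq: "\<phi> (join (cvec t) y) = \<phi> (join (cvec t') y)"
  shows "t = t'"
proof (rule ccontr)
  assume "t \<noteq> t'"
  define \<tau> where "\<tau> = t - t'"
  have \<tau>: "\<tau> \<noteq> 0" using \<open>t \<noteq> t'\<close> by (simp add: \<tau>_def)
  let ?x = "join (cvec t') y :: complex^('n + 'm)" and ?u = "join (cvec \<tau>) 0 :: complex^('n + 'm)"
  have b: "base (?x + r *\<^sub>R ?u) \<in> S" for r
      by (simp add: linear_add[OF linear_base] linear_scale[OF linear_base] y)
  have d: "((\<lambda>r. \<phi> (?x + r *\<^sub>R ?u) \<bullet> \<tau>) has_real_derivative dd \<phi> (?x + r *\<^sub>R ?u) ?u \<bullet> \<tau>) (at r)" for r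
    unfolding has_real_derivative_iff_has_vector_derivative
    by (rule bounded_linear.has_vector_derivative[OF bounded_linear_inner_left
        dd_line[OF \<phi>_diff[OF b]]])
  obtain r where "\<phi> (?x + 1 *\<^sub>R ?u) \<bullet> \<tau> - \<phi> (?x + 0 *\<^sub>R ?u) \<bullet> \<tau>
      = (1 - 0) * (dd \<phi> (?x + r *\<^sub>R ?u) ?u \<bullet> \<tau>)"
    using MVT2[OF zero_less_one d] by blast
  moreover have "?x + 1 *\<^sub>R ?u = join (cvec t) y"
    by (simp add: sum_vec_eq_iff \<tau>_def)
  ultimately show False using eq \<phi>_positive[OF b[of r] \<tau>] by simp
qed


text \<open>The map \<open>(t, y) \<mapsto> (\<phi>(t, y), y)\<close> is injective on the whole fibre space and has invertible
  derivative, so its set-theoretic inverse is differentiable. The inverse at \<open>(l, y)\<close> is \<open>(\<sigma>(y), y)\<close>.\<close>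

lemma section_differentiable:
  assumes lev: "\<And>y. y \<in> S \<Longrightarrow> \<phi> (graph_of \<sigma> y) = l" and y: "y \<in> S"
  shows "\<sigma> differentiable (at y)"
proof -
  define J :: "(real^'n) \<times> (complex^'m) \<Rightarrow> complex^('n + 'm)" where "J p
      = join (cvec (fst p)) (snd p)" for p
  define G where "G p = (\<phi> (J p), snd p)" for p
  have linJ: "linear J"
    unfolding J_def
    by (rule linear_join_pair[OF linear_compose[OF linear_fst linear_cvec, unfolded o_def] linear_snd])
  have bJ: "base (J p) = snd p" for p by (simp add: J_def)
  have dJ: "(J has_derivative J) (at p)" for p
    using linJ by (intro bounded_linear_imp_has_derivative) (simp add: linear_conv_bounded_linear)
  have dG: "(G has_derivative (\<lambda>q. (dd \<phi> (J p) (J q), snd q))) (at p)" if "snd p \<in> S" for p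
    unfolding G_def
    by (intro has_derivative_Pair has_derivative_compose[OF dJ has_derivative_dd]
        bounded_linear_imp_has_derivative bounded_linear_snd \<phi>_diff) (simp add: bJ that)
  have inj: "inj_on G (UNIV \<times> S)"
  proof (rule inj_onI)
    fix p q assume p: "p \<in> UNIV \<times> S" and "q \<in> UNIV \<times> S" and "G p = G q"
    then have "snd p = snd q" "\<phi> (join (cvec (fst p)) (snd p)) = \<phi> (join (cvec (fst q)) (snd p))"
      by (auto simp: G_def J_def)
    moreover have "snd p \<in> S" using p by auto
    ultimately show "p = q" using \<phi>_injective by (auto simp: prod_eq_iff)
  qed
  define g where "g = inv_into (UNIV \<times> S) G"
  have gG: "g (G p) = p" if "p \<in> UNIV \<times> S" for p
    unfolding g_def by (rule inv_into_f_f[OF inj that])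
  have G\<sigma>: "G (\<sigma> y', y') = (l, y')" if "y' \<in> S" for y'
    using lev[OF that] by (simp add: G_def J_def graph_of_def)
  let ?p = "(\<sigma> y, y)"
  let ?G' = "\<lambda>q. (dd \<phi> (J ?p) (J q), snd q)"
  have bp: "base (J ?p) \<in> S" using y by (simp add: bJ)
  have lG': "linear ?G'"
    using has_derivative_linear[OF dG[of ?p]] y by simp
  have "inj ?G'"
  proof -
    have "q = 0" if "?G' q = 0" for q
    proof -
      have "snd q = 0" "dd \<phi> (J ?p) (join (cvec (fst q)) 0) = 0"
        using that by (auto simp: J_def zero_prod_def)
      then have "fst q = 0" using \<phi>_positive[OF bp, of "fst q"] by force
      then show ?thesis using \<open>snd q = 0\<close> by (simp add: prod_eq_iff)
    qed
    then show ?thesis using linear_injective_0[OF lG'] by blast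
  qed
  then obtain g' where g': "linear g'" "\<And>q. ?G' (g' q) = q"
    using linear_injective_isomorphism[OF lG'] by blast
  have "G differentiable (at p)" if "p \<in> UNIV \<times> S" for p
    using dG[of p] that unfolding differentiable_def by auto
  then have contG: "continuous_on (UNIV \<times> S) G"
    by (intro differentiable_imp_continuous_on differentiable_at_imp_differentiable_on)
  have "(g has_derivative g') (at (G ?p))"
    by (rule has_derivative_inverse_strong[OF _ _ contG gG dG])
       (use y g' open_S in \<open>auto simp: open_Times fun_eq_iff\<close>)
  then have dg: "(g has_derivative g') (at (l, y))" by (simp add: G\<sigma>[OF y])
  have "((\<lambda>y'. (l, y')) has_derivative (\<lambda>v. (0, v))) (at y)"
    by (auto intro!: derivative_eq_intros)
  from bounded_linear.has_derivative[OF bounded_linear_fst has_derivative_compose[OF this dg]]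
  have "(\<lambda>y'. fst (g (l, y'))) differentiable (at y)" by (auto simp: differentiable_def)
  moreover have "fst (g (l, y')) = \<sigma> y'" if "y' \<in> S" for y'
    using gG[of "(\<sigma> y', y')"] G\<sigma>[OF that] that by simp
  ultimately show ?thesis
    using differentiable_eq_open[OF open_S y, of "\<lambda>y'. fst (g (l, y'))" \<sigma>] by simp
qed

text \<open>The graph stays in the level set.\<close>

lemma section_tangent:
  assumes lev: "\<And>y. y \<in> S \<Longrightarrow> \<phi> (graph_of \<sigma> y) = l" and y: "y \<in> S"
  shows "dd \<phi> (graph_of \<sigma> y) (join (cvec (dd \<sigma> y v)) v) = 0"
proof -
  have d: "\<sigma> differentiable (at y)" by (rule section_differentiable[OF assms])
  have "dd \<phi> (graph_of \<sigma> y) (dd (graph_of \<sigma>) y v) = dd (\<lambda>y. \<phi> (graph_of \<sigma> y)) y v"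
    by (rule dd_compose[symmetric])
       (use dd_graph_of(1)[OF d] y in \<open>auto simp: differentiable_def
           intro: \<phi>_diff[unfolded differentiable_def]\<close>)
  also have "\<dots> = 0" by (rule dd_const_family[OF open_S y lev])
  finally show ?thesis by (simp add: dd_graph_of(2)[OF d])
qed

text \<open>By Cramer's rule the tangency of the graph to the level set determines the derivative of \<open>\<sigma>\<close> at
  \<open>y\<close> as a smooth function of \<open>(\<sigma>(y), y)\<close>, which raises the class of \<open>\<sigma>\<close> by one in each step.\<close>

lemma section_smooth:
  assumes lev: "\<And>y. y \<in> S \<Longrightarrow> \<phi> (graph_of \<sigma> y) = l"
  shows "smooth_on S \<sigma>"
proof -
  define A where "A y = (\<chi> j k. dd \<phi> (graph_of \<sigma> y) (vert k) $ j)" for y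
  define b where "b v y = - dd \<phi> (graph_of \<sigma> y) (join 0 v)" for v y
  have dsig: "\<sigma> differentiable (at y)" if "y \<in> S" for y by (rule section_differentiable[OF lev that])
  have Av: "A y *v t = dd \<phi> (graph_of \<sigma> y) (join (cvec t) 0)" if y: "y \<in> S" for y t
  proof -
    have "base (graph_of \<sigma> y) \<in> S" using y by simp
    from linear_vertical[OF lin_\<phi>[OF this], of "cvec t"]
    show ?thesis by (simp add: vec_eq_iff matrix_vector_mult_def A_def mult.commute)
  qed
  have det: "det (A y) \<noteq> 0" if y: "y \<in> S" for y
  proof
    assume "det (A y) = 0"
    then have "\<not> inj ((*v) (A y))"
      using invertible_det_nz[of "A y"] invertible_left_inverse[of "A y"]
          matrix_left_invertible_injective[of "A y"] by blast
    then have "\<not> (\<forall>t. A y *v t = 0 \<longrightarrow> t = 0)"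
      using linear_injective_0[OF matrix_vector_mul_linear[of "A y"]] by blast
    then obtain t where "t \<noteq> 0" "A y *v t = 0" by blast
    then show False using \<phi>_positive[of "graph_of \<sigma> y" t] y by (simp add: Av[OF y])
  qed
  have sol: "A y *v dd \<sigma> y v = b v y" if y: "y \<in> S" for y v
  proof -
    have bs: "base (graph_of \<sigma> y) \<in> S" using y by simp
    have "join (cvec (dd \<sigma> y v)) v = join (cvec (dd \<sigma> y v)) 0 + join 0 v" by (simp add: join_add)
    then show ?thesis
      using section_tangent[OF lev y, of v] linear_add[OF lin_\<phi>[OF bs]]
      by (simp add: Av[OF y] b_def eq_neg_iff_add_eq_0)
  qed
  have cr: "dd \<sigma> y v = (\<chi> k. det (\<chi> i j. if j = k then b v y $ i else A y $ i $ j) * inverse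
      (det (A y)))"
    if "y \<in> S" for y v
    using cramer[OF det[OF that], of "dd \<sigma> y v" "b v y"] sol[OF that] by (simp add: divide_inverse)
  have "Ck_on k S \<sigma>" for k
  proof (induction k)
    case 0
    have "continuous_on S \<sigma>"
      by (intro differentiable_imp_continuous_on differentiable_at_imp_differentiable_on dsig)
    then show ?case by simp
  next
    case (Suc k)
    have graph_of: "Ck_on k S (graph_of \<sigma>)"
      unfolding graph_of_def
      by (intro Ck_on_join Ck_on_bounded_linear[OF bounded_linear_cvec] Ck_on_id open_S Suc)
    have d: "Ck_on k S (\<lambda>y. dd \<phi> (graph_of \<sigma> y) u)" for u
      by (rule Ck_on_compose[OF open_S open_\<Omega> _ graph_of])
         (use smooth_on_dd[OF smooth_\<phi>] in \<open>auto simp: smooth_on_def\<close>)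
    have A: "Ck_on k S (\<lambda>y. A y $ i $ j)" for i j
      unfolding A_def using Ck_on_bounded_linear[OF bounded_linear_vec_nth open_S d] by simp
    have b: "Ck_on k S (\<lambda>y. b v y $ i)" for v i
      unfolding b_def using Ck_on_bounded_linear[OF bounded_linear_minus[OF bounded_linear_vec_nth]
          open_S d] by simp
    have D: "Ck_on k S (\<lambda>y. det (C y))" if "\<And>i j. Ck_on k S (\<lambda>y. C y $ i $ j)" for C :: "_ \<Rightarrow> real^'n^'n"
      unfolding det_def
      by (intro Ck_on_sum Ck_on_bilinear[OF bounded_bilinear_mult] Ck_on_prod open_S that Ck_on_const)
    have E: "Ck_on k S (\<lambda>y. (\<chi> i j. if j = m then b v y $ i else A y $ i $ j) $ i $ j)" for v m i j
      by (cases "j = m") (simp_all add: A b)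
    have "Ck_on k S (\<lambda>y. \<chi> m. det (\<chi> i j. if j = m then b v y $ i else A y $ i $ j) * inverse
        (det (A y)))" for v
      by (intro Ck_on_vec Ck_on_bilinear[OF bounded_bilinear_mult] Ck_on_inverse open_S det D A E)
    then have "Ck_on k S (\<lambda>y. dd \<sigma> y v)" for v
      by (rule Ck_on_eq[OF open_S, rotated]) (simp add: cr)
    then show ?case using dsig by simp
  qed
  then show ?thesis by (simp add: smooth_on_def)
qed


text \<open>The first order conditions on an admissible potential, in logarithmic coordinates:
  \<open>z\<^sub>j \<partial>/\<partial>z\<^sub>j = (\<partial>/\<partial>t\<^sub>j - i \<partial>/\<partial>\<theta>\<^sub>j) / 2\<close>, and the second condition is torus invariance. Dropping the
      equation
  \<open>\<omega> = i \<partial>\<partial>\<close>-bar \<open>\<rho>\<close> makes existence elementary.\<close>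

definition fibre_potential :: "(complex^('n + 'm) \<Rightarrow> real) \<Rightarrow> bool" where
  "fibre_potential \<rho> \<longleftrightarrow> smooth_on \<Omega> \<rho> \<and>
     (\<forall>x\<in>\<Omega>. \<forall>j. dd \<rho> x (vert j) = 2 * \<phi> x $ j \<and> dd \<rho> x (\<i> *s vert j) = 0)"

text \<open>Integrate the closed form \<open>2 \<Sum> \<phi>\<^sub>j dt\<^sub>j\<close> along the rays \<open>r \<mapsto> (r t, w)\<close> of the fibre.\<close>

lemma fibre_potential_exists: "\<exists>\<rho>. fibre_potential \<rho>"
proof -
  define h :: "real \<times> (complex^('n + 'm)) \<Rightarrow> complex^('n + 'm)"
    where "h p = join (fst p *\<^sub>R fib (snd p)) (base (snd p))" for p
  define f where "f p = (\<Sum>j\<in>UNIV. (2 * Re (fib (snd p) $ j)) * (\<phi> (h p) $ j))" for p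
  define \<rho> where "\<rho> x = integral {0..1} (\<lambda>t. f (t, x))" for x
  let ?W = "{p::real \<times> (complex^('n + 'm)). base (snd p) \<in> S}"
  have oW: "open ?W"
  proof -
    have "?W = UNIV \<times> \<Omega>" by auto
    then show ?thesis by (simp add: open_Times open_\<Omega>)
  qed
  have bh: "base (h p) = base (snd p)" for p by (simp add: h_def)
  have b1: "bounded_linear (\<lambda>p::real \<times> (complex^('n + 'm)). fib (snd p))"
    and b2: "bounded_linear (\<lambda>p::real \<times> (complex^('n + 'm)). base (snd p))"
    by (rule bounded_linear_compose[OF bounded_linear_fib bounded_linear_snd]
          bounded_linear_compose[OF bounded_linear_base bounded_linear_snd])+
  have b3: "bounded_linear (\<lambda>p::real \<times> (complex^('n + 'm)). 2 * Re (fib (snd p) $ j))" for j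
    by (rule bounded_linear_compose[OF bounded_linear_mult_right
        bounded_linear_compose[OF bounded_linear_Re
          bounded_linear_compose[OF bounded_linear_vec_nth b1]]])
  have smh: "smooth_on ?W h"
    unfolding h_def smooth_on_def
    by (intro allI Ck_on_join Ck_on_bilinear[OF bounded_bilinear_scaleR] oW
        Ck_on_bounded_linear[OF bounded_linear_fst oW Ck_on_id[OF oW]]
        Ck_on_bounded_linear[OF b1 oW Ck_on_id[OF oW]] Ck_on_bounded_linear[OF b2 oW Ck_on_id[OF oW]])
  have sm\<phi>h: "smooth_on ?W (\<lambda>p. \<phi> (h p) $ j)" for j
    by (intro smooth_on_vec_nth smooth_on_compose[OF oW open_\<Omega> _ smh smooth_\<phi>] oW) (auto simp: bh)
  have smf: "smooth_on ?W f"
    unfolding f_def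
    by (intro smooth_intros oW sm\<phi>h smooth_on_linear[OF bounded_linear.linear[OF b3]])
  have sub: "{0..1} \<times> \<Omega> \<subseteq> ?W" by auto
  have dfib: "dd (\<lambda>p::real \<times> (complex^('n + 'm)). 2 * Re (fib (snd p) $ j)) q u
      = 2 * Re (fib (snd u) $ j)" for j q u
    by (rule dd_linear[OF b3])
  have dh: "dd h (t, x) (s, v) = join (t *\<^sub>R fib v + s *\<^sub>R fib x) (base v)" for t x s v
  proof -
    have l: "bounded_linear (\<lambda>p::(complex^'n) \<times> (complex^'m). join (fst p) (snd p))"
      using linear_join by (simp add: linear_conv_bounded_linear)
    have "((\<lambda>p. fst p *\<^sub>R fib (snd p)) has_derivative
        (\<lambda>q. fst (t, x) *\<^sub>R fib (snd q) + fst q *\<^sub>R fib (snd (t, x)))) (at (t, x))"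
      by (intro has_derivative_scaleR bounded_linear_imp_has_derivative bounded_linear_fst b1)
    from bounded_linear.has_derivative[OF l
        has_derivative_Pair[OF this bounded_linear_imp_has_derivative[OF b2]]]
    show ?thesis unfolding h_def[abs_def] by (simp add: dd_eqI)
  qed
  have df: "dd f (t, x) (0, v) = (\<Sum>j\<in>UNIV. 2 * Re (fib x $ j) * dd \<phi> (h (t, x))
      (join (t *\<^sub>R fib v) (base v)) $ j
      + 2 * Re (fib v $ j) * (\<phi> (h (t, x)) $ j))" if x: "x \<in> \<Omega>" for t x v
  proof -
    have inW: "(t, x) \<in> ?W" using x by simp
    have dphi: "\<phi> differentiable (at (h (t, x)))" by (rule \<phi>_diff) (use x in \<open>simp add: bh\<close>)
    have d1: "dd (\<lambda>p. \<phi> (h p) $ j) (t, x) (0, v) = dd \<phi> (h (t, x)) (join (t *\<^sub>R fib v) (base v)) $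
        j" for j
    proof -
      have dphih: "(\<lambda>p. \<phi> (h p)) differentiable (at (t, x))"
        by (rule smooth_on_differentiable[OF smooth_on_compose[OF oW open_\<Omega> _ smh smooth_\<phi>] inW])
            (auto simp: bh)
      have "dd (\<lambda>p. \<phi> (h p) $ j) (t, x) (0, v) = dd (\<lambda>p. \<phi> (h p)) (t, x) (0, v) $ j"
        by (rule dd_vec_nth[OF dphih])
      then show ?thesis
        by (simp add: dd_compose[OF smooth_on_differentiable[OF smh inW] dphi] dh)
    qed
    have d2: "(\<lambda>p. 2 * Re (fib (snd p) $ j)) differentiable (at (t, x))" for j
      using bounded_linear_imp_differentiable[OF b3] .
    have "dd f (t, x) (0, v) = (\<Sum>j\<in>UNIV. dd (\<lambda>p. (2 * Re (fib (snd p) $ j)) * (\<phi> (h p) $ j)) (t, x)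
        (0, v))"
      unfolding f_def
      by (rule dd_sum) (rule differentiable_mult[OF d2 smooth_on_differentiable[OF sm\<phi>h inW]])
    also have "\<dots> = (\<Sum>j\<in>UNIV. 2 * Re (fib x $ j) * dd \<phi> (h (t, x)) (join (t *\<^sub>R fib v) (base v)) $ j
      + 2 * Re (fib v $ j) * (\<phi> (h (t, x)) $ j))"
      unfolding dd_mult[OF d2 smooth_on_differentiable[OF sm\<phi>h inW]] dfib d1 by simp
    finally show ?thesis .
  qed
  have d\<rho>: "dd \<rho> x v = integral {0..1} (\<lambda>t. dd f (t, x) (0, v))" if "x \<in> \<Omega>" for x v
    unfolding \<rho>_def
    by (rule dd_eqI[OF has_derivative_integral[OF open_\<Omega> sub _ that]])
       (use smf in \<open>auto simp: smooth_on_def simp del: Ck_on.simps\<close>)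
  have "smooth_on \<Omega> \<rho>"
    unfolding \<rho>_def smooth_on_def
    using Ck_on_integral[OF open_\<Omega> sub] smf by (auto simp: smooth_on_def)
  moreover have "dd \<rho> x (\<i> *s vert k) = 0" if x: "x \<in> \<Omega>" for x k
  proof -
    have "dd f (t, x) (0, \<i> *s vert k) = 0" for t
    proof -
      have bs: "base (h (t, x)) \<in> S" using x by (simp add: bh)
      let ?v = "\<i> *s vert k :: complex^('n + 'm)"
      have "join (t *\<^sub>R fib ?v) (base ?v) = t *\<^sub>R ?v"
        by (simp add: sum_vec_eq_iff)
      then have "dd \<phi> (h (t, x)) (join (t *\<^sub>R fib ?v) (base ?v)) = 0"
        by (simp only: linear_scale[OF lin_\<phi>[OF bs]] \<phi>_invariant[OF bs] scaleR_zero_right)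
      then show ?thesis unfolding df[OF x] by (intro sum.neutral) (simp add: axis_def)
    qed
    then show ?thesis by (simp add: d\<rho>[OF x])
  qed
  moreover have "dd \<rho> x (vert k) = 2 * \<phi> x $ k" if x: "x \<in> \<Omega>" for x k
  proof -
    \<comment> \<open>A primitive of the derivative of the integrand in the direction vert k, by symmetry of the
        radial derivative.\<close>
    let ?F = "\<lambda>t. 2 * t * (\<phi> (h (t, x)) $ k)"
    have bs: "base (h (t, x)) \<in> S" for t using x by (simp add: bh)
    have hl: "h (t, x) = join 0 (base x) + t *\<^sub>R join (fib x) 0" for t
      by (simp add: h_def sum_vec_eq_iff)
    have dphik: "dd \<phi> (h (t, x)) (join (fib x) 0) $ k
        = (\<Sum>j\<in>UNIV. Re (fib x $ j) * dd \<phi> (h (t, x)) (vert k) $ j)" for t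
      using linear_vertical[OF lin_\<phi>[OF bs[of t]], of "fib x"]
      by (simp add: \<phi>_invariant[OF bs] \<phi>_symmetric[OF bs[of t], of k])
    have "(?F has_vector_derivative dd f (t, x) (0, vert k)) (at t within {0..1})" for t
    proof -
      have "((\<lambda>t. \<phi> (join 0 (base x) + t *\<^sub>R join (fib x) 0)) has_vector_derivative
          dd \<phi> (join 0 (base x) + t *\<^sub>R join (fib x) 0) (join (fib x) 0)) (at t)"
        by (rule dd_line[OF \<phi>_diff]) (use bs[of t] in \<open>simp only: hl\<close>)
      from bounded_linear.has_vector_derivative[OF bounded_linear_vec_nth this, of k]
      have "((\<lambda>t. \<phi> (h (t, x)) $ k) has_real_derivative dd \<phi> (h (t, x)) (join (fib x) 0) $ k) (at t)"
        by (simp only: hl has_real_derivative_iff_has_vector_derivative)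
      then have F: "(?F has_real_derivative 2 * (\<phi> (h (t, x)) $ k)
          + 2 * t * (dd \<phi> (h (t, x)) (join (fib x) 0) $ k)) (at t)"
        by (auto intro!: derivative_eq_intros)
      have sc: "join (t *\<^sub>R axis k 1) 0 = t *\<^sub>R (vert k :: complex^('n + 'm))"
        by (simp add: sum_vec_eq_iff)
      have "dd f (t, x) (0, vert k) = (\<Sum>j\<in>UNIV. 2 * Re (fib x $ j) * (t * dd \<phi> (h (t, x)) (vert k) $ j))
          + (\<Sum>j\<in>UNIV. 2 * Re (axis k 1 $ j) * (\<phi> (h (t, x)) $ j))"
        unfolding df[OF x] by (simp add: sc linear_scale[OF lin_\<phi>[OF bs]] sum.distrib)
      also have "(\<Sum>j\<in>UNIV. 2 * Re (axis k 1 $ j) * (\<phi> (h (t, x)) $ j)) = 2 * (\<phi> (h (t, x)) $ k)"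
        by (simp add: axis_def if_distrib[of Re] if_distrib[of "\<lambda>u. 2 * u"] if_distribR
            if_distrib[of "\<lambda>u. u * _"] cong: if_cong)
      also have "(\<Sum>j\<in>UNIV. 2 * Re (fib x $ j) * (t * dd \<phi> (h (t, x)) (vert k) $ j))
          = 2 * t * (dd \<phi> (h (t, x)) (join (fib x) 0) $ k)"
        unfolding dphik by (simp add: sum_distrib_left mult_ac)
      finally have "dd f (t, x) (0, vert k) = 2 * (\<phi> (h (t, x)) $ k)
          + 2 * t * (dd \<phi> (h (t, x)) (join (fib x) 0) $ k)"
        by simp
      then show ?thesis
        using has_field_derivative_at_within[OF F]
            by (simp add: has_real_derivative_iff_has_vector_derivative)
    qed
    then have "((\<lambda>t. dd f (t, x) (0, vert k)) has_integral (?F 1 - ?F 0)) {0..1}"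
      by (intro fundamental_theorem_of_calculus) auto
    then have "dd \<rho> x (vert k) = ?F 1 - ?F 0"
      unfolding d\<rho>[OF x] by (rule integral_unique)
    also have "\<dots> = 2 * \<phi> x $ k" by (simp add: h_def)
    finally show ?thesis .
  qed
  ultimately have "fibre_potential \<rho>" unfolding fibre_potential_def by blast
  then show ?thesis by blast
qed


text \<open>The form \<open>\<beta>\<close> with \<open>\<omega> = i \<partial>\<partial>\<close>-bar \<open>\<rho> + \<beta>\<close>.\<close>

definition basic_part :: "(complex^('n + 'm) \<Rightarrow> real) \<Rightarrow> complex^('n + 'm) \<Rightarrow> complex^('n + 'm)
    \<Rightarrow> complex^('n + 'm) \<Rightarrow> real" where
  "basic_part \<rho> x u v = w x u v - levi \<rho> x u v"

lemma const_along_fibre: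
  fixes f :: "complex^('n + 'm) \<Rightarrow> real"
  assumes "base x \<in> S" "base x' = base x"
    and f: "\<And>x. base x \<in> S \<Longrightarrow> f differentiable (at x)"
    and 0: "\<And>x j. base x \<in> S \<Longrightarrow> dd f x (vert j) = 0" "\<And>x j. base x \<in> S \<Longrightarrow> dd f x (\<i> *s vert j) = 0"
  shows "f x' = f x"
proof -
  let ?v = "x' - x"
  have v: "?v = join (fib ?v) 0"
    using assms(2) by (simp add: sum_vec_eq_iff vec_eq_iff)
  have b: "base (x + r *\<^sub>R ?v) \<in> S" for r
    using assms(1,2) by (simp add: linear_add[OF linear_base] linear_scale[OF linear_base]
        linear_diff[OF linear_base])
  have "dd f (x + r *\<^sub>R ?v) (join (fib ?v) 0) = 0" for r
    using linear_vertical[OF linear_dd[OF f[OF b[of r]]], of "fib ?v"] by (simp add: 0[OF b])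
  then have "dd f (x + r *\<^sub>R ?v) ?v = 0" for r
    by (metis v)
  then have "((\<lambda>r. f (x + r *\<^sub>R ?v)) has_real_derivative 0) (at r)" for r
    using dd_line[OF f[OF b[of r]]] by (simp add: has_real_derivative_iff_has_vector_derivative)
  then have "f (x + 1 *\<^sub>R ?v) = f (x + 0 *\<^sub>R ?v)"
    using DERIV_isconst_all[of "\<lambda>r. f (x + r *\<^sub>R ?v)" 1 0] by blast
  then show ?thesis by simp
qed

lemma smooth_\<phi>_nth: "smooth_on \<Omega> (\<lambda>x. \<phi> x $ j)"
  by (rule smooth_on_vec_nth[OF open_\<Omega> smooth_\<phi>])

lemma dd_\<phi>_nth: "base x \<in> S \<Longrightarrow> dd (\<lambda>x. \<phi> x $ j) x v = dd \<phi> x v $ j"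
  by (rule dd_vec_nth[OF \<phi>_diff])

text \<open>Closedness of \<open>w\<close>, evaluated on one vertical and two further constant fields, gives the vertical
  derivative of \<open>w\<close> in terms of the components with a vertical argument, which are derivatives of
  the moment map.\<close>

lemma dd_w_vertical:
  assumes x: "base x \<in> S"
  shows "dd (\<lambda>y. w y u v) x (vert j) = levi (\<lambda>y. 2 * \<phi> y $ j) x u v"
    and "dd (\<lambda>y. w y u v) x (\<i> *s vert j) = 0"
proof -
  have x': "x \<in> \<Omega>" using x by simp
  let ?f = "\<lambda>y. \<phi> y $ j"
  have d: "(\<lambda>y. dd ?f y u) differentiable (at x)" for u
    by (rule smooth_on_differentiable[OF smooth_on_dd[OF smooth_\<phi>_nth] x'])
  have m: "bounded_linear (\<lambda>r::real. - r)" by (rule bounded_linear_minus[OF bounded_linear_ident])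
  have 1: "dd (\<lambda>y. w y (\<i> *s vert j) u) x v = - dd (\<lambda>y. dd ?f y u) x v" for u v
  proof -
    have "dd (\<lambda>y. w y (\<i> *s vert j) u) x v = dd (\<lambda>y. - dd ?f y u) x v"
      by (rule fun_cong[OF dd_eq_open[OF open_\<Omega> x']]) (simp add: w_moment dd_\<phi>_nth)
    then show ?thesis by (simp add: dd_bounded_linear[OF m d])
  qed
  have 2: "dd (\<lambda>y. w y (vert j) u) x v = - dd (\<lambda>y. dd ?f y (\<i> *s u)) x v" for u v
  proof -
    have "dd (\<lambda>y. w y (vert j) u) x v = dd (\<lambda>y. - dd ?f y (\<i> *s u)) x v"
      by (rule fun_cong[OF dd_eq_open[OF open_\<Omega> x']]) (simp add: w_vert dd_\<phi>_nth)
    then show ?thesis by (simp add: dd_bounded_linear[OF m d])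
  qed
  have "dd (\<lambda>y. w y u v) x (\<i> *s vert j) = dd (\<lambda>y. w y (\<i> *s vert j) v) x u
      - dd (\<lambda>y. w y (\<i> *s vert j) u) x v"
    using w_closed[OF x, where u = "\<i> *s vert j" and v = u and z = v] by simp
  also have "\<dots> = 0"
    unfolding 1 using dd_symmetric[OF open_\<Omega> smooth_\<phi>_nth x'] by simp
  finally show "dd (\<lambda>y. w y u v) x (\<i> *s vert j) = 0" .
  have "dd (\<lambda>y. w y u v) x (vert j) = dd (\<lambda>y. w y (vert j) v) x u - dd (\<lambda>y. w y (vert j) u) x v"
    using w_closed[OF x, where u = "vert j" and v = u and z = v] by simp
  also have "\<dots> = 2 * levi ?f x u v"
    unfolding 2 levi_def by simp
  also have "\<dots> = levi (\<lambda>y. 2 * \<phi> y $ j) x u v"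
    by (rule levi_cmult[OF open_\<Omega> smooth_\<phi>_nth x', symmetric])
  finally show "dd (\<lambda>y. w y u v) x (vert j) = levi (\<lambda>y. 2 * \<phi> y $ j) x u v" .
qed

lemma dd_levi:
  fixes f :: "complex^('n + 'm) \<Rightarrow> real"
  assumes f: "smooth_on \<Omega> f" and x: "x \<in> \<Omega>"
  shows "dd (\<lambda>x. levi f x u v) x z = levi (\<lambda>y. dd f y z) x u v"
proof -
  have s2: "smooth_on \<Omega> (\<lambda>y. dd (\<lambda>y. dd f y a) y b)" for a b
    by (rule smooth_on_dd[OF smooth_on_dd[OF f]])
  have *: "dd (\<lambda>y. dd (\<lambda>y. dd f y a) y b) x z = dd (\<lambda>y. dd (\<lambda>y. dd f y z) y a) x b" for a b
  proof -
    have "dd (\<lambda>y. dd (\<lambda>y. dd f y a) y b) x z = dd (\<lambda>y. dd (\<lambda>y. dd f y a) y z) x b"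
      by (rule dd_symmetric[OF open_\<Omega> smooth_on_dd[OF f] x])
    also have "\<dots> = dd (\<lambda>y. dd (\<lambda>y. dd f y z) y a) x b"
      by (rule fun_cong[OF dd_eq_open[OF open_\<Omega> x]]) (rule dd_symmetric[OF open_\<Omega> f])
    finally show ?thesis .
  qed
  have "dd (\<lambda>x. levi f x u v) x z = (1/2) *\<^sub>R (dd (\<lambda>y. dd (\<lambda>y. dd f y (\<i> *s u)) y v) x z
      - dd (\<lambda>y. dd (\<lambda>y. dd f y (\<i> *s v)) y u) x z)"
    unfolding levi_def
    by (subst dd_bounded_linear[OF bounded_linear_scaleR_right])
       (auto intro!: differentiable_diff smooth_on_differentiable[OF s2 x]
           simp: dd_diff[OF smooth_on_differentiable[OF s2 x] smooth_on_differentiable[OF s2 x]])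
  then show ?thesis unfolding * levi_def .
qed

text \<open>The derivative of \<open>w\<close> along \<open>\<partial>/\<partial>t\<^sub>j\<close> is the Levi form of \<open>2 \<phi>\<^sub>j = \<partial>\<rho>/\<partial>t\<^sub>j\<close>, and mixed
    derivatives of \<open>\<rho>\<close>
  commute.\<close>

lemma basic_part_const:
  assumes \<rho>: "fibre_potential \<rho>" and x: "base x \<in> S" "base x' = base x"
  shows "basic_part \<rho> x' u v = basic_part \<rho> x u v"
proof (rule const_along_fibre[OF x])
  have s: "smooth_on \<Omega> \<rho>" using \<rho> by (simp add: fibre_potential_def)
  have sw: "(\<lambda>x. w x u v) differentiable (at x)" if "base x \<in> S" for x
    by (rule smooth_on_differentiable[OF smooth_w]) (simp add: that)
  have sl: "(\<lambda>x. levi \<rho> x u v) differentiable (at x)" if "base x \<in> S" for x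
    by (rule smooth_on_differentiable[OF smooth_on_levi[OF open_\<Omega> s]]) (simp add: that)
  fix x :: "complex^('n + 'm)" and j assume x: "base x \<in> S"
  then have x': "x \<in> \<Omega>" by simp
  show "(\<lambda>x. basic_part \<rho> x u v) differentiable (at x)"
    unfolding basic_part_def by (intro differentiable_diff sw sl x)
  have "levi (\<lambda>y. dd \<rho> y (vert j)) x u v = levi (\<lambda>y. 2 * \<phi> y $ j) x u v"
    by (rule levi_eq_open[OF open_\<Omega> x']) (use \<rho> in \<open>simp add: fibre_potential_def\<close>)
  then show "dd (\<lambda>x. basic_part \<rho> x u v) x (vert j) = 0"
    unfolding basic_part_def dd_diff[OF sw[OF x] sl[OF x]] dd_levi[OF s x'] dd_w_vertical(1)[OF x]
        by simp
  have "levi (\<lambda>y. dd \<rho> y (\<i> *s vert j)) x u v = levi (\<lambda>y. 0) x u v"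
    by (rule levi_eq_open[OF open_\<Omega> x']) (use \<rho> in \<open>simp add: fibre_potential_def\<close>)
  then show "dd (\<lambda>x. basic_part \<rho> x u v) x (\<i> *s vert j) = 0"
    unfolding basic_part_def dd_diff[OF sw[OF x] sl[OF x]] dd_levi[OF s x'] dd_w_vertical(2)[OF x]
    by (simp add: levi_def frechet_derivative_const)
qed

lemma dd_dd_lin:
  fixes f :: "complex^('n + 'm) \<Rightarrow> real"
  assumes f: "smooth_on \<Omega> f" and x: "x \<in> \<Omega>"
  shows "linear (\<lambda>v. dd (\<lambda>y. dd f y v) x u)"
proof -
  have "dd (\<lambda>y. dd f y v) x u = dd (\<lambda>y. dd f y u) x v" for v
    by (rule dd_symmetric[OF open_\<Omega> f x])
  then show ?thesis
    using linear_dd[OF smooth_on_differentiable[OF smooth_on_dd[OF f, of u] x]] by simp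
qed

lemma levi_J:
  fixes f :: "complex^('n + 'm) \<Rightarrow> real"
  assumes f: "smooth_on \<Omega> f" and x: "x \<in> \<Omega>"
  shows "levi f x (\<i> *s u) (\<i> *s v) = levi f x u v"
  unfolding levi_def using dd_symmetric[OF open_\<Omega> f x, of u "\<i> *s v"]
      dd_symmetric[OF open_\<Omega> f x, of v "\<i> *s u"]
  by (simp add: linear_neg[OF dd_dd_lin[OF f x]])

lemma basic_part_linear:
  assumes \<rho>: "fibre_potential \<rho>" and x: "base x \<in> S"
  shows "linear (\<lambda>u. basic_part \<rho> x u v)" "basic_part \<rho> x v u = - basic_part \<rho> x u v"
proof -
  have s: "smooth_on \<Omega> \<rho>" using \<rho> by (simp add: fibre_potential_def)
  have x': "x \<in> \<Omega>" using x by simp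
  have l1: "linear (\<lambda>u. dd (\<lambda>y. dd \<rho> y (\<i> *s u)) x v)"
    using linear_compose[OF bounded_linear.linear[OF bounded_linear_i] dd_dd_lin[OF s x', of v]]
        by (simp add: o_def)
  have l2: "linear (\<lambda>u. dd (\<lambda>y. dd \<rho> y (\<i> *s v)) x u)"
    by (rule linear_dd[OF smooth_on_differentiable[OF smooth_on_dd[OF s] x']])
  show "linear (\<lambda>u. basic_part \<rho> x u v)"
    unfolding basic_part_def levi_def
    by (intro linear_compose_sub lin_w'[OF x] linear_compose_scale_right l1 l2)
  show "basic_part \<rho> x v u = - basic_part \<rho> x u v"
    using w_antisym[OF x, of v u] levi_antisym[of \<rho> x v u] by (simp add: basic_part_def)
qed

text \<open>For the Levi form of \<open>\<rho>\<close> the value on \<open>(\<partial>/\<partial>\<theta>\<^sub>j, v)\<close> is \<open>- d\<phi>\<^sub>j v\<close>, as for \<open>w\<close>; the directions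
    \<open>\<partial>/\<partial>t\<^sub>j\<close>
  follow because both forms are of type \<open>(1,1)\<close>.\<close>

lemma basic_part_vertical:
  assumes \<rho>: "fibre_potential \<rho>" and x: "base x \<in> S"
  shows "basic_part \<rho> x (join a 0) v = 0"
proof -
  have s: "smooth_on \<Omega> \<rho>" using \<rho> by (simp add: fibre_potential_def)
  have x': "x \<in> \<Omega>" using x by simp
  have i: "basic_part \<rho> x (\<i> *s vert j) v = 0" for j v
  proof -
    have "dd (\<lambda>y. dd \<rho> y (\<i> *s (\<i> *s vert j))) x v = - dd (\<lambda>y. dd \<rho> y (vert j)) x v"
      by (simp add: linear_neg[OF dd_dd_lin[OF s x']])
    also have "dd (\<lambda>y. dd \<rho> y (vert j)) x v = dd (\<lambda>y. 2 * \<phi> y $ j) x v"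
      by (rule fun_cong[OF dd_eq_open[OF open_\<Omega> x']]) (use \<rho> in \<open>simp add: fibre_potential_def\<close>)
    also have "\<dots> = 2 * (dd \<phi> x v $ j)"
      by (simp add: dd_cmult smooth_on_differentiable[OF smooth_\<phi>_nth x'] dd_\<phi>_nth[OF x])
    finally have 1: "dd (\<lambda>y. dd \<rho> y (\<i> *s (\<i> *s vert j))) x v = - (2 * (dd \<phi> x v $ j))" .
    have "dd (\<lambda>y. dd \<rho> y (\<i> *s v)) x (\<i> *s vert j) = dd (\<lambda>y. dd \<rho> y (\<i> *s vert j)) x (\<i> *s v)"
      by (rule dd_symmetric[OF open_\<Omega> s x'])
    also have "\<dots> = 0"
      by (rule dd_const_family[OF open_\<Omega> x']) (use \<rho> in \<open>simp add: fibre_potential_def\<close>)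
    finally show ?thesis unfolding basic_part_def levi_def 1 w_moment[OF x] by simp
  qed
  have J: "basic_part \<rho> x (\<i> *s u) (\<i> *s v) = basic_part \<rho> x u v" for u v
    unfolding basic_part_def by (simp add: w_J[OF x] levi_J[OF s x'])
  have "basic_part \<rho> x (vert j) v = 0" for j
    using J[of "vert j" v] i[of j "\<i> *s v"] by simp
  then show ?thesis
    using linear_vertical[OF basic_part_linear(1)[OF \<rho> x, of v], of a] i by simp
qed

text \<open>The form \<open>\<beta>\<close> annihilates vertical vectors and is constant along the fibres, that is, it is pulled
  back from the base.\<close>

lemma basic_part_base:
  assumes \<rho>: "fibre_potential \<rho>" and x: "base x \<in> S" "base x' = base x" "base u' = base u" "base v'
      = base v"
  shows "basic_part \<rho> x' u' v' = basic_part \<rho> x u v"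
proof -
  have vert: "a' - a = join (fib (a' - a)) 0" if "base a' = base a" for a a' :: "complex^('n + 'm)"
    using that by (simp add: sum_vec_eq_iff vec_eq_iff)
  have *: "basic_part \<rho> x a' v = basic_part \<rho> x a v" if "base a' = base a" for a a' v
  proof -
    have "basic_part \<rho> x (a' - a) v = 0" using basic_part_vertical[OF \<rho> x(1)] vert[OF that] by metis
    then show ?thesis by (simp add: linear_diff[OF basic_part_linear(1)[OF \<rho> x(1)]])
  qed
  have "basic_part \<rho> x' u' v' = basic_part \<rho> x u' v'" by (rule basic_part_const[OF \<rho> x(1,2)])
  also have "\<dots> = basic_part \<rho> x u v'" by (rule *[OF x(3)])
  also have "\<dots> = - basic_part \<rho> x v' u" by (rule basic_part_linear(2)[OF \<rho> x(1)])
  also have "\<dots> = - basic_part \<rho> x v u" by (simp add: *[OF x(4)])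
  also have "\<dots> = basic_part \<rho> x u v" using basic_part_linear(2)[OF \<rho> x(1), of u v] by simp
  finally show ?thesis .
qed

text \<open>The pullback of \<open>w\<close> along the graph of \<open>\<sigma>\<close>.\<close>

definition graph_form :: "(complex^'m \<Rightarrow> real^'n) \<Rightarrow> complex^'m \<Rightarrow> complex^'m \<Rightarrow> complex^'m \<Rightarrow> real" where
  "graph_form \<sigma> y u v = w (graph_of \<sigma> y) (join (cvec (dd \<sigma> y u)) u) (join (cvec (dd \<sigma> y v)) v)"

text \<open>The Duistermaat-Heckman equation in coordinates. In the chain rule for the second derivative of
  \<open>\<rho> \<circ> s\<close> the vertical second derivative of \<open>s\<close> is paired with \<open>d\<rho> = 2 l\<close>, which gives the sum over
  \<open>j\<close>. The failure of \<open>ds\<close> to be complex linear is vertical, and the corresponding second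
  derivatives \<open>2 d\<phi>\<^sub>j\<close> of \<open>\<rho>\<close> vanish on the tangent vectors of the level set.\<close>

lemma graph_form_decomposition:
  assumes lev: "\<And>y. y \<in> S \<Longrightarrow> \<phi> (graph_of \<sigma> y) = l" and \<rho>: "fibre_potential \<rho>" and y: "y \<in> S"
  shows "graph_form \<sigma> y u v = basic_part \<rho> (join 0 y) (join 0 u) (join 0 v)
      + levi (\<lambda>y. \<rho> (graph_of \<sigma> y)) y u v
     - (\<Sum>j\<in>UNIV. 2 * l $ j * levi (\<lambda>y. \<sigma> y $ j) y u v)"
proof -
  let ?s = "graph_of \<sigma>"
  have s: "smooth_on \<Omega> \<rho>" using \<rho> by (simp add: fibre_potential_def)
  have d: "dd \<rho> x (vert j) = 2 * \<phi> x $ j" "dd \<rho> x (\<i> *s vert j) = 0" if "base x \<in> S" for x j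
    using \<rho> that by (auto simp: fibre_potential_def)
  have sm: "smooth_on S \<sigma>" by (rule section_smooth[OF lev])
  have ss: "smooth_on S ?s" by (rule smooth_on_graph_of[OF open_S sm])
  have ds: "dd ?s y u = join (cvec (dd \<sigma> y u)) u" if "y \<in> S" for y u
    by (rule dd_graph_of(2)[OF smooth_on_differentiable[OF sm that]])
  have bs: "base (?s y) \<in> S" "?s y \<in> \<Omega>" using y by simp_all
  let ?D2 = "\<lambda>a b. dd (\<lambda>q. dd \<rho> q b) (?s y) a"
  have lin2: "linear (\<lambda>b. ?D2 a b)" for a by (rule dd_dd_lin[OF s bs(2)])
  have vi: "?D2 a (\<i> *s vert j) = 0" for a j
    by (rule dd_const_family[OF open_\<Omega> bs(2)]) (simp add: d)
  have ve: "?D2 (dd ?s y a) (vert j) = 0" for a j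
  proof -
    have "?D2 (dd ?s y a) (vert j) = dd (\<lambda>q. 2 * \<phi> q $ j) (?s y) (dd ?s y a)"
      by (rule fun_cong[OF dd_eq_open[OF open_\<Omega> bs(2)]]) (simp add: d)
    also have "\<dots> = 2 * (dd \<phi> (?s y) (dd ?s y a) $ j)"
      by (simp add: dd_cmult smooth_on_differentiable[OF smooth_\<phi>_nth bs(2)] dd_\<phi>_nth[OF bs(1)])
    also have "\<dots> = 0" using section_tangent[of \<sigma> l y a, OF lev y] by (simp add: ds[OF y])
    finally show ?thesis .
  qed
  \<comment> \<open>The deviation of the tangent map of the graph from complex linearity is vertical.\<close>
  have D2i: "?D2 (dd ?s y a) (dd ?s y (\<i> *s b)) = ?D2 (dd ?s y a) (\<i> *s dd ?s y b)" for a b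
  proof -
    have "?D2 (dd ?s y a) (dd ?s y (\<i> *s b) - \<i> *s dd ?s y b)
        = ?D2 (dd ?s y a) (join (cvec (dd \<sigma> y (\<i> *s b)) - \<i> *s cvec (dd \<sigma> y b)) 0)"
      by (simp add: ds[OF y] join_scalar join_diff)
    also have "\<dots> = 0"
      using linear_vertical[OF lin2[of "dd ?s y a"], of "cvec (dd \<sigma> y (\<i> *s b)) - \<i> *s cvec (dd \<sigma> y b)"]
      by (simp add: vi ve)
    finally show ?thesis by (simp add: linear_diff[OF lin2])
  qed
  have sig: "dd (\<lambda>y. dd ?s y b) y a = join (cvec (dd (\<lambda>y. dd \<sigma> y b) y a)) 0" for a b
  proof -
    have "dd (\<lambda>y. dd ?s y b) y a = dd (\<lambda>y. join (cvec (dd \<sigma> y b)) b) y a"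
      by (rule fun_cong[OF dd_eq_open[OF open_S y]]) (rule ds)
    also have "\<dots> = join (cvec (dd (\<lambda>y. dd \<sigma> y b) y a)) 0"
    proof (rule dd_eqI)
      have l: "bounded_linear (\<lambda>t. join (cvec t) 0 :: complex^('n + 'm))"
      proof -
        have "linear (\<lambda>t. join (cvec t) 0 :: complex^('n + 'm))"
          by (rule linearI) (simp_all add: sum_vec_eq_iff complex_eq_iff)
        then show ?thesis by (simp add: linear_conv_bounded_linear)
      qed
      have "((\<lambda>y. join (cvec (dd \<sigma> y b)) 0 + join 0 b)
          has_derivative (\<lambda>a. join (cvec (dd (\<lambda>y. dd \<sigma> y b) y a)) 0)) (at y)"
        by (rule has_derivative_add_const[OF bounded_linear.has_derivative[OF l
              smooth_on_has_derivative[OF smooth_on_dd[OF sm] y]]])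
      then show "((\<lambda>y. join (cvec (dd \<sigma> y b)) b)
          has_derivative (\<lambda>a. join (cvec (dd (\<lambda>y. dd \<sigma> y b) y a)) 0)) (at y)"
        by (simp add: join_add)
    qed
    finally show ?thesis .
  qed
  have D\<rho>: "dd \<rho> (?s y) (dd (\<lambda>y. dd ?s y b) y a)
      = (\<Sum>j\<in>UNIV. 2 * l $ j * dd (\<lambda>y. dd (\<lambda>y. \<sigma> y $ j) y b) y a)" for a b
  proof -
    have "dd (\<lambda>y. dd \<sigma> y b) y a $ j = dd (\<lambda>y. dd (\<lambda>y. \<sigma> y $ j) y b) y a" for j
      by (rule dd_dd_bounded_linear[OF bounded_linear_vec_nth open_S sm y, symmetric])
    then show ?thesis
      unfolding sig using linear_vertical[OF linear_dd[OF smooth_on_differentiable[OF s bs(2)]],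
          of "cvec (dd (\<lambda>y. dd \<sigma> y b) y a)"]
      by (simp add: d[OF bs(1)] lev[OF y] mult_ac)
  qed
  have "levi (\<lambda>y. \<rho> (?s y)) y u v = levi \<rho> (?s y) (dd ?s y u) (dd ?s y v) +
      (1/2) *\<^sub>R (dd \<rho> (?s y) (dd (\<lambda>y. dd ?s y (\<i> *s u)) y v) - dd \<rho> (?s y)
          (dd (\<lambda>y. dd ?s y (\<i> *s v)) y u))"
  proof -
    have "?s ` S \<subseteq> \<Omega>" by auto
    from dd_dd_compose[OF open_S y ss open_\<Omega> this s] show ?thesis
      unfolding levi_def by (simp add: D2i algebra_simps)
  qed
  also have "(1/2) *\<^sub>R (dd \<rho> (?s y) (dd (\<lambda>y. dd ?s y (\<i> *s u)) y v)
      - dd \<rho> (?s y) (dd (\<lambda>y. dd ?s y (\<i> *s v)) y u))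
    = (\<Sum>j\<in>UNIV. 2 * l $ j * levi (\<lambda>y. \<sigma> y $ j) y u v)"
    unfolding D\<rho> levi_def by (simp add: sum_subtractf[symmetric] sum_distrib_left algebra_simps)
  finally have L: "levi (\<lambda>y. \<rho> (?s y)) y u v = levi \<rho> (?s y) (dd ?s y u) (dd ?s y v)
    + (\<Sum>j\<in>UNIV. 2 * l $ j * levi (\<lambda>y. \<sigma> y $ j) y u v)" .
  have "basic_part \<rho> (?s y) (dd ?s y u) (dd ?s y v) = basic_part \<rho> (join 0 y) (join 0 u) (join 0 v)"
    by (rule basic_part_base[OF \<rho>]) (use y in \<open>simp_all add: ds[OF y]\<close>)
  then have "graph_form \<sigma> y u v - levi \<rho> (?s y) (dd ?s y u) (dd ?s y v)
      = basic_part \<rho> (join 0 y) (join 0 u) (join 0 v)"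
    by (simp add: basic_part_def graph_form_def ds[OF y])
  then show ?thesis using L by simp
qed

text \<open>The flow of the \<open>\<partial>/\<partial>\<theta>\<^sub>j\<close> moves along the torus orbits.\<close>

lemma const_along_imaginary:
  fixes f :: "complex^('n + 'm) \<Rightarrow> real"
  assumes "base x \<in> S" "base x' = base x" "\<And>j. Re (x' $ Inl j) = Re (x $ Inl j)"
    and f: "\<And>x. base x \<in> S \<Longrightarrow> f differentiable (at x)"
    and 0: "\<And>x j. base x \<in> S \<Longrightarrow> dd f x (\<i> *s vert j) = 0"
  shows "f x' = f x"
proof -
  let ?v = "x' - x"
  have v: "?v = join (fib ?v) 0"
    using assms(2) by (simp add: sum_vec_eq_iff vec_eq_iff)
  have b: "base (x + r *\<^sub>R ?v) \<in> S" for r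
    using assms(1,2) by (simp add: linear_add[OF linear_base] linear_scale[OF linear_base]
        linear_diff[OF linear_base])
  have "dd f (x + r *\<^sub>R ?v) (join (fib ?v) 0) = 0" for r
    using linear_vertical[OF linear_dd[OF f[OF b[of r]]], of "fib ?v"] by (simp add: 0[OF b] assms(3))
  then have "dd f (x + r *\<^sub>R ?v) ?v = 0" for r
    by (metis v)
  then have "((\<lambda>r. f (x + r *\<^sub>R ?v)) has_real_derivative 0) (at r)" for r
    using dd_line[OF f[OF b[of r]]] by (simp add: has_real_derivative_iff_has_vector_derivative)
  then have "f (x + 1 *\<^sub>R ?v) = f (x + 0 *\<^sub>R ?v)"
    using DERIV_isconst_all[of "\<lambda>r. f (x + r *\<^sub>R ?v)" 1 0] by blast
  then show ?thesis by simp
qed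

lemma \<phi>_imaginary:
  assumes "base x \<in> S" "base x' = base x" "\<And>j. Re (x' $ Inl j) = Re (x $ Inl j)"
  shows "\<phi> x' = \<phi> x"
proof -
  have "\<phi> x' $ j = \<phi> x $ j" for j
    by (rule const_along_imaginary[OF assms])
       (auto intro!: smooth_on_differentiable[OF smooth_\<phi>_nth] simp: dd_\<phi>_nth \<phi>_invariant)
  then show ?thesis by (simp add: vec_eq_iff)
qed

lemma level_graph_of:
  assumes lev: "\<phi> (graph_of \<sigma> (base x)) = l" and x: "base x \<in> S" "\<phi> x = l"
  shows "join (cvec (\<chi> j. Re (x $ Inl j))) (base x) = graph_of \<sigma> (base x)"
proof -
  have "\<phi> (join (cvec (\<chi> j. Re (x $ Inl j))) (base x)) = \<phi> x"
    by (rule \<phi>_imaginary) (simp_all add: x)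
  then have "\<phi> (join (cvec (\<chi> j. Re (x $ Inl j))) (base x)) = \<phi> (join (cvec (\<sigma> (base x))) (base x))"
    using lev x(2) by (simp add: graph_of_def)
  from \<phi>_injective[OF x(1) this] show ?thesis by (simp add: graph_of_def)
qed

text \<open>Two tangent vectors of the level set with the same projection to the base differ by a real
  combination of the \<open>\<partial>/\<partial>\<theta>\<^sub>j\<close>, because \<open>d\<phi>\<close> is injective on the radial directions; and
  \<open>w(\<partial>/\<partial>\<theta>\<^sub>j, v) = - d\<phi>\<^sub>j v\<close> vanishes for tangent vectors \<open>v\<close> of the level set.\<close>

lemma graph_form_tangent:
  assumes lev: "\<And>y. y \<in> S \<Longrightarrow> \<phi> (graph_of \<sigma> y) = l" and x: "base x \<in> S" "\<phi> x = l"
    and u: "dd \<phi> x u = 0" and v: "dd \<phi> x v = 0"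
  shows "w x u v = graph_form \<sigma> (base x) (base u) (base v)"
proof -
  let ?x = "join (cvec (\<chi> j. Re (x $ Inl j))) (base x)"
  have bx: "base ?x \<in> S" "base (graph_of \<sigma> (base x)) \<in> S" using x by simp_all
  have inv: "f x = f ?x" if "\<And>x. base x \<in> S \<Longrightarrow> f differentiable (at x)"
    and "\<And>x j. base x \<in> S \<Longrightarrow> dd f x (\<i> *s vert j) = 0" for f :: "complex^('n + 'm) \<Rightarrow> real"
    by (rule const_along_imaginary[OF bx(1) _ _ that]) simp_all
  have sx: "?x = graph_of \<sigma> (base x)" by (rule level_graph_of[OF lev[OF x(1)] x])
  have wx: "w x a b = w ?x a b" for a b
    by (rule inv) (auto intro!: smooth_on_differentiable[OF smooth_w] simp: dd_w_vertical)
  have d\<phi>: "dd \<phi> x a = dd \<phi> ?x a" for a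
  proof -
    have "dd (\<lambda>y. \<phi> y $ j) x a = dd (\<lambda>y. \<phi> y $ j) ?x a" for j
    proof (rule inv)
      fix x :: "complex^('n + 'm)" and k assume x: "base x \<in> S"
      show "(\<lambda>x. dd (\<lambda>y. \<phi> y $ j) x a) differentiable (at x)"
        by (rule smooth_on_differentiable[OF smooth_on_dd[OF smooth_\<phi>_nth]]) (simp add: x)
      have "dd (\<lambda>x. dd (\<lambda>y. \<phi> y $ j) x a) x (\<i> *s vert k)
          = dd (\<lambda>x. dd (\<lambda>y. \<phi> y $ j) x (\<i> *s vert k)) x a"
        by (rule dd_symmetric[OF open_\<Omega> smooth_\<phi>_nth]) (simp add: x)
      also have "\<dots> = 0"
        by (rule dd_const_family[OF open_\<Omega>]) (auto simp: x dd_\<phi>_nth \<phi>_invariant)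
      finally show "dd (\<lambda>x. dd (\<lambda>y. \<phi> y $ j) x a) x (\<i> *s vert k) = 0" .
    qed
    then show ?thesis using x(1) bx(1) by (simp add: vec_eq_iff dd_\<phi>_nth)
  qed
  have *: "w ?x a b = w ?x (join (cvec (dd \<sigma> (base x) (base a))) (base a)) b"
    if a: "dd \<phi> ?x a = 0" and b: "dd \<phi> ?x b = 0" for a b
  proof -
    let ?a = "join (cvec (dd \<sigma> (base x) (base a))) (base a) :: complex^('n + 'm)"
    let ?c = "fib (a - ?a)"
    have ac: "a - ?a = join ?c 0" by (simp add: sum_vec_eq_iff)
    have "dd \<phi> ?x ?a = 0" using section_tangent[OF lev x(1)] sx by simp
    then have "dd \<phi> ?x (join ?c 0) = 0"
      unfolding ac[symmetric] by (simp add: linear_diff[OF lin_\<phi>[OF bx(1)]] a)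
    then have "dd \<phi> ?x (join (cvec (\<chi> j. Re (?c $ j))) 0) = 0" using \<phi>_vertical[OF bx(1)] by metis
    then have "(\<chi> j. Re (?c $ j)) = 0" using \<phi>_positive[OF bx(1), of "\<chi> j. Re (?c $ j)"] by force
    then have "Re (?c $ j) = 0" for j by (metis (no_types, lifting) vec_lambda_beta zero_index)
    then have "w ?x (join ?c 0) b = 0"
      using linear_vertical[OF lin_w'[OF bx(1)], of ?c b] by (simp add: w_moment[OF bx(1)] b)
    then show ?thesis unfolding ac[symmetric] by (simp add: linear_diff[OF lin_w'[OF bx(1)]])
  qed
  have tan: "dd \<phi> ?x (join (cvec (dd \<sigma> (base x) a)) a) = 0" for a
    using section_tangent[OF lev x(1)] sx by simp
  have u': "dd \<phi> ?x u = 0" and v': "dd \<phi> ?x v = 0" using u v d\<phi> by auto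
  have "w x u v = w ?x u v" by (rule wx)
  also have "\<dots> = w ?x (join (cvec (dd \<sigma> (base x) (base u))) (base u)) v" by (rule *[OF u' v'])
  also have "\<dots> = - w ?x v (join (cvec (dd \<sigma> (base x) (base u))) (base u))" by (rule w_antisym[OF bx(1)])
  also have "\<dots> = - w ?x (join (cvec (dd \<sigma> (base x) (base v))) (base v))
      (join (cvec (dd \<sigma> (base x) (base u))) (base u))"
    by (simp only: *[OF v' tan])
  also have "\<dots> = w ?x (join (cvec (dd \<sigma> (base x) (base u))) (base u))
      (join (cvec (dd \<sigma> (base x) (base v))) (base v))"
    using w_antisym[OF bx(1)] by (metis neg_equal_iff_equal minus_minus)
  also have "\<dots> = graph_form \<sigma> (base x) (base u) (base v)" by (simp add: graph_form_def sx)
  finally show ?thesis .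
qed

lemma graph_form_smooth:
  assumes sm: "smooth_on S \<sigma>" shows "smooth_on S (\<lambda>y. graph_form \<sigma> y u v)"
proof -
  have t: "smooth_on S (\<lambda>y. join (cvec (dd \<sigma> y u)) u)" for u
    unfolding smooth_on_def
    using smooth_on_dd[OF sm] open_S
    by (auto intro!: Ck_on_join Ck_on_bounded_linear[OF bounded_linear_cvec] simp: smooth_on_def)
  have e: "w x a b = (\<Sum>i\<in>Basis. \<Sum>j\<in>Basis. (a \<bullet> i) * ((b \<bullet> j) * w x i j))" if x: "base x \<in> S" for x a b
    by (rule bilinear_expansion[OF lin_w[OF x] lin_w'[OF x]])
  have "smooth_on S (\<lambda>y. \<Sum>i\<in>Basis. \<Sum>j\<in>Basis. (join (cvec (dd \<sigma> y u)) u \<bullet> i) *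
      ((join (cvec (dd \<sigma> y v)) v \<bullet> j) * w (graph_of \<sigma> y) i j))"
    by (intro smooth_on_sum smooth_on_mult open_S
        smooth_on_bounded_linear[OF bounded_linear_inner_left] t
        smooth_on_compose[OF open_S open_\<Omega> _ smooth_on_graph_of[OF open_S sm] smooth_w]) auto
  then show ?thesis
    by (rule smooth_on_eq[OF open_S, rotated]) (unfold graph_form_def, subst e, simp_all)
qed

lemma graph_form_bilinear:
  assumes d: "\<sigma> differentiable (at y)" and y: "y \<in> S"
  shows "bilinear (graph_form \<sigma> y)" "graph_form \<sigma> y u u = 0"
proof -
  have b: "base (graph_of \<sigma> y) \<in> S" using y by simp
  have l: "linear (\<lambda>u. join (cvec (dd \<sigma> y u)) u)"
    by (rule linear_join_pair[OF linear_compose[OF linear_dd[OF d] linear_cvec, unfolded o_def]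
        linear_id[unfolded id_def]])
  show "bilinear (graph_form \<sigma> y)"
    unfolding bilinear_def graph_form_def
    using linear_compose[OF l lin_w[OF b]] linear_compose[OF l lin_w'[OF b]] by (auto simp: o_def)
  show "graph_form \<sigma> y u u = 0" unfolding graph_form_def by (rule w_alt[OF b])
qed

end

section \<open>Charts of a maximal atlas\<close>

lemma holo_on_eq:
  assumes "open S" "\<And>x. x \<in> S \<Longrightarrow> f x = g x" "holo_on S f"
  shows "holo_on S g"
  unfolding holo_on_def
proof
  fix x assume x: "x \<in> S"
  then show "\<exists>D. (g has_derivative D) (at x) \<and> (\<forall>a v. D (a *s v) = a *s D v)"
    using assms(3) has_derivative_eq_open[of S x f g, OF assms(1) x assms(2)] unfolding holo_on_def
        by blast
qed

lemma holo_on_compose: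
  assumes "holo_on S f" "f ` S \<subseteq> T" "holo_on T g"
  shows "holo_on S (\<lambda>x. g (f x))"
  unfolding holo_on_def
proof
  fix x assume x: "x \<in> S"
  obtain D where D: "(f has_derivative D) (at x)" "\<And>a v. D (a *s v) = a *s D v"
    using assms(1) x unfolding holo_on_def by blast
  have "f x \<in> T" using assms(2) x by blast
  then obtain D' where D': "(g has_derivative D') (at (f x))" "\<And>a v. D' (a *s v) = a *s D' v"
    using assms(3) unfolding holo_on_def by blast
  show "\<exists>D. ((\<lambda>x. g (f x)) has_derivative D) (at x) \<and> (\<forall>a v. D (a *s v) = a *s D v)"
    using has_derivative_compose[OF D(1) D'(1)] D(2) D'(2) by (intro exI[of _ "\<lambda>v. D' (D v)"]) simp
qed

lemma holo_on_continuous: "holo_on S f \<Longrightarrow> continuous_on S f"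
  by (intro differentiable_imp_continuous_on differentiable_at_imp_differentiable_on
      holo_on_differentiable)

lemma holo_on_subset: "holo_on S f \<Longrightarrow> T \<subseteq> S \<Longrightarrow> holo_on T f"
  unfolding holo_on_def by blast

lemma chart_inv_chart [simp]: "inj_on (snd c) (fst c) \<Longrightarrow> p \<in> fst c
    \<Longrightarrow> inv_into (fst c) (snd c) (snd c p) = p"
  by (rule inv_into_f_f)

lemma transition_compose:
  assumes c: "inj_on (snd c) (dom_of c)" and d: "inj_on (snd d) (dom_of d)"
    and cd: "holo_transition c d" and de: "holo_transition d e"
    and sub: "dom_of c \<inter> dom_of e \<subseteq> dom_of d"
  shows "holo_transition c e"
proof -
  let ?Q = "snd c ` (dom_of c \<inter> dom_of d)" and ?R = "snd d ` (dom_of d \<inter> dom_of e)"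
    and ?P = "snd c ` (dom_of c \<inter> dom_of e)"
  let ?h = "snd d \<circ> chart_inv c"
  have P: "?P = ?Q \<inter> ?h -` ?R"
  proof (intro equalityI subsetI)
    fix x assume "x \<in> ?P"
    then obtain p where p: "p \<in> dom_of c" "p \<in> dom_of e" "x = snd c p" by blast
    then show "x \<in> ?Q \<inter> ?h -` ?R" using sub c by auto
  next
    fix x assume "x \<in> ?Q \<inter> ?h -` ?R"
    then obtain p q where p: "p \<in> dom_of c" "p \<in> dom_of d" "x = snd c p"
      and q: "q \<in> dom_of d" "q \<in> dom_of e" "?h x = snd d q" by blast
    then have "snd d p = snd d q" using c by simp
    then have "p = q" using d p q by (auto dest: inj_onD)
    then show "x \<in> ?P" using p q by blast
  qed
  have oP: "open ?P"
    unfolding P using cd de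
    by (intro continuous_open_preimage holo_on_continuous) (auto simp: holo_transition_def)
  have "holo_on ?P (\<lambda>x. (snd e \<circ> chart_inv d) (?h x))"
    by (rule holo_on_compose[of _ ?h ?R "snd e \<circ> chart_inv d"])
        (use cd de P in \<open>auto simp: holo_transition_def intro: holo_on_subset\<close>)
  then have "holo_on ?P (snd e \<circ> chart_inv c)"
    by (rule holo_on_eq[OF oP, rotated]) (use c d sub in auto)
  with oP show ?thesis by (simp add: holo_transition_def)
qed

lemma manifoldD:
  assumes "complex_manifold A" "c \<in> A"
  shows "inj_on (snd c) (dom_of c)" "open (img_of c)" "d \<in> A \<Longrightarrow> holo_transition c d"
    "dom_of c \<subseteq> points A"
  using assms unfolding complex_manifold_def is_chart_def compatible_def points_def by blast+

text \<open>Membership of a chart with smaller domain need only be tested against one chart containing it,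
  since every other transition factors through that one.\<close>

lemma chart_in_atlas:
  assumes A: "complex_manifold A" and d: "d \<in> A" and e: "is_chart e"
    and sub: "dom_of e \<subseteq> dom_of d" and comp: "compatible e d"
  shows "e \<in> A"
proof -
  have ie: "inj_on (snd e) (dom_of e)" using e by (simp add: is_chart_def)
  note id = manifoldD(1)[OF A d]
  have "compatible e f" if f: "f \<in> A" for f
    unfolding compatible_def
  proof
    show "holo_transition e f"
      by (rule transition_compose[OF ie id _ manifoldD(3)[OF A d f]])
          (use comp sub in \<open>auto simp: compatible_def\<close>)
    show "holo_transition f e"
      by (rule transition_compose[OF manifoldD(1)[OF A f] id manifoldD(3)[OF A f d]])
         (use comp sub in \<open>auto simp: compatible_def\<close>)
  qed
  moreover have "dom_of e \<subseteq> points A" using sub manifoldD(4)[OF A d] by blast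
  ultimately show ?thesis using A e unfolding complex_manifold_def by blast
qed

lemma holo_on_id: "holo_on S (\<lambda>x. x)"
  unfolding holo_on_def by (auto intro: exI[of _ "\<lambda>v. v"])

lemma restrict_chart:
  assumes A: "complex_manifold A" and c: "c \<in> A" and c0: "c0 \<in> A"
  shows "(dom_of c \<inter> dom_of c0, snd c) \<in> A"
proof (rule chart_in_atlas[OF A c])
  let ?e = "(dom_of c \<inter> dom_of c0, snd c)"
  note ic = manifoldD(1)[OF A c]
  have ie: "inj_on (snd c) (dom_of c \<inter> dom_of c0)" using ic by (rule inj_on_subset) auto
  have o: "open (snd c ` (dom_of c \<inter> dom_of c0))"
    using manifoldD(3)[OF A c c0] by (simp add: holo_transition_def)
  show "is_chart ?e" using ie o by (simp add: is_chart_def)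
  have s: "dom_of ?e \<inter> dom_of c = dom_of c \<inter> dom_of c0" "dom_of c \<inter> dom_of ?e
      = dom_of c \<inter> dom_of c0" by auto
  have "holo_on (snd c ` (dom_of c \<inter> dom_of c0)) (snd c \<circ> chart_inv ?e)"
    by (rule holo_on_eq[OF o _ holo_on_id]) (use ie in auto)
  moreover have "holo_on (snd c ` (dom_of c \<inter> dom_of c0)) (snd ?e \<circ> chart_inv c)"
    by (rule holo_on_eq[OF o _ holo_on_id]) (use ic in auto)
  ultimately show "compatible ?e c" using o by (simp add: compatible_def holo_transition_def s Int_ac)
qed auto

lemma bundle_chart_join:
  "bundle_chart M \<pi> c z = (points M \<inter> \<pi> -` dom_of c, \<lambda>p. join (z p) (snd c (\<pi> p)))"
  by (simp add: bundle_chart_def join_def)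

lemma trivialization_image:
  "trivialization M act \<pi> c z \<Longrightarrow>
    img_of (bundle_chart M \<pi> c z) = {x. (\<forall>j. x $ Inl j \<noteq> 0) \<and> base x \<in> img_of c}"
  by (simp add: trivialization_def base_def)

lemma open_punctured: "open {x :: complex^('n::finite + 'm::finite). \<forall>j. x $ Inl j \<noteq> 0}"
proof -
  have "open (\<Inter>j\<in>UNIV. {x :: complex^('n + 'm). x $ Inl j \<noteq> 0})"
    by (intro open_INT finite ballI open_Collect_neq continuous_intros)
  moreover have "(\<Inter>j\<in>UNIV. {x :: complex^('n + 'm). x $ Inl j \<noteq> 0}) = {x. \<forall>j. x $ Inl j \<noteq> 0}" by auto
  ultimately show ?thesis by simp
qed

lemma holo_on_join:
  assumes "holo_on S f" "holo_on S g" shows "holo_on S (\<lambda>x. join (f x) (g x))"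
  unfolding holo_on_def
proof
  fix x assume x: "x \<in> S"
  obtain D where D: "(f has_derivative D) (at x)" "\<And>a v. D (a *s v) = a *s D v"
    using assms(1) x unfolding holo_on_def by blast
  obtain D' where D': "(g has_derivative D') (at x)" "\<And>a v. D' (a *s v) = a *s D' v"
    using assms(2) x unfolding holo_on_def by blast
  have l: "bounded_linear (\<lambda>p. join (fst p) (snd p))"
    using linear_join by (simp add: linear_conv_bounded_linear)
  have "((\<lambda>x. join (f x) (g x)) has_derivative (\<lambda>v. join (D v) (D' v))) (at x)"
    using bounded_linear.has_derivative[OF l has_derivative_Pair[OF D(1) D'(1)]] by simp
  then show "\<exists>D. ((\<lambda>x. join (f x) (g x)) has_derivative D) (at x) \<and> (\<forall>a v. D (a *s v) = a *s D v)"
    using D(2) D'(2) by (intro exI[of _ "\<lambda>v. join (D v) (D' v)"]) (simp add: join_scalar)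
qed

lemma holo_on_linear:
  assumes "bounded_linear f" "\<And>a v. f (a *s v) = a *s f v" shows "holo_on S f"
  unfolding holo_on_def using bounded_linear_imp_has_derivative[OF assms(1)] assms(2) by blast

lemma fib_scalar [simp]: "fib (c *s x) = c *s fib x"
  by (simp add: vec_eq_iff)

text \<open>A trivialization survives shrinking the base and changing the base coordinates. Thus every chart
  \<open>c\<close> of the base can be shrunk, without changing its coordinate map, to one with a trivialization,
  and coefficients of forms in \<open>c\<close> can be computed there.\<close>

lemma restrict_trivialization:
  fixes M :: "('a, 'n::finite + 'm::finite) chart set" and B :: "('b, 'm) chart set"
  assumes M: "complex_manifold M" and B: "complex_manifold B"
    and t: "trivialization M act \<pi> c0 z" and c: "c \<in> B" and c0: "c0 \<in> B"
  shows "trivialization M act \<pi> (dom_of c \<inter> dom_of c0, snd c) z"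
proof -
  define c' where "c' = (dom_of c \<inter> dom_of c0, snd c)"
  let ?bo = "bundle_chart M \<pi> c0 z" and ?b = "bundle_chart M \<pi> c' z"
  have b0: "?bo \<in> M" using t by (simp add: trivialization_def)
  have c': "c' \<in> B" unfolding c'_def by (rule restrict_chart[OF B c c0])
  note ib0 = manifoldD(1)[OF M b0] and ic0 = manifoldD(1)[OF B c0] and ic' = manifoldD(1)[OF B c']
  have dc: "dom_of c' \<subseteq> dom_of c0" by (auto simp: c'_def)
  have db: "dom_of ?b \<subseteq> dom_of ?bo" using dc by (auto simp: bundle_chart_join)
  have sb: "snd ?b p = join (z p) (snd c' (\<pi> p))" "snd ?bo p = join (z p) (snd c0 (\<pi> p))" for p
    by (simp_all add: bundle_chart_join)
  have eqd: "p = q" if "p \<in> dom_of ?bo" "q \<in> dom_of ?bo" "z p = z q" "\<pi> p = \<pi> q" for p q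
    using ib0 that sb by (metis inj_onD)
  have ib: "inj_on (snd ?b) (dom_of ?b)"
  proof (rule inj_onI)
    fix p q assume p: "p \<in> dom_of ?b" and q: "q \<in> dom_of ?b" and "snd ?b p = snd ?b q"
    then have "z p = z q" "snd c' (\<pi> p) = snd c' (\<pi> q)" unfolding sb
        by (metis fib_join, metis base_join)
    moreover have "\<pi> p \<in> dom_of c'" "\<pi> q \<in> dom_of c'" using p q by (auto simp: bundle_chart_join)
    ultimately show "p = q" using eqd p q db ic' by (metis inj_onD subsetD)
  qed
  have pre: "\<exists>p\<in>dom_of ?bo. z p = fib x \<and> \<pi> p = w"
      if "\<forall>j. x $ Inl j \<noteq> 0" "w \<in> dom_of c0" for x :: "complex^('n + 'm)" and w
  proof -
    have "join (fib x) (snd c0 w) \<in> img_of ?bo"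
      unfolding trivialization_image[OF t] using that by simp
    then obtain p where p: "p \<in> dom_of ?bo" "join (fib x) (snd c0 w) = snd ?bo p" by auto
    then have "fib x = z p" "snd c0 w = snd c0 (\<pi> p)" unfolding sb by (metis fib_join, metis base_join)
    moreover have "\<pi> p \<in> dom_of c0" using p by (simp add: bundle_chart_join)
    ultimately show ?thesis using p ic0 that(2) by (metis inj_onD)
  qed
  have nz: "z p $ j \<noteq> 0" if "p \<in> dom_of ?bo" for p j
  proof -
    have "snd ?bo p \<in> img_of ?bo" using that by blast
    then have "snd ?bo p $ Inl j \<noteq> 0" unfolding trivialization_image[OF t] by blast
    then show ?thesis by (simp add: sb)
  qed
  have img: "snd k ` dom_of ?b = {x. (\<forall>j. x $ Inl j \<noteq> 0) \<and> base x \<in> snd d ` dom_of c'}"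
    if k: "snd k = (\<lambda>p. join (z p) (snd d (\<pi> p)))" for k :: "('a, 'n + 'm) chart" and d
        :: "('b, 'm) chart"
  proof (intro equalityI subsetI)
    fix x :: "complex^('n + 'm)" assume "x \<in> snd k ` dom_of ?b"
    then obtain p where p: "p \<in> dom_of ?b" "x = join (z p) (snd d (\<pi> p))" unfolding k by blast
    then show "x \<in> {x. (\<forall>j. x $ Inl j \<noteq> 0) \<and> base x \<in> snd d ` dom_of c'}"
      using nz db by (auto simp: bundle_chart_join)
  next
    fix x :: "complex^('n + 'm)" assume "x \<in> {x. (\<forall>j. x $ Inl j \<noteq> 0) \<and> base x \<in> snd d ` dom_of c'}"
    then obtain w where w: "\<forall>j. x $ Inl j \<noteq> 0" "w \<in> dom_of c'" "base x = snd d w" by blast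
    then obtain p where p: "p \<in> dom_of ?bo" "z p = fib x" "\<pi> p = w" using pre dc by blast
    then have "p \<in> dom_of ?b" "x = snd k p" using w
        by (auto simp: bundle_chart_join k sum_vec_eq_iff vec_eq_iff)
    then show "x \<in> snd k ` dom_of ?b" by blast
  qed
  have imgb: "img_of ?b = {x. (\<forall>j. x $ Inl j \<noteq> 0) \<and> base x \<in> img_of c'}"
    and imgb0: "snd ?bo ` dom_of ?b = {x. (\<forall>j. x $ Inl j \<noteq> 0) \<and> base x \<in> snd c0 ` dom_of c'}"
    by (rule img, simp add: bundle_chart_join)+
  have op: "open {x :: complex^('n + 'm). (\<forall>j. x $ Inl j \<noteq> 0) \<and> base x \<in> S}" if "open S" for S
    using open_Int[OF open_punctured open_base[OF that]] by (simp add: Int_def vimage_def)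
  have oc0: "open (snd c0 ` dom_of c')"
    using manifoldD(3)[OF B c0 c'] dc by (simp add: holo_transition_def Int_absorb1)
  have ob: "open (img_of ?b)" "open (snd ?bo ` dom_of ?b)"
    unfolding imgb imgb0 using op manifoldD(2)[OF B c'] oc0 by blast+
  have h: "holo_on {x :: complex^('n + 'm). (\<forall>j. x $ Inl j \<noteq> 0)
      \<and> base x \<in> snd k ` (dom_of k \<inter> dom_of d)}
      (\<lambda>x. join (fib x) ((snd d \<circ> chart_inv k) (base x)))" if "k \<in> B" "d \<in> B" for k d
  proof (intro holo_on_join)
    have "holo_on (snd k ` (dom_of k \<inter> dom_of d)) (snd d \<circ> chart_inv k)"
      using manifoldD(3)[OF B that] by (simp add: holo_transition_def)
    then show "holo_on {x :: complex^('n + 'm). (\<forall>j. x $ Inl j \<noteq> 0)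
        \<and> base x \<in> snd k ` (dom_of k \<inter> dom_of d)}
        (\<lambda>x. (snd d \<circ> chart_inv k) (base x))"
      by (rule holo_on_compose[OF holo_on_linear[OF bounded_linear_base base_scalar], rotated]) auto
  qed (rule holo_on_linear[OF bounded_linear_fib fib_scalar])
  have i1: "dom_of c' \<inter> dom_of c0 = dom_of c'" "dom_of c0 \<inter> dom_of c' = dom_of c'"
    "dom_of ?b \<inter> dom_of ?bo = dom_of ?b" "dom_of ?bo \<inter> dom_of ?b = dom_of ?b" using dc db by auto
  have "holo_on (img_of ?b) (snd ?bo \<circ> chart_inv ?b)"
  proof (rule holo_on_eq[OF ob(1) _ h[OF c' c0, unfolded i1, folded imgb]])
    fix x assume "x \<in> img_of ?b"
    then obtain p where p: "p \<in> dom_of ?b" "x = snd ?b p" by blast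
    then have "\<pi> p \<in> dom_of c'" by (simp add: bundle_chart_join)
    then have "chart_inv c' (base x) = \<pi> p" using p ic' by (simp add: sb)
    moreover have "chart_inv ?b x = p" unfolding p(2) by (rule chart_inv_chart[OF ib p(1)])
    ultimately show "join (fib x) ((snd c0 \<circ> chart_inv c') (base x)) = (snd ?bo \<circ> chart_inv ?b) x"
      using p(2) by (simp add: sb)
  qed
  moreover have "holo_on (snd ?bo ` dom_of ?b) (snd ?b \<circ> chart_inv ?bo)"
  proof (rule holo_on_eq[OF ob(2) _ h[OF c0 c', unfolded i1, folded imgb0]])
    fix x assume "x \<in> snd ?bo ` dom_of ?b"
    then obtain p where p: "p \<in> dom_of ?b" "x = snd ?bo p" by blast
    then have "\<pi> p \<in> dom_of c0" using dc by (auto simp add: bundle_chart_join)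
    then have "chart_inv c0 (base x) = \<pi> p" using p ic0 by (simp add: sb)
    moreover have "chart_inv ?bo x = p" unfolding p(2)
        by (rule chart_inv_chart[OF ib0]) (use p db in blast)
    ultimately show "join (fib x) ((snd c' \<circ> chart_inv c0) (base x)) = (snd ?b \<circ> chart_inv ?bo) x"
      using p(2) by (simp add: sb)
  qed
  ultimately have "compatible ?b ?bo"
    unfolding compatible_def holo_transition_def i1 using ob by blast
  then have "?b \<in> M"
    by (intro chart_in_atlas[OF M b0 _ db]) (use ib ob in \<open>simp_all add: is_chart_def\<close>)
  moreover have "\<forall>a\<in>complex_torus. \<forall>p\<in>points M \<inter> \<pi> -` dom_of c'. z (act a p) = a * z p"
    using t dc unfolding trivialization_def by blast
  ultimately have "trivialization M act \<pi> c' z"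
    unfolding trivialization_def using imgb by (simp add: base_def)
  then show ?thesis by (simp add: c'_def)
qed

section \<open>Logarithmic coordinates over a trivialization\<close>

lemma dd_bilinear_family:
  fixes h :: "'a::euclidean_space \<Rightarrow> 'b::euclidean_space" and p q :: "'a \<Rightarrow> 'c::euclidean_space"
    and \<alpha> :: "'b \<Rightarrow> 'c \<Rightarrow> 'c \<Rightarrow> 'd::real_normed_vector"
  assumes S: "open S" "x \<in> S" and T: "open T" "h ` S \<subseteq> T"
    and lin: "\<And>r u. r \<in> T \<Longrightarrow> linear (\<alpha> r u)" "\<And>r v. r \<in> T \<Longrightarrow> linear (\<lambda>u. \<alpha> r u v)"
    and d\<alpha>: "\<And>r u v. r \<in> T \<Longrightarrow> (\<lambda>r. \<alpha> r u v) differentiable (at r)"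
    and dh: "\<And>y. y \<in> S \<Longrightarrow> h differentiable (at y)"
    and dp: "\<And>y. y \<in> S \<Longrightarrow> p differentiable (at y)" and dq: "\<And>y. y \<in> S \<Longrightarrow> q differentiable (at y)"
  shows "dd (\<lambda>y. \<alpha> (h y) (p y) (q y)) x a =
    dd (\<lambda>r. \<alpha> r (p x) (q x)) (h x) (dd h x a) + \<alpha> (h x) (dd p x a) (q x) + \<alpha> (h x) (p x) (dd q x a)"
proof -
  have hT: "h y \<in> T" if "y \<in> S" for y using T that by blast
  have 1: "(\<lambda>y. \<alpha> (h y) u (q y)) differentiable (at y)"
    "dd (\<lambda>y. \<alpha> (h y) u (q y)) y a = dd (\<lambda>r. \<alpha> r u (q y)) (h y) (dd h y a) + \<alpha> (h y) u (dd q y a)"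
    if "y \<in> S" for u y
    by (rule dd_linear_family[OF T(1) hT[OF that] lin(1) d\<alpha>[OF hT[OF that]] dh[OF that]
        dq[OF that]]; assumption)+
  have "dd (\<lambda>y. \<alpha> (h y) (p y) (q y)) x a = dd (\<lambda>y. \<alpha> (h y) (p x) (q y)) x (dd (\<lambda>y. y) x a)
      + \<alpha> (h x) (dd p x a) (q x)"
    by (rule dd_linear_family(2)[OF S(1), of "\<lambda>y. y" x "\<lambda>y u. \<alpha> (h y) u (q y)" p])
       (use S(2) lin(2)[OF hT] 1(1) dp in auto)
  then show ?thesis
    by (simp add: 1(2)[OF S(2)] frechet_derivative_ident)
qed

text \<open>From logarithmic to ordinary fibre coordinates.\<close>

definition fibre_exp :: "complex^('n::finite + 'm::finite) \<Rightarrow> complex^('n + 'm)" where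
  "fibre_exp x = join (\<chi> j. exp (x $ Inl j)) (base x)"

lemma base_fibre_exp [simp]: "base (fibre_exp x) = base x"
  by (simp add: fibre_exp_def)

lemma fibre_exp_nth [simp]: "fibre_exp x $ Inl j = exp (x $ Inl j)" "fibre_exp x $ Inr k = x $ Inr k"
  by (simp_all add: fibre_exp_def)

lemma has_derivative_vec:
  fixes f :: "'n::finite \<Rightarrow> 'a::real_normed_vector \<Rightarrow> 'b::euclidean_space"
  assumes "\<And>i. (f i has_derivative f' i) (at x)"
  shows "((\<lambda>x. \<chi> i. f i x) has_derivative (\<lambda>v. \<chi> i. f' i v)) (at x)"
proof -
  have "((\<lambda>x. \<Sum>i\<in>UNIV. axis i (f i x)) has_derivative (\<lambda>v. \<Sum>i\<in>UNIV. axis i (f' i v))) (at x)"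
    by (intro has_derivative_sum bounded_linear.has_derivative[OF bounded_linear_axis] assms)
  moreover have "(\<Sum>i\<in>UNIV. axis i (g i)) = (\<chi> i. g i)" for g :: "'n \<Rightarrow> 'b"
    by (simp add: vec_eq_iff axis_def)
  ultimately show ?thesis by simp
qed

lemma fibre_exp_has_derivative:
  fixes x :: "complex^('n::finite + 'm::finite)"
  shows "(fibre_exp has_derivative (\<lambda>u. join (\<chi> j. exp (x $ Inl j) * u $ Inl j) (base u))) (at x)"
proof -
  have l: "bounded_linear (\<lambda>p::(complex^'n) \<times> (complex^'m). join (fst p) (snd p))"
    using linear_join by (simp add: linear_conv_bounded_linear)
  have "((\<lambda>x::complex^('n + 'm). exp (x $ Inl j)) has_derivative (\<lambda>u. exp (x $ Inl j) * u $ Inl j))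
      (at x)" for j
    by (rule has_derivative_compose[OF bounded_linear_imp_has_derivative[OF bounded_linear_vec_nth]
          DERIV_exp[unfolded has_field_derivative_def]])
  then have "((\<lambda>x::complex^('n + 'm). \<chi> j. exp (x $ Inl j))
      has_derivative (\<lambda>u. \<chi> j. exp (x $ Inl j) * u $ Inl j)) (at x)"
    by (rule has_derivative_vec)
  from bounded_linear.has_derivative[OF l
      has_derivative_Pair[OF this bounded_linear_imp_has_derivative[OF bounded_linear_base]]]
  show ?thesis by (simp add: fibre_exp_def[abs_def])
qed

lemma dd_fibre_exp: "dd fibre_exp x u = join (\<chi> j. exp (x $ Inl j) * u $ Inl j) (base u)"
  by (rule dd_eqI[OF fibre_exp_has_derivative])

lemma holo_on_fibre_exp: "holo_on S fibre_exp"
  unfolding holo_on_def using fibre_exp_has_derivative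
  by (intro ballI exI conjI) (auto simp: sum_vec_eq_iff)

lemma smooth_on_fibre_exp: "smooth_on UNIV fibre_exp"
  by (rule holo_on_smooth_on[OF open_UNIV holo_on_fibre_exp])

lemma dd_fibre_exp_i: "dd fibre_exp x (\<i> *s u) = \<i> *s dd fibre_exp x u"
  by (rule holo_on_dd[OF holo_on_fibre_exp[of UNIV]]) simp

lemma fibre_exp_differentiable: "fibre_exp differentiable (at x)"
  unfolding differentiable_def using fibre_exp_has_derivative by blast

lemma base_dd_fibre_exp [simp]: "base (dd fibre_exp x u) = base u"
  by (simp add: dd_fibre_exp)

lemma dd_fibre_exp_inj: "dd fibre_exp x u = 0 \<Longrightarrow> u = 0"
  by (auto simp: dd_fibre_exp sum_vec_eq_iff vec_eq_iff base_def)

lemma form2_smooth: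
  assumes "two_form A \<alpha>" "c \<in> A" shows "smooth_on (img_of c) (\<lambda>x. \<alpha> c x u v)"
  using assms by (simp add: two_form_def)

lemma form2_bilinear:
  assumes "two_form A \<alpha>" "c \<in> A" "x \<in> img_of c"
  shows "linear (\<alpha> c x u)" "linear (\<lambda>u. \<alpha> c x u v)" "\<alpha> c x u u = 0"
  using assms unfolding two_form_def bilinear_def by blast+

locale hamiltonian_bundle =
  fixes M :: "('a, 'n::finite + 'm::finite) chart set"
    and B :: "('b, 'm) chart set"
    and act :: "complex^'n \<Rightarrow> 'a \<Rightarrow> 'a"
    and \<pi> :: "'a \<Rightarrow> 'b"
    and \<omega> :: "('a, 'n + 'm) form2"
    and \<Phi> :: "'a \<Rightarrow> real^'n"
  assumes principal: "principal_bundle M B act \<pi>"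
    and kaehler: "kaehler_form M \<omega>"
    and moment: "moment_map M act \<omega> \<Phi>"
begin

lemma manifold_M: "complex_manifold M" and manifold_B: "complex_manifold B"
  using principal by (simp_all add: principal_bundle_def)

lemma act_one: "p \<in> points M \<Longrightarrow> act 1 p = p"
  and act_points: "a \<in> complex_torus \<Longrightarrow> p \<in> points M \<Longrightarrow> act a p \<in> points M"
  and \<pi>_act: "a \<in> complex_torus \<Longrightarrow> p \<in> points M \<Longrightarrow> \<pi> (act a p) = \<pi> p"
  using principal by (simp_all add: principal_bundle_def)

lemma compact_complex: "a \<in> compact_torus \<Longrightarrow> a \<in> complex_torus"
  by (auto simp: compact_torus_def complex_torus_def) (metis norm_zero zero_neq_one)

lemma two_form_\<omega>: "two_form M \<omega>"
  using kaehler by (simp add: kaehler_form_def)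

lemma \<Phi>_act: "a \<in> compact_torus \<Longrightarrow> p \<in> points M \<Longrightarrow> \<Phi> (act a p) = \<Phi> p"
  using moment by (simp add: moment_map_def)

definition trivial_over :: "('b, 'm) chart \<Rightarrow> ('a \<Rightarrow> complex^'n) \<Rightarrow> bool" where
  "trivial_over c z \<longleftrightarrow> c \<in> B \<and> trivialization M act \<pi> c z"

abbreviation bchart :: "('b, 'm) chart \<Rightarrow> ('a \<Rightarrow> complex^'n) \<Rightarrow> ('a, 'n + 'm) chart" where
  "bchart c z \<equiv> bundle_chart M \<pi> c z"

text \<open>The new chart has the coordinate map of \<open>c\<close>, hence the same coefficients of forms.\<close>

lemma trivial_over_nhd:
  assumes c: "c \<in> B" and w: "w \<in> dom_of c"
  shows "\<exists>c' z. trivial_over c' z \<and> w \<in> dom_of c' \<and> dom_of c' \<subseteq> dom_of c \<and> snd c' = snd c"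
proof -
  have "w \<in> points B" using c w by (auto simp: points_def)
  then obtain c0 z where c0: "c0 \<in> B" "w \<in> dom_of c0" "trivialization M act \<pi> c0 z"
    using principal unfolding principal_bundle_def by meson
  have "trivial_over (dom_of c \<inter> dom_of c0, snd c) z"
    unfolding trivial_over_def
    using restrict_chart[OF manifold_B c c0(1)]
        restrict_trivialization[OF manifold_M manifold_B c0(3) c c0(1)] by blast
  then show ?thesis using w c0(2) by (intro exI[of _ "(dom_of c \<inter> dom_of c0, snd c)"] exI[of _ z]) auto
qed

lemma dom_bchart: "p \<in> dom_of (bchart c z) \<longleftrightarrow> p \<in> points M \<and> \<pi> p \<in> dom_of c"
  by (simp add: bundle_chart_join)

lemma snd_bchart: "snd (bchart c z) p = join (z p) (snd c (\<pi> p))"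
  by (simp add: bundle_chart_join)

context
  fixes c :: "('b, 'm) chart" and z :: "'a \<Rightarrow> complex^'n"
  assumes trivial_over: "trivial_over c z"
begin

lemma c_B: "c \<in> B" and triv: "trivialization M act \<pi> c z"
  using trivial_over by (simp_all add: trivial_over_def)

lemma bchart_M: "bchart c z \<in> M"
  using triv by (simp add: trivialization_def)

lemma inj_c: "inj_on (snd c) (dom_of c)" and open_img_c: "open (img_of c)"
  using manifoldD[OF manifold_B c_B] by auto

lemma inj_bchart: "inj_on (snd (bchart c z)) (dom_of (bchart c z))" and
    open_img_bchart: "open (img_of (bchart c z))"
  using manifoldD[OF manifold_M bchart_M] by auto

lemma img_bchart: "x \<in> img_of (bchart c z) \<longleftrightarrow> (\<forall>j. x $ Inl j \<noteq> 0) \<and> base x \<in> img_of c"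
  using trivialization_image[OF triv] by simp

lemma inv_bchart:
  assumes "\<And>j. x $ Inl j \<noteq> 0" "base x \<in> img_of c"
  shows "chart_inv (bchart c z) x \<in> dom_of (bchart c z)"
      "snd (bchart c z) (chart_inv (bchart c z) x) = x"
    "z (chart_inv (bchart c z) x) = fib x" "\<pi> (chart_inv (bchart c z) x) = chart_inv c (base x)"
    "\<pi> (chart_inv (bchart c z) x) \<in> dom_of c" "snd c (\<pi> (chart_inv (bchart c z) x)) = base x"
proof -
  have x: "x \<in> img_of (bchart c z)" using assms by (simp add: img_bchart)
  show 1: "chart_inv (bchart c z) x \<in> dom_of (bchart c z)" by (rule inv_into_into[OF x])
  show 2: "snd (bchart c z) (chart_inv (bchart c z) x) = x" by (rule f_inv_into_f[OF x])
  then have J: "join (z (chart_inv (bchart c z) x)) (snd c (\<pi> (chart_inv (bchart c z) x))) = x"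
      by (simp only: snd_bchart)
  show "z (chart_inv (bchart c z) x) = fib x" using arg_cong[OF J, of fib] by (simp only: fib_join)
  show 3: "snd c (\<pi> (chart_inv (bchart c z) x)) = base x" using arg_cong[OF J, of base]
      by (simp only: base_join)
  show 4: "\<pi> (chart_inv (bchart c z) x) \<in> dom_of c" using 1 by (simp add: dom_bchart)
  show "\<pi> (chart_inv (bchart c z) x) = chart_inv c (base x)"
    using chart_inv_chart[OF inj_c 4] by (simp only: 3)
qed

lemma z_nonzero: "p \<in> points M \<Longrightarrow> \<pi> p \<in> dom_of c \<Longrightarrow> z p $ j \<noteq> 0"
proof -
  assume "p \<in> points M" "\<pi> p \<in> dom_of c"
  then have "snd (bchart c z) p \<in> img_of (bchart c z)" by (intro imageI) (simp add: dom_bchart)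
  then have "snd (bchart c z) p $ Inl j \<noteq> 0" unfolding img_bchart by blast
  then show ?thesis by (simp add: snd_bchart)
qed

lemma z_act: "a \<in> complex_torus \<Longrightarrow> p \<in> points M \<Longrightarrow> \<pi> p \<in> dom_of c \<Longrightarrow> z (act a p) = a * z p"
  using triv by (auto simp: trivialization_def)

lemma act_unique:
  assumes "a \<in> complex_torus" "p \<in> points M" "q \<in> points M" "\<pi> p \<in> dom_of c" "\<pi> q = \<pi> p" "z q = a * z p"
  shows "act a p = q"
proof -
  have "snd (bchart c z) (act a p) = snd (bchart c z) q"
    using assms by (simp add: snd_bchart z_act \<pi>_act)
  moreover have "act a p \<in> dom_of (bchart c z)" "q \<in> dom_of (bchart c z)"
    using assms by (simp_all add: dom_bchart act_points \<pi>_act)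
  ultimately show ?thesis using inj_bchart by (metis inj_onD)
qed

definition log_moment :: "complex^('n + 'm) \<Rightarrow> real^'n" where
  "log_moment x = \<Phi> (chart_inv (bchart c z) (fibre_exp x))"

definition log_form :: "complex^('n + 'm) \<Rightarrow> complex^('n + 'm) \<Rightarrow> complex^('n + 'm) \<Rightarrow> real" where
  "log_form x u v = Re (\<omega> (bchart c z) (fibre_exp x) (dd fibre_exp x u) (dd fibre_exp x v))"

lemma fibre_exp_img: "base x \<in> img_of c \<Longrightarrow> fibre_exp x \<in> img_of (bchart c z)"
  by (simp add: img_bchart)

lemma inv_fibre_exp:
  assumes "base x \<in> img_of c"
  shows "chart_inv (bchart c z) (fibre_exp x) \<in> dom_of (bchart c z)"
      "snd (bchart c z) (chart_inv (bchart c z) (fibre_exp x)) = fibre_exp x"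
    "z (chart_inv (bchart c z) (fibre_exp x)) $ j = exp (x $ Inl j)"
        "\<pi> (chart_inv (bchart c z) (fibre_exp x)) = chart_inv c (base x)"
  using inv_bchart[of "fibre_exp x"] assms by (simp_all del: fib_nth add: fib_nth[of "fibre_exp x"])

lemma smooth_\<Phi>: "smooth_on (img_of (bchart c z)) (\<Phi> \<circ> chart_inv (bchart c z))"
  using moment bchart_M by (auto simp: moment_map_def smooth_function_def)

lemma \<omega>_real: "x \<in> img_of (bchart c z) \<Longrightarrow> \<omega> (bchart c z) x u v
    = complex_of_real (Re (\<omega> (bchart c z) x u v))"
  using kaehler bchart_M unfolding kaehler_form_def by (metis of_real_Re)

lemma dd_log_moment:
  assumes "base x \<in> img_of c"
  shows "dd log_moment x u = dd (\<Phi> \<circ> chart_inv (bchart c z)) (fibre_exp x) (dd fibre_exp x u)"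
  using dd_compose[OF fibre_exp_differentiable
      smooth_on_differentiable[OF smooth_\<Phi> fibre_exp_img[OF assms]]]
  by (simp add: log_moment_def[abs_def] o_def)

lemma dmoment_dd:
  assumes "x \<in> img_of (bchart c z)"
  shows "dmoment \<Phi> (bchart c z) j x v = dd (\<Phi> \<circ> chart_inv (bchart c z)) x v $ j"
  using dd_vec_nth[OF smooth_on_differentiable[OF smooth_\<Phi> assms]] by (simp add: dmoment_def o_def)

text \<open>The generator of the \<open>j\<close>-th circle is \<open>i z\<^sub>j \<partial>/\<partial>z\<^sub>j\<close>.\<close>

lemma gen_bchart:
  assumes p: "p \<in> dom_of (bchart c z)"
  shows "gen act (bchart c z) j p = join (axis j (\<i> * z p $ j)) 0"
proof -
  have pM: "p \<in> points M" "\<pi> p \<in> dom_of c" using p by (simp_all add: dom_bchart)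
  have T: "circle_elt j t \<in> complex_torus" for t
    by (simp add: circle_elt_def complex_torus_def)
  have e: "snd (bchart c z) (act (circle_elt j t) p) = join (z p) (snd c (\<pi> p))
      + (cis t - 1) *s join (axis j (z p $ j)) 0" for t
    using pM T by (simp add: snd_bchart z_act \<pi>_act sum_vec_eq_iff circle_elt_def axis_def
        algebra_simps)
  have c: "((\<lambda>t. cis t) has_vector_derivative \<i> * cis 0) (at 0)"
    unfolding has_vector_derivative_def
    by (rule has_derivative_eq_rhs[OF has_derivative_cis[OF has_derivative_ident]])
        (auto simp: scaleR_conv_of_real mult_ac)
  have c': "((\<lambda>t. cis t - 1) has_vector_derivative \<i>) (at 0)"
    using has_vector_derivative_diff[OF c has_vector_derivative_const[of 1]] by simp
  have "((\<lambda>t. snd (bchart c z) (act (circle_elt j t) p)) has_vector_derivative 0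
      + \<i> *s join (axis j (z p $ j)) 0) (at 0)"
    unfolding e
    by (intro has_vector_derivative_add has_vector_derivative_const
        bounded_linear.has_vector_derivative[OF bounded_linear_vector_scalar c'])
  then have "gen act (bchart c z) j p = \<i> *s join (axis j (z p $ j)) 0"
    unfolding gen_def by (simp add: vector_derivative_at)
  then show ?thesis by (simp add: sum_vec_eq_iff axis_def)
qed

end

lemma dd_log_moment_i:
  assumes g: "trivial_over c z" and x: "base x \<in> img_of c"
  shows "dd (log_moment c z) x (\<i> *s vert j) = 0"
proof -
  let ?p = "chart_inv (bchart c z) (fibre_exp x)"
  have p: "?p \<in> dom_of (bchart c z)" by (rule inv_fibre_exp(1)[OF g x])
  then have pM: "?p \<in> points M" "\<pi> ?p \<in> dom_of c" by (simp_all add: dom_bchart)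
  have "log_moment c z (x + r *\<^sub>R (\<i> *s vert j)) = log_moment c z x" for r
  proof -
    let ?a = "circle_elt j r"
    have a: "?a \<in> compact_torus" by (simp add: circle_elt_def compact_torus_def)
    have "snd (bchart c z) (act ?a ?p) = join (?a * z ?p) (snd c (\<pi> ?p))"
      using pM compact_complex[OF a] by (simp add: snd_bchart z_act[OF g] \<pi>_act)
    also have "\<dots> = fibre_exp (x + r *\<^sub>R (\<i> *s vert j))"
    proof -
      have "snd c (\<pi> ?p) = base x"
        using arg_cong[OF inv_fibre_exp(2)[OF g x], of base] by (simp add: snd_bchart)
      then have "snd c (\<pi> ?p) $ k = x $ Inr k" for k by simp
      then show ?thesis
        using inv_fibre_exp(3)[OF g x]
        by (simp add: sum_vec_eq_iff circle_elt_def axis_def exp_add cis_conv_exp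
            scaleR_conv_of_real[where 'a = complex] mult.commute)
    qed
    finally have e: "snd (bchart c z) (act ?a ?p) = fibre_exp (x + r *\<^sub>R (\<i> *s vert j))" .
    have "act ?a ?p \<in> dom_of (bchart c z)" using pM compact_complex[OF a]
        by (simp add: dom_bchart act_points \<pi>_act)
    then have "chart_inv (bchart c z) (fibre_exp (x + r *\<^sub>R (\<i> *s vert j))) = act ?a ?p"
      unfolding e[symmetric] by (rule chart_inv_chart[OF inj_bchart[OF g]])
    then show ?thesis using \<Phi>_act[OF a pM(1)] by (simp add: log_moment_def[OF g])
  qed
  then have "((\<lambda>r. log_moment c z (x + r *\<^sub>R (\<i> *s vert j))) has_vector_derivative 0) (at 0)"
    by simp
  moreover have "log_moment c z differentiable (at (x + 0 *\<^sub>R (\<i> *s vert j)))"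
  proof -
    have "(\<lambda>x. (\<Phi> \<circ> chart_inv (bchart c z)) (fibre_exp x)) differentiable (at x)"
      using differentiable_chain_at[OF fibre_exp_differentiable
          smooth_on_differentiable[OF smooth_\<Phi>[OF g] fibre_exp_img[OF g x]]]
      by (simp add: o_def)
    then show ?thesis by (simp add: log_moment_def[OF g, abs_def] o_def)
  qed
  from dd_line[OF this]
  have "((\<lambda>r. log_moment c z (x + r *\<^sub>R (\<i> *s vert j))) has_vector_derivative dd (log_moment c z) x
      (\<i> *s vert j)) (at 0)"
    by simp
  ultimately show ?thesis using vector_derivative_unique_at by blast
qed

text \<open>The form and the moment map of the bundle, pulled back
    by \<open>fibre_exp\<close>. Closedness is preserved because
  second derivatives of \<open>fibre_exp\<close> are symmetric.\<close>

lemma log_model: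
  assumes g: "trivial_over c z"
  shows "log_model (img_of c) (log_moment c z) (log_form c z)"
proof
  let ?b = "bchart c z" and ?S = "img_of c"
  let ?W = "\<lambda>y u v. Re (\<omega> ?b y u v)"
  note bM = bchart_M[OF g]
  have ob: "open (img_of ?b)" by (rule open_img_bchart[OF g])
  have oS: "open ?S" by (rule open_img_c[OF g])
  then show "open ?S" .
  have o\<Omega>: "open (base -` ?S :: (complex^('n + 'm)) set)" by (rule open_base[OF oS])
  have cs: "fibre_exp ` (base -` ?S) \<subseteq> img_of ?b" using fibre_exp_img[OF g] by auto
  have scx: "smooth_on (base -` ?S) fibre_exp" by (rule smooth_on_subset[OF smooth_on_fibre_exp]) simp
  show "smooth_on (base -` ?S) (log_moment c z)"
    using smooth_on_compose[OF o\<Omega> ob cs scx smooth_\<Phi>[OF g]]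
        by (simp add: log_moment_def[OF g, abs_def] o_def)
  have sW: "smooth_on (img_of ?b) (\<lambda>y. ?W y u v)" for u v
    by (rule smooth_on_bounded_linear[OF bounded_linear_Re ob form2_smooth[OF two_form_\<omega> bM]])
  have lW: "linear (?W y u)" "linear (\<lambda>u. ?W y u v)" if "y \<in> img_of ?b" for y u v
    using linear_compose[OF form2_bilinear(1)[OF two_form_\<omega> bM that]
        bounded_linear.linear[OF bounded_linear_Re]]
      linear_compose[OF form2_bilinear(2)[OF two_form_\<omega> bM that]
          bounded_linear.linear[OF bounded_linear_Re]]
    by (simp_all add: o_def)
  have eW: "?W y a b = (\<Sum>i\<in>Basis. \<Sum>j\<in>Basis. (a \<bullet> i) * ((b \<bullet> j) * ?W y i j))"
      if y: "y \<in> img_of ?b" for y a b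
    by (rule bilinear_expansion[OF lW[OF y]])
  show "smooth_on (base -` ?S) (\<lambda>x. log_form c z x u v)" for u v
  proof -
    have "smooth_on (base -` ?S) (\<lambda>x. \<Sum>i\<in>Basis. \<Sum>j\<in>Basis. (dd fibre_exp x u \<bullet> i) *
        ((dd fibre_exp x v \<bullet> j) * ?W (fibre_exp x) i j))"
      by (intro smooth_on_sum smooth_on_mult o\<Omega>
          smooth_on_bounded_linear[OF bounded_linear_inner_left] smooth_on_dd scx
          smooth_on_compose[OF o\<Omega> ob cs scx sW])
    then show ?thesis
      by (rule smooth_on_eq[OF o\<Omega>, rotated]) (unfold log_form_def[OF g], subst eW, use cs in auto)
  qed
  fix x :: "complex^('n + 'm)" assume x: "base x \<in> ?S"
  have xb: "fibre_exp x \<in> img_of ?b" by (rule fibre_exp_img[OF g x])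
  have lc: "linear (dd fibre_exp x)" by (rule linear_dd[OF fibre_exp_differentiable])
  show "bilinear (log_form c z x)"
    unfolding bilinear_def log_form_def[OF g]
    using linear_compose[OF lc lW(1)[OF xb]] linear_compose[OF lc lW(2)[OF xb]] by (auto simp: o_def)
  show "log_form c z x u u = 0" for u
    by (simp add: log_form_def[OF g] form2_bilinear(3)[OF two_form_\<omega> bM xb])
  have K: "\<omega> ?b (fibre_exp x) (\<i> *s u) (\<i> *s v) = \<omega> ?b (fibre_exp x) u v" "u \<noteq> 0
      \<longrightarrow> 0 < ?W (fibre_exp x) u (\<i> *s u)" for u v
    using kaehler bM xb unfolding kaehler_form_def by blast+
  show "log_form c z x (\<i> *s u) (\<i> *s v) = log_form c z x u v" for u v
    by (simp add: log_form_def[OF g] dd_fibre_exp_i K(1))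
  show "0 < log_form c z x u (\<i> *s u)" if "u \<noteq> 0" for u
    using K(2) dd_fibre_exp_inj[of x u] that by (auto simp: log_form_def[OF g] dd_fibre_exp_i)
  show "dd (log_moment c z) x (\<i> *s vert j) = 0" for j by (rule dd_log_moment_i[OF g x])
  show "log_form c z x (\<i> *s vert j) v = - (dd (log_moment c z) x v $ j)" for j v
  proof -
    let ?p = "chart_inv ?b (fibre_exp x)"
    have p: "?p \<in> dom_of ?b" by (rule inv_fibre_exp(1)[OF g x])
    have "gen act ?b j ?p = join (axis j (\<i> * exp (x $ Inl j))) 0"
      by (simp add: gen_bchart[OF g p] inv_fibre_exp(3)[OF g x])
    also have "\<dots> = dd fibre_exp x (\<i> *s vert j)"
      by (simp add: dd_fibre_exp sum_vec_eq_iff axis_def)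
    finally have ge: "dd fibre_exp x (\<i> *s vert j) = gen act ?b j ?p" by simp
    have "\<omega> ?b (snd ?b ?p) (gen act ?b j ?p) (dd fibre_exp x v)
        = - complex_of_real (dmoment \<Phi> ?b j (snd ?b ?p) (dd fibre_exp x v))"
      using moment bM p unfolding moment_map_def by blast
    then show ?thesis
      unfolding log_form_def[OF g] ge dd_log_moment[OF g x] inv_fibre_exp(2)[OF g x]
          dmoment_dd[OF g xb] by simp
  qed
  show "dd (\<lambda>y. log_form c z y v s) x u - dd (\<lambda>y. log_form c z y u s) x v
      + dd (\<lambda>y. log_form c z y u v) x s = 0" for u v s
  proof -
    \<comment> \<open>The terms with second derivatives of the exponential cancel in the cyclic sum, these being
        symmetric.\<close>
    have D: "dd (\<lambda>y. log_form c z y v s) x u = dd (\<lambda>r. ?W r (dd fibre_exp x v) (dd fibre_exp x s))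
        (fibre_exp x) (dd fibre_exp x u)
        + ?W (fibre_exp x) (dd (\<lambda>y. dd fibre_exp y v) x u) (dd fibre_exp x s) + ?W (fibre_exp x)
            (dd fibre_exp x v) (dd (\<lambda>y. dd fibre_exp y s) x u)" for u v s
      unfolding log_form_def[OF g, abs_def]
      by (rule dd_bilinear_family[OF o\<Omega> _ ob cs lW smooth_on_differentiable[OF sW]
          fibre_exp_differentiable
            smooth_on_differentiable[OF smooth_on_dd[OF scx]]
                smooth_on_differentiable[OF smooth_on_dd[OF scx]]])
         (use x in auto)
    have sym: "dd (\<lambda>y. dd fibre_exp y v) x u = dd (\<lambda>y. dd fibre_exp y u) x v" for u v
      by (rule dd_symmetric[OF o\<Omega> scx]) (use x in simp)
    have anti: "?W (fibre_exp x) a b = - ?W (fibre_exp x) b a" for a b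
    proof -
      have "\<omega> ?b (fibre_exp x) (a + b) (a + b) = 0" by (rule form2_bilinear(3)[OF two_form_\<omega> bM xb])
      then have "?W (fibre_exp x) (a + b) (a + b) = 0" by simp
      moreover have "?W (fibre_exp x) a a = 0" "?W (fibre_exp x) b b = 0"
          by (simp_all add: form2_bilinear(3)[OF two_form_\<omega> bM xb])
      ultimately show ?thesis
        by (simp add: linear_add[OF lW(1)[OF xb]] linear_add[OF lW(2)[OF xb]] del: plus_complex.sel)
    qed
    have re: "dd (\<lambda>r. ?W r a b) (fibre_exp x) e = Re (dd (\<lambda>r. \<omega> ?b r a b) (fibre_exp x) e)" for a b e
      by (rule dd_bounded_linear[OF bounded_linear_Re
          smooth_on_differentiable[OF form2_smooth[OF two_form_\<omega> bM] xb]])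
    have "dd (\<lambda>y. \<omega> ?b y b e) (fibre_exp x) a - dd (\<lambda>y. \<omega> ?b y a e) (fibre_exp x) b
        + dd (\<lambda>y. \<omega> ?b y a b) (fibre_exp x) e = 0" for a b e
      using kaehler bM xb unfolding kaehler_form_def closed_form_def by blast
    from arg_cong[OF this, of Re]
    have "dd (\<lambda>r. ?W r b e) (fibre_exp x) a - dd (\<lambda>r. ?W r a e) (fibre_exp x) b
        + dd (\<lambda>r. ?W r a b) (fibre_exp x) e = 0" for a b e
      unfolding re by simp
    from this[of "dd fibre_exp x v" "dd fibre_exp x s" "dd fibre_exp x u"]
    show ?thesis
      unfolding D using sym[of v u] sym[of s u] sym[of s v]
        anti[of "dd fibre_exp x v" "dd (\<lambda>y. dd fibre_exp y s) x u"]
            anti[of "dd fibre_exp x u" "dd (\<lambda>y. dd fibre_exp y s) x v"]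
      by simp
  qed
qed

section \<open>Level sets of the moment map\<close>

abbreviation \<Lambda> :: "(real^'n) set" where "\<Lambda> \<equiv> Lambda M B act \<pi> \<omega> \<Phi>"

lemma orbit_self: "p \<in> points M \<Longrightarrow> p \<in> torus_orbit act p"
  unfolding torus_orbit_def
  by (intro image_eqI[of _ _ 1]) (auto simp: act_one compact_torus_def)

lemma induced_orbit:
  assumes p: "p \<in> points M" shows "induced_map \<pi> (torus_orbit act p) = \<pi> p"
proof -
  have "(SOME q. q \<in> torus_orbit act p) \<in> torus_orbit act p"
    using orbit_self[OF p] by (rule someI)
  then obtain a where "a \<in> compact_torus" "(SOME q. q \<in> torus_orbit act p) = act a p"
    unfolding torus_orbit_def by blast
  then show ?thesis using \<pi>_act[OF compact_complex p] by (simp add: induced_map_def)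
qed

text \<open>Since the induced map from orbits to the base is bijective, the level set meets every fibre,
    and it
  does so in a single orbit of the compact torus.\<close>

lemma Lambda_level:
  assumes l: "l \<in> \<Lambda>"
  shows "w \<in> points B \<Longrightarrow> \<exists>p. p \<in> level M \<Phi> l \<and> \<pi> p = w"
    and "p \<in> level M \<Phi> l \<Longrightarrow> q \<in> level M \<Phi> l \<Longrightarrow> \<pi> p = \<pi> q \<Longrightarrow> \<exists>a\<in>compact_torus. q = act a p"
proof -
  have b: "bij_betw (induced_map \<pi>) (quotient_points M act \<Phi> l) (points B)"
    using l by (auto simp: Lambda_def biholomorphic_map_def)
  show "\<exists>p. p \<in> level M \<Phi> l \<and> \<pi> p = w" if "w \<in> points B"
  proof -
    have "w \<in> induced_map \<pi> ` torus_orbit act ` level M \<Phi> l"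
      using bij_betw_imp_surj_on[OF b] that by (simp add: quotient_points_def)
    then obtain p where "p \<in> level M \<Phi> l" "w = induced_map \<pi> (torus_orbit act p)" by blast
    then show ?thesis using induced_orbit by (auto simp: level_def)
  qed
  show "\<exists>a\<in>compact_torus. q = act a p" if "p \<in> level M \<Phi> l" "q \<in> level M \<Phi> l" "\<pi> p = \<pi> q"
  proof -
    have pq: "p \<in> points M" "q \<in> points M" using that by (auto simp: level_def)
    have "torus_orbit act p = torus_orbit act q"
      by (rule inj_onD[OF bij_betw_imp_inj_on[OF b]])
         (use that pq in \<open>auto simp: induced_orbit quotient_points_def\<close>)
    then have "q \<in> torus_orbit act p" using orbit_self[OF pq(2)] by simp
    then show ?thesis by (auto simp: torus_orbit_def)
  qed
qed

text \<open>The same choice as in \<^const>\<open>restr\<close>.\<close>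

definition level_pt :: "real^'n \<Rightarrow> 'b \<Rightarrow> 'a" where
  "level_pt l w = (SOME p. p \<in> level M \<Phi> l \<and> \<pi> p = w)"

lemma restr_level_pt: "restr M \<pi> \<Phi> l u w = u (level_pt l w)"
  by (simp add: restr_def level_pt_def)

lemma level_pt:
  assumes "l \<in> \<Lambda>" "w \<in> points B"
  shows "level_pt l w \<in> level M \<Phi> l" "\<pi> (level_pt l w) = w" "level_pt l w \<in> points M"
      "\<Phi> (level_pt l w) = l"
proof -
  have "level_pt l w \<in> level M \<Phi> l \<and> \<pi> (level_pt l w) = w"
    unfolding level_pt_def by (rule someI_ex) (rule Lambda_level(1)[OF assms])
  then show "level_pt l w \<in> level M \<Phi> l" "\<pi> (level_pt l w) = w" "level_pt l w \<in> points M"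
      "\<Phi> (level_pt l w) = l"
    by (auto simp: level_def)
qed

text \<open>The function \<open>\<sigma>\<close> whose graph is the level set up to rotation: \<open>\<sigma>\<^sub>j = log |z\<^sub>j|\<close>.\<close>

definition log_radius :: "('b, 'm) chart \<Rightarrow> ('a \<Rightarrow> complex^'n) \<Rightarrow> real^'n \<Rightarrow> complex^'m \<Rightarrow> real^'n" where
  "log_radius c z l y = (\<chi> j. ln (cmod (z (level_pt l (chart_inv c y)) $ j)))"

context
  fixes c z l assumes g: "trivial_over c z" and l: "l \<in> \<Lambda>"
begin

lemma dom_points: "w \<in> dom_of c \<Longrightarrow> w \<in> points B"
  using c_B[OF g] by (auto simp: points_def)

lemma img_inv:
  assumes "y \<in> img_of c"
  shows "chart_inv c y \<in> dom_of c" "snd c (chart_inv c y) = y"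
  using assms by (rule inv_into_into, rule f_inv_into_f)

lemma exp_log_radius:
  assumes y: "y \<in> img_of c"
  shows "complex_of_real (exp (log_radius c z l y $ j))
      = complex_of_real (cmod (z (level_pt l (chart_inv c y)) $ j))"
proof -
  have w: "chart_inv c y \<in> dom_of c" by (rule img_inv(1)[OF y])
  have "z (level_pt l (chart_inv c y)) $ j \<noteq> 0"
    by (rule z_nonzero[OF g]) (simp_all add: level_pt[OF l dom_points[OF w]] w)
  then show ?thesis by (simp add: log_radius_def)
qed

text \<open>The graph consists of the points of the level set with positive fibre coordinates; rotating the
  chosen point over \<open>y\<close> makes its coordinates positive.\<close>

lemma graph_of_orbit:
  assumes y: "y \<in> img_of c"
  shows "\<exists>a\<in>compact_torus. chart_inv (bchart c z) (fibre_exp (graph_of (log_radius c z l) y))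
      = act a (level_pt l (chart_inv c y))"
proof -
  let ?w = "chart_inv c y" and ?q = "chart_inv (bchart c z) (fibre_exp (graph_of (log_radius c z l) y))"
  let ?p = "level_pt l ?w"
  note w = img_inv[OF y]
  note p = level_pt[OF l dom_points[OF w(1)]]
  have pd: "\<pi> ?p \<in> dom_of c" using w p by simp
  have nz: "z ?p $ j \<noteq> 0" for j by (rule z_nonzero[OF g p(3) pd])
  \<comment> \<open>The rotation that makes all fibre coordinates of the chosen point positive.\<close>
  let ?a = "\<chi> j. complex_of_real (cmod (z ?p $ j)) / z ?p $ j"
  have a: "?a \<in> compact_torus" using nz by (simp add: compact_torus_def norm_divide)
  have by': "base (graph_of (log_radius c z l) y) \<in> img_of c" using y by simp
  note q = inv_fibre_exp[OF g by']
  have "act ?a ?p = ?q"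
  proof (rule act_unique[OF g compact_complex[OF a] p(3) _ pd])
    show "?q \<in> points M" using q(1) by (simp add: dom_bchart)
    show "\<pi> ?q = \<pi> ?p" using q(4) p(2) by simp
    have "z ?q $ j = (?a * z ?p) $ j" for j
      unfolding q(3) using exp_log_radius[OF y, of j] nz[of j] by (simp add: graph_of_def exp_of_real)
    then show "z ?q = ?a * z ?p" by (simp only: vec_eq_iff) blast
  qed
  then show ?thesis using a by force
qed

lemma log_moment_graph_of: "y \<in> img_of c \<Longrightarrow> log_moment c z (graph_of (log_radius c z l) y) = l"
  using graph_of_orbit[of y] \<Phi>_act level_pt[OF l dom_points[OF img_inv(1)[of y]]]
      by (auto simp: log_moment_def[OF g])

lemma graph_of_level:
  assumes y: "y \<in> img_of c"
  shows "chart_inv (bchart c z) (fibre_exp (graph_of (log_radius c z l) y)) \<in> level M \<Phi> l"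
    "\<pi> (chart_inv (bchart c z) (fibre_exp (graph_of (log_radius c z l) y))) = chart_inv c y"
    "chart_inv (bchart c z) (fibre_exp (graph_of (log_radius c z l) y)) \<in> dom_of (bchart c z)"
proof -
  have by': "base (graph_of (log_radius c z l) y) \<in> img_of c" using y by simp
  note q = inv_fibre_exp[OF g by']
  show "chart_inv (bchart c z) (fibre_exp (graph_of (log_radius c z l) y)) \<in> dom_of (bchart c z)"
      by (rule q(1))
  then show "chart_inv (bchart c z) (fibre_exp (graph_of (log_radius c z l) y)) \<in> level M \<Phi> l"
    using log_moment_graph_of[OF y] by (simp add: level_def log_moment_def[OF g] dom_bchart)
  show "\<pi> (chart_inv (bchart c z) (fibre_exp (graph_of (log_radius c z l) y))) = chart_inv c y"
      using q(4) by simp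
qed

lemma restr_graph_of:
  assumes u: "\<And>a p. a \<in> compact_torus \<Longrightarrow> p \<in> dom_of (bchart c z) \<Longrightarrow> u (act a p) = u p" and
      y: "y \<in> img_of c"
  shows "restr M \<pi> \<Phi> l u (chart_inv c y) = u
      (chart_inv (bchart c z) (fibre_exp (graph_of (log_radius c z l) y)))"
proof -
  note p = level_pt[OF l dom_points[OF img_inv(1)[OF y]]]
  have "level_pt l (chart_inv c y) \<in> dom_of (bchart c z)" using p img_inv(1)[OF y]
      by (simp add: dom_bchart)
  then show ?thesis using graph_of_orbit[OF y] u by (auto simp: restr_level_pt)
qed

lemma smooth_log_radius: "smooth_on (img_of c) (log_radius c z l)"
  by (rule log_model.section_smooth[OF log_model[OF g] log_moment_graph_of])

end

end

section \<open>The reduced form\<close>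

lemma tmap_id: "tmap c d id x = dd (snd d \<circ> chart_inv c) x"
  by (simp add: tmap_def o_def)

lemma transition_differentiable:
  assumes A: "complex_manifold A" and c: "c \<in> A" and d: "d \<in> A" and p: "p \<in> dom_of c" "p \<in> dom_of d"
  shows "(snd d \<circ> chart_inv c) differentiable (at (snd c p))" "snd c p \<in> snd c ` (dom_of c \<inter> dom_of d)"
    "open (snd c ` (dom_of c \<inter> dom_of d))" "holo_on (snd c ` (dom_of c \<inter> dom_of d))
        (snd d \<circ> chart_inv c)"
proof -
  show o: "open (snd c ` (dom_of c \<inter> dom_of d))" and h: "holo_on (snd c ` (dom_of c \<inter> dom_of d))
      (snd d \<circ> chart_inv c)"
    using manifoldD(3)[OF A c d] by (simp_all add: holo_transition_def)
  show x: "snd c p \<in> snd c ` (dom_of c \<inter> dom_of d)" using p by blast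
  show "(snd d \<circ> chart_inv c) differentiable (at (snd c p))" by (rule holo_on_differentiable[OF h x])
qed

lemma dd_transition:
  assumes A: "complex_manifold A" and c: "c \<in> A" and d: "d \<in> A" and p: "p \<in> dom_of c" "p \<in> dom_of d"
    and F: "(F \<circ> chart_inv d) differentiable (at (snd d p))"
  shows "dd (F \<circ> chart_inv c) (snd c p) v = dd (F \<circ> chart_inv d) (snd d p) (tmap c d id (snd c p) v)"
    "(F \<circ> chart_inv c) differentiable (at (snd c p))"
proof -
  note t = transition_differentiable[OF A c d p]
  let ?N = "snd c ` (dom_of c \<inter> dom_of d)" and ?h = "snd d \<circ> chart_inv c"
  note ic = manifoldD(1)[OF A c] and id = manifoldD(1)[OF A d]
  have hp: "?h (snd c p) = snd d p" using ic p by simp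
  have eq: "(F \<circ> chart_inv d) (?h y) = (F \<circ> chart_inv c) y" if "y \<in> ?N" for y
    using that ic id by auto
  have F': "(F \<circ> chart_inv d) differentiable (at (?h (snd c p)))" using F hp by simp
  have "dd (\<lambda>y. (F \<circ> chart_inv d) (?h y)) (snd c p) v = dd (F \<circ> chart_inv d) (snd d p)
      (dd ?h (snd c p) v)"
    using dd_compose[OF t(1) F', of v] by (simp only: hp)
  moreover have "dd (\<lambda>y. (F \<circ> chart_inv d) (?h y)) (snd c p) = dd (F \<circ> chart_inv c) (snd c p)"
    by (rule dd_eq_open[OF t(3,2) eq])
  ultimately show "dd (F \<circ> chart_inv c) (snd c p) v = dd (F \<circ> chart_inv d) (snd d p)
      (tmap c d id (snd c p) v)"
    by (simp add: tmap_id)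
  have "(\<lambda>y. (F \<circ> chart_inv d) (?h y)) differentiable (at (snd c p))"
    using differentiable_chain_at[OF t(1) F'] by (simp add: o_def)
  then show "(F \<circ> chart_inv c) differentiable (at (snd c p))"
    using differentiable_eq_open[of ?N "snd c p" "\<lambda>y. (F \<circ> chart_inv d) (?h y)" "F \<circ> chart_inv c",
        OF t(3,2) eq]
    by blast
qed

lemma two_form_transition:
  "two_form A \<alpha> \<Longrightarrow> c \<in> A \<Longrightarrow> d \<in> A \<Longrightarrow> p \<in> dom_of c \<Longrightarrow> p \<in> dom_of d \<Longrightarrow>
    \<alpha> c (snd c p) u v = \<alpha> d (snd d p) (tmap c d id (snd c p) u) (tmap c d id (snd c p) v)"
  unfolding two_form_def by blast

context hamiltonian_bundle
begin

lemma tmap_\<pi>_bchart: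
  assumes g: "trivial_over c z" and d: "d \<in> B" and x: "x \<in> img_of (bchart c z)" and
      w: "chart_inv c (base x) \<in> dom_of d"
  shows "tmap (bchart c z) d \<pi> x U = tmap c d id (base x) (base U)"
proof -
  have bx: "base x \<in> img_of c" using x img_bchart[OF g] by blast
  note w' = inv_into_into[OF bx] f_inv_into_f[OF bx]
  have "tmap (bchart c z) d \<pi> x U = dd (\<lambda>x. (snd d \<circ> chart_inv c) (base x)) x U"
    unfolding tmap_def
  proof (rule fun_cong[OF dd_eq_open[OF open_img_bchart[OF g] x]])
    fix y assume "y \<in> img_of (bchart c z)"
    then show "(snd d \<circ> \<pi> \<circ> chart_inv (bchart c z)) y = (snd d \<circ> chart_inv c) (base y)"
      unfolding img_bchart[OF g] by (simp add: inv_bchart(4)[OF g])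
  qed
  also have "\<dots> = dd (snd d \<circ> chart_inv c) (base x) (dd base x U)"
    using transition_differentiable(1)[OF manifold_B c_B[OF g] d w'(1) w]
    by (intro dd_compose[OF bounded_linear_imp_differentiable[OF bounded_linear_base]])
        (simp add: w'(2) o_def)
  finally show ?thesis by (simp add: tmap_id dd_linear[OF bounded_linear_base])
qed

lemma tmap_\<pi>_base:
  assumes g: "trivial_over c z" and d: "snd d = snd c" and x: "x \<in> img_of (bchart c z)"
  shows "tmap (bchart c z) d \<pi> x U = base U"
proof -
  have "tmap (bchart c z) d \<pi> x U = dd base x U"
    unfolding tmap_def d
  proof (rule fun_cong[OF dd_eq_open[OF open_img_bchart[OF g] x]])
    fix y assume "y \<in> img_of (bchart c z)"
    then show "(snd c \<circ> \<pi> \<circ> chart_inv (bchart c z)) y = base y"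
      unfolding img_bchart[OF g] by (simp add: inv_bchart(6)[OF g])
  qed
  then show ?thesis by (simp add: dd_linear[OF bounded_linear_base])
qed

definition reduced_coeff :: "('b, 'm) chart \<Rightarrow> ('a \<Rightarrow> complex^'n) \<Rightarrow> real^'n \<Rightarrow> complex^'m \<Rightarrow> complex^'m
    \<Rightarrow> complex^'m \<Rightarrow> complex" where
  "reduced_coeff c z l y u v = complex_of_real
      (log_model.graph_form (log_form c z) (log_radius c z l) y u v)"

text \<open>On the level set \<open>\<omega>\<close> is the pullback of the form with the coefficients \<^const>\<open>log_model.graph_form\<close>,
  whatever chart of the total space is used. Existence, uniqueness and transformation behaviour of
  the reduced form all follow from this equation.\<close>

lemma level_form_eq_reduced_coeff:
  assumes g: "trivial_over c z" and l: "l \<in> \<Lambda>" and p: "p \<in> level M \<Phi> l" "\<pi> p \<in> dom_of c"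
    and b1: "b1 \<in> M" "p \<in> dom_of b1"
    and U: "U \<in> level_tangent \<Phi> b1 p" and V: "V \<in> level_tangent \<Phi> b1 p"
  shows "\<omega> b1 (snd b1 p) U V = reduced_coeff c z l (snd c (\<pi> p)) (tmap b1 c \<pi> (snd b1 p) U)
      (tmap b1 c \<pi> (snd b1 p) V)"
proof -
  interpret log_model "img_of c" "log_moment c z" "log_form c z" by (rule log_model[OF g])
  let ?b = "bchart c z"
  note bM = bchart_M[OF g]
  have pM: "p \<in> points M" "\<Phi> p = l" using p by (auto simp: level_def)
  have pb: "p \<in> dom_of ?b" using pM p by (simp add: dom_bchart)
  have nz: "z p $ j \<noteq> 0" for j by (rule z_nonzero[OF g pM(1) p(2)])
  define x :: "complex^('n + 'm)" where "x = join (\<chi> j. Ln (z p $ j)) (snd c (\<pi> p))"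
  have bx: "base x \<in> img_of c" "base x = snd c (\<pi> p)" using p by (simp_all add: x_def)
  have ex: "fibre_exp x = snd ?b p" using nz by (simp add: sum_vec_eq_iff x_def snd_bchart)
  have inv: "chart_inv ?b (fibre_exp x) = p" unfolding ex
      by (rule chart_inv_chart[OF inj_bchart[OF g] pb])
  have phix: "log_moment c z x = l" unfolding log_moment_def[OF g] inv by (rule pM(2))
  have xb: "snd ?b p \<in> img_of ?b" using pb by blast
  define L :: "complex^('n + 'm) \<Rightarrow> complex^('n + 'm)"
    where "L U = join (\<chi> j. U $ Inl j / exp (x $ Inl j)) (base U)" for U
  have L: "dd fibre_exp x (L U) = U" for U
    by (simp add: dd_fibre_exp L_def sum_vec_eq_iff)
  have bL: "base (L U) = base U" for U by (simp add: L_def)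
  let ?T = "tmap b1 ?b id (snd b1 p)"
  have tan: "dd (log_moment c z) x (L (?T U)) = 0" if U: "U \<in> level_tangent \<Phi> b1 p" for U
  proof -
    have "dd (log_moment c z) x (L (?T U)) $ j = 0" for j
    proof -
      have sm: "(\<Phi> \<circ> chart_inv ?b) differentiable (at (snd ?b p))"
        by (rule smooth_on_differentiable[OF smooth_\<Phi>[OF g] xb])
      have d: "((\<lambda>p. \<Phi> p $ j) \<circ> chart_inv ?b) differentiable (at (snd ?b p))"
        using smooth_on_differentiable[OF smooth_on_vec_nth[OF open_img_bchart[OF g] smooth_\<Phi>[OF g]] xb]
        by (simp add: o_def)
      have "dd (log_moment c z) x (L (?T U)) $ j = dd (\<Phi> \<circ> chart_inv ?b) (snd ?b p) (?T U) $ j"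
        by (simp add: dd_log_moment[OF g bx(1)] L ex)
      also have "\<dots> = dd ((\<lambda>p. \<Phi> p $ j) \<circ> chart_inv ?b) (snd ?b p) (?T U)"
        using dd_vec_nth[OF sm] by (simp add: o_def)
      also have "\<dots> = dmoment \<Phi> b1 j (snd b1 p) U"
        unfolding dmoment_def by (rule dd_transition(1)[OF manifold_M b1(1) bM b1(2) pb d, symmetric])
      also have "\<dots> = 0" using U by (simp add: level_tangent_def)
      finally show ?thesis .
    qed
    then show ?thesis by (simp add: vec_eq_iff)
  qed
  have base: "base (?T U) = tmap b1 c \<pi> (snd b1 p) U" for U
  proof -
    have "((snd c \<circ> \<pi>) \<circ> chart_inv ?b) differentiable (at (snd ?b p))"
    proof (rule differentiable_eq_open[OF open_img_bchart[OF g] xb])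
      show "base differentiable (at (snd ?b p))"
        by (rule bounded_linear_imp_differentiable[OF bounded_linear_base])
    qed (auto simp: img_bchart[OF g] inv_bchart(6)[OF g])
    from dd_transition(1)[OF manifold_M b1(1) bM b1(2) pb this, of U]
    have "tmap b1 c \<pi> (snd b1 p) U = tmap ?b c \<pi> (snd ?b p) (?T U)" by (simp add: tmap_def)
    then show ?thesis by (simp add: tmap_\<pi>_base[OF g refl xb])
  qed
  have "\<omega> b1 (snd b1 p) U V = \<omega> ?b (snd ?b p) (?T U) (?T V)"
    by (rule two_form_transition[OF two_form_\<omega> b1(1) bM b1(2) pb])
  also have "\<dots> = complex_of_real (log_form c z x (L (?T U)) (L (?T V)))"
    using \<omega>_real[OF g xb] by (simp add: log_form_def[OF g] L ex)
  also have "log_form c z x (L (?T U)) (L (?T V)) = graph_form (log_radius c z l) (base x)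
      (base (L (?T U))) (base (L (?T V)))"
    by (rule graph_form_tangent[OF log_moment_graph_of[OF g l] bx(1) phix tan[OF U] tan[OF V]])
  finally show ?thesis by (simp only: reduced_coeff_def bL base bx(2))
qed

text \<open>Together with \<open>graph_pt\<close>: a lift of the base vector \<open>u\<close> at \<open>y\<close> to a tangent vector of the
    level set,
  along the graph, in the chart of the trivialization.\<close>

definition graph_lift :: "('b, 'm) chart \<Rightarrow> ('a \<Rightarrow> complex^'n) \<Rightarrow> real^'n \<Rightarrow> complex^'m \<Rightarrow> complex^'m
    \<Rightarrow> complex^('n + 'm)" where
  "graph_lift c z l y u = dd fibre_exp (graph_of (log_radius c z l) y)
      (dd (graph_of (log_radius c z l)) y u)"

definition graph_pt :: "('b, 'm) chart \<Rightarrow> ('a \<Rightarrow> complex^'n) \<Rightarrow> real^'n \<Rightarrow> complex^'m \<Rightarrow> 'a" where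
  "graph_pt c z l y = chart_inv (bchart c z) (fibre_exp (graph_of (log_radius c z l) y))"

lemma graph_pt:
  assumes g: "trivial_over c z" and l: "l \<in> \<Lambda>" and y: "y \<in> img_of c"
  shows "graph_pt c z l y \<in> level M \<Phi> l" "\<pi> (graph_pt c z l y) = chart_inv c y"
      "graph_pt c z l y \<in> dom_of (bchart c z)"
    "snd (bchart c z) (graph_pt c z l y) = fibre_exp (graph_of (log_radius c z l) y)"
        "snd (bchart c z) (graph_pt c z l y) \<in> img_of (bchart c z)"
    "base (snd (bchart c z) (graph_pt c z l y)) = y"
proof -
  show "graph_pt c z l y \<in> level M \<Phi> l" "\<pi> (graph_pt c z l y) = chart_inv c y" and
      d: "graph_pt c z l y \<in> dom_of (bchart c z)"
    using graph_of_level[OF g l y] by (simp_all add: graph_pt_def)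
  show "snd (bchart c z) (graph_pt c z l y) \<in> img_of (bchart c z)" using d by blast
  show 1: "snd (bchart c z) (graph_pt c z l y) = fibre_exp (graph_of (log_radius c z l) y)"
    unfolding graph_pt_def by (rule inv_fibre_exp(2)[OF g]) (simp add: y)
  show "base (snd (bchart c z) (graph_pt c z l y)) = y" unfolding 1 by simp
qed

lemma base_graph_lift:
  assumes g: "trivial_over c z" and l: "l \<in> \<Lambda>" and y: "y \<in> img_of c"
  shows "base (graph_lift c z l y u) = u"
  by (simp add: graph_lift_def dd_graph_of(2)[OF
      smooth_on_differentiable[OF smooth_log_radius[OF g l] y]])

lemma graph_lift_tangent:
  assumes g: "trivial_over c z" and l: "l \<in> \<Lambda>" and y: "y \<in> img_of c"
  shows "graph_lift c z l y u \<in> level_tangent \<Phi> (bchart c z) (graph_pt c z l y)"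
proof -
  interpret log_model "img_of c" "log_moment c z" "log_form c z" by (rule log_model[OF g])
  have by': "base (graph_of (log_radius c z l) y) \<in> img_of c" using y by simp
  have "dmoment \<Phi> (bchart c z) j (snd (bchart c z) (graph_pt c z l y)) (graph_lift c z l y u) = 0" for j
  proof -
    have "dmoment \<Phi> (bchart c z) j (snd (bchart c z) (graph_pt c z l y)) (graph_lift c z l y u)
      = dd (log_moment c z) (graph_of (log_radius c z l) y) (dd (graph_of (log_radius c z l)) y u) $ j"
      unfolding dmoment_dd[OF g graph_pt(5)[OF assms]]
      by (simp add: dd_log_moment[OF g by'] graph_pt(4)[OF assms] graph_lift_def)
    also have "\<dots> = 0"
      by (simp add: dd_graph_of(2)[OF smooth_on_differentiable[OF smooth_log_radius[OF g l] y]]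
          section_tangent[of "log_radius c z l" l y u, OF log_moment_graph_of[OF g l] y])
    finally show ?thesis .
  qed
  then show ?thesis by (simp add: level_tangent_def)
qed

text \<open>Every base vector lifts to the level set, so the defining property of the reduced form determines
  all its coefficients.\<close>

lemma reduced_form_coeff:
  assumes \<sigma>: "is_reduced_form M B \<pi> \<omega> \<Phi> l \<sigma>" and g: "trivial_over c' z" and l: "l \<in> \<Lambda>"
    and c: "c \<in> B" "snd c' = snd c" "dom_of c' \<subseteq> dom_of c" and y: "y \<in> img_of c'"
  shows "\<sigma> c y u v = reduced_coeff c' z l y u v"
proof -
  let ?p = "graph_pt c' z l y" and ?b = "bchart c' z"
  note p = graph_pt[OF g l y]
  have w: "chart_inv c' y \<in> dom_of c'" by (rule inv_into_into[OF y])
  have sy: "snd c (\<pi> ?p) = y" using f_inv_into_f[OF y] by (simp add: p(2) c(2)[symmetric])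
  have t: "tmap ?b c \<pi> (snd ?b ?p) (graph_lift c' z l y u) = u"
      "tmap ?b c' \<pi> (snd ?b ?p) (graph_lift c' z l y u) = u" for u
    using tmap_\<pi>_base[OF g _ p(5)] c(2) by (simp_all add: base_graph_lift[OF g l y])
  have "\<pi> ?p \<in> dom_of c" using w c(3) p(2) by auto
  then have "\<sigma> c (snd c (\<pi> ?p)) (tmap ?b c \<pi> (snd ?b ?p) (graph_lift c' z l y u))
      (tmap ?b c \<pi> (snd ?b ?p) (graph_lift c' z l y v))
      = \<omega> ?b (snd ?b ?p) (graph_lift c' z l y u) (graph_lift c' z l y v)"
    using \<sigma> bchart_M[OF g] c(1) p(1,3) graph_lift_tangent[OF g l y] unfolding is_reduced_form_def
        by blast
  also have "\<dots> = reduced_coeff c' z l (snd c' (\<pi> ?p)) u v"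
    using level_form_eq_reduced_coeff[OF g l p(1) _ bchart_M[OF g] p(3) graph_lift_tangent[OF g l y]
        graph_lift_tangent[OF g l y]] w p(2)
    by (simp add: t)
  finally show ?thesis by (simp add: t sy c(2))
qed

text \<open>A trivialization over a smaller domain containing the point with coordinate \<open>x\<close>, with the
  coordinate map of \<open>c\<close>. Charts of the base need not carry a trivialization themselves.\<close>

definition trivializes_at :: "('b, 'm) chart \<Rightarrow> complex^'m \<Rightarrow> ('b, 'm) chart \<times> ('a \<Rightarrow> complex^'n)
    \<Rightarrow> bool" where
  "trivializes_at c x q \<longleftrightarrow> trivial_over (fst q) (snd q) \<and> snd (fst q) = snd c
      \<and> dom_of (fst q) \<subseteq> dom_of c \<and> x \<in> img_of (fst q)"

lemma trivializes_at_exists: "c \<in> B \<Longrightarrow> x \<in> img_of c \<Longrightarrow> \<exists>q. trivializes_at c x q"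
proof -
  assume c: "c \<in> B" and x: "x \<in> img_of c"
  obtain c' z where "trivial_over c' z" "chart_inv c x \<in> dom_of c'" "dom_of c' \<subseteq> dom_of c" "snd c'
      = snd c"
    using trivial_over_nhd[OF c inv_into_into[OF x]] by blast
  then have "trivializes_at c x (c', z)"
    unfolding trivializes_at_def using f_inv_into_f[OF x]
        by (auto simp: image_iff intro!: bexI[of _ "chart_inv c x"])
  then show ?thesis ..
qed

definition chosen_triv :: "('b, 'm) chart \<Rightarrow> complex^'m \<Rightarrow> ('b, 'm) chart \<times> ('a \<Rightarrow> complex^'n)" where
  "chosen_triv c x = (SOME q. trivializes_at c x q)"

lemma trivializes_at_chosen_triv: "c \<in> B \<Longrightarrow> x \<in> img_of c \<Longrightarrow> trivializes_at c x (chosen_triv c x)"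
  unfolding chosen_triv_def by (rule someI_ex[OF trivializes_at_exists])

lemma trivializes_at_inv:
  assumes "c \<in> B" "trivializes_at c x q" "y \<in> img_of (fst q)"
  shows "chart_inv (fst q) y = chart_inv c y" "y \<in> img_of c" "chart_inv (fst q) y \<in> dom_of (fst q)"
proof -
  note w = inv_into_into[OF assms(3)] f_inv_into_f[OF assms(3)]
  have w': "chart_inv (fst q) y \<in> dom_of c" "snd c (chart_inv (fst q) y) = y"
    using w assms(2) by (auto simp: trivializes_at_def)
  then show "y \<in> img_of c" by (metis imageI)
  show "chart_inv (fst q) y = chart_inv c y"
    using chart_inv_chart[OF manifoldD(1)[OF manifold_B assms(1)] w'(1)] w'(2) by simp
  show "chart_inv (fst q) y \<in> dom_of (fst q)" by (rule w(1))
qed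

text \<open>The local pullbacks, glued by choosing a trivialization near each point. By
  \<open>level_form_eq_reduced_coeff\<close> the choice does not matter, which gives smoothness and the
  transformation law.\<close>

definition glued_reduced_form :: "real^'n \<Rightarrow> ('b, 'm) form2" where
  "glued_reduced_form l c x u v = reduced_coeff (fst (chosen_triv c x)) (snd (chosen_triv c x)) l x u v"

lemma glued_reduced_form_level:
  assumes l: "l \<in> \<Lambda>" and b: "b \<in> M" and c: "c \<in> B" and p: "p \<in> level M \<Phi> l" "p \<in> dom_of b"
      "\<pi> p \<in> dom_of c"
    and U: "U \<in> level_tangent \<Phi> b p" and V: "V \<in> level_tangent \<Phi> b p"
  shows "glued_reduced_form l c (snd c (\<pi> p)) (tmap b c \<pi> (snd b p) U) (tmap b c \<pi> (snd b p) V)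
      = \<omega> b (snd b p) U V"
proof -
  let ?x = "snd c (\<pi> p)"
  have x: "?x \<in> img_of c" using p by blast
  obtain c' z where q: "chosen_triv c ?x = (c', z)" by (cases "chosen_triv c ?x")
  have s: "trivializes_at c ?x (c', z)" using trivializes_at_chosen_triv[OF c x] q by simp
  have c': "trivial_over c' z" "snd c' = snd c" "dom_of c' \<subseteq> dom_of c" "?x \<in> img_of c'" using s
      by (auto simp: trivializes_at_def)
  have "chart_inv c' ?x = \<pi> p"
    using trivializes_at_inv(1)[OF c s, of ?x] c'(4)
        chart_inv_chart[OF manifoldD(1)[OF manifold_B c] p(3)] by simp
  then have "\<pi> p \<in> dom_of c'" using trivializes_at_inv(3)[OF c s, of ?x] c'(4) by simp
  from level_form_eq_reduced_coeff[OF c'(1) l p(1) this b p(2) U V]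
  show ?thesis by (simp add: glued_reduced_form_def q tmap_def c'(2))
qed

lemma glued_reduced_form_local:
  assumes l: "l \<in> \<Lambda>" and c: "c \<in> B" and s: "trivializes_at c x0 (c', z)" and y: "y \<in> img_of c'"
  shows "glued_reduced_form l c y u v = reduced_coeff c' z l y u v"
proof -
  have g: "trivial_over c' z" "snd c' = snd c" using s by (auto simp: trivializes_at_def)
  let ?p = "graph_pt c' z l y" and ?b = "bchart c' z"
  note p = graph_pt[OF g(1) l y]
  have y': "y \<in> img_of (fst (c', z))" using y by simp
  have w: "\<pi> ?p \<in> dom_of c'" "\<pi> ?p \<in> dom_of c" "snd c (\<pi> ?p) = y" "snd c' (\<pi> ?p) = y"
    using trivializes_at_inv[OF c s y'] s f_inv_into_f[OF y] by (auto simp: p(2) trivializes_at_def)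
  have t: "tmap ?b c \<pi> (snd ?b ?p) (graph_lift c' z l y u) = u"
      "tmap ?b c' \<pi> (snd ?b ?p) (graph_lift c' z l y u) = u" for u
    using tmap_\<pi>_base[OF g(1) _ p(5)] g(2) by (simp_all add: base_graph_lift[OF g(1) l y])
  note T = graph_lift_tangent[OF g(1) l y]
  show ?thesis
    using glued_reduced_form_level[OF l bchart_M[OF g(1)] c p(1) p(3) w(2) T T]
      level_form_eq_reduced_coeff[OF g(1) l p(1) w(1) bchart_M[OF g(1)] p(3) T T]
    by (simp add: t w)
qed

lemma is_reduced_form_glued:
  assumes l: "l \<in> \<Lambda>" shows "is_reduced_form M B \<pi> \<omega> \<Phi> l (glued_reduced_form l)"
  unfolding is_reduced_form_def
proof (intro conjI ballI impI)
  show "glued_reduced_form l c (snd c (\<pi> p)) (tmap b c \<pi> (snd b p) u) (tmap b c \<pi> (snd b p) v)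
      = \<omega> b (snd b p) u v"
    if "b \<in> M" "c \<in> B" "p \<in> level M \<Phi> l \<inter> dom_of b" "\<pi> p \<in> dom_of c" "u \<in> level_tangent \<Phi> b p"
        "v \<in> level_tangent \<Phi> b p"
    for b c p u v
    using glued_reduced_form_level[OF l that(1,2) _ _ that(4,5,6)] that(3) by blast
  show "two_form B (glued_reduced_form l)"
    unfolding two_form_def
  proof (intro conjI ballI allI)
    fix c assume c: "c \<in> B"
    show "smooth_on (img_of c) (\<lambda>x. glued_reduced_form l c x u v)" for u v
    proof (rule smooth_on_local)
      fix x assume "x \<in> img_of c"
      then obtain c' z where s: "trivializes_at c x (c', z)" using trivializes_at_exists[OF c] by force
      then have g: "trivial_over c' z" "x \<in> img_of c'" by (auto simp: trivializes_at_def)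
      have "smooth_on (img_of c') (\<lambda>y. reduced_coeff c' z l y u v)"
        unfolding reduced_coeff_def
        by (rule smooth_on_bounded_linear[OF bounded_linear_of_real open_img_c[OF g(1)]
              log_model.graph_form_smooth[OF log_model[OF g(1)] smooth_log_radius[OF g(1) l]]])
      then have "smooth_on (img_of c') (\<lambda>y. glued_reduced_form l c y u v)"
        by (rule smooth_on_eq[OF open_img_c[OF g(1)], rotated])
            (simp add: glued_reduced_form_local[OF l c s])
      then show "\<exists>N. open N \<and> x \<in> N \<and> smooth_on N (\<lambda>y. glued_reduced_form l c y u v)"
        using g open_img_c[OF g(1)] by blast
    qed
    fix x assume x: "x \<in> img_of c"
    have s: "trivializes_at c x (chosen_triv c x)" by (rule trivializes_at_chosen_triv[OF c x])
    then have g: "trivial_over (fst (chosen_triv c x)) (snd (chosen_triv c x))"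
        "x \<in> img_of (fst (chosen_triv c x))" by (auto simp: trivializes_at_def)
    note rb = log_model.graph_form_bilinear[OF log_model[OF g(1)]
        smooth_on_differentiable[OF smooth_log_radius[OF g(1) l] g(2)] g(2)]
    show "bilinear (glued_reduced_form l c x)"
    proof -
      have cr: "linear complex_of_real" by (rule bounded_linear.linear[OF bounded_linear_of_real])
      show ?thesis
        using rb(1) unfolding bilinear_def glued_reduced_form_def reduced_coeff_def
        using linear_compose[OF _ cr] by (auto simp: o_def)
    qed
    show "glued_reduced_form l c x u u = 0" for u using rb(2)
        by (simp add: glued_reduced_form_def reduced_coeff_def)
  next
    fix c d p u v assume c: "c \<in> B" and d: "d \<in> B" and p: "p \<in> dom_of c \<inter> dom_of d"
    let ?y = "snd c p"
    have y: "?y \<in> img_of c" using p by blast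
    then obtain c' z where s: "trivializes_at c ?y (c', z)" using trivializes_at_exists[OF c] by force
    then have g: "trivial_over c' z" "?y \<in> img_of c'" "snd c' = snd c" "dom_of c' \<subseteq> dom_of c"
        by (auto simp: trivializes_at_def)
    let ?q = "graph_pt c' z l ?y" and ?b = "bchart c' z"
    note q = graph_pt[OF g(1) l g(2)]
    have ci: "chart_inv c' ?y = p"
      using trivializes_at_inv(1)[OF c s, of ?y] g(2)
          chart_inv_chart[OF manifoldD(1)[OF manifold_B c]] p by simp
    have t: "tmap ?b c \<pi> (snd ?b ?q) (graph_lift c' z l ?y u) = u" for u
      using tmap_\<pi>_base[OF g(1) _ q(5), of c] g(3) by (simp add: base_graph_lift[OF g(1) l g(2)])
    have ext: "tmap c' d id ?y = tmap c d id ?y"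
      unfolding tmap_id
    proof (rule dd_eq_open[OF open_img_c[OF g(1)] g(2)])
      fix y assume "y \<in> img_of c'"
      then show "(snd d \<circ> chart_inv c') y = (snd d \<circ> chart_inv c) y"
        using trivializes_at_inv(1)[OF c s, of y] by simp
    qed
    have t': "tmap ?b d \<pi> (snd ?b ?q) (graph_lift c' z l ?y u) = tmap c d id ?y u" for u
      using tmap_\<pi>_bchart[OF g(1) d q(5)] p by (simp add: q(6) ci base_graph_lift[OF g(1) l g(2)] ext)
    note T = graph_lift_tangent[OF g(1) l g(2)]
    have "glued_reduced_form l c (snd c (\<pi> ?q)) (tmap ?b c \<pi> (snd ?b ?q) (graph_lift c' z l ?y u))
        (tmap ?b c \<pi> (snd ?b ?q) (graph_lift c' z l ?y v))
      = glued_reduced_form l d (snd d (\<pi> ?q)) (tmap ?b d \<pi> (snd ?b ?q) (graph_lift c' z l ?y u))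
          (tmap ?b d \<pi> (snd ?b ?q) (graph_lift c' z l ?y v))"
      using glued_reduced_form_level[OF l bchart_M[OF g(1)] c q(1,3) _ T T]
          glued_reduced_form_level[OF l bchart_M[OF g(1)] d q(1,3) _ T T] p
      by (simp add: q(2) ci)
    then show "glued_reduced_form l c ?y u v = glued_reduced_form l d (snd d p) (tmap c d id ?y u)
        (tmap c d id ?y v)"
      by (simp add: t t' q(2) ci)
  qed
qed

end

section \<open>Curvature of the line bundles\<close>

text \<open>Levi forms of functions are well defined on a complex manifold.\<close>

lemma levi_transition:
  fixes f :: "'a \<Rightarrow> real"
  assumes A: "complex_manifold A" and c: "c \<in> A" and d: "d \<in> A" and p: "p \<in> dom_of c" "p \<in> dom_of d"
    and V: "open V" "snd d p \<in> V" "smooth_on V (f \<circ> chart_inv d)"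
  shows "levi (f \<circ> chart_inv c) (snd c p) u v =
    levi (f \<circ> chart_inv d) (snd d p) (tmap c d id (snd c p) u) (tmap c d id (snd c p) v)"
proof -
  note t = transition_differentiable[OF A c d p]
  let ?N = "snd c ` (dom_of c \<inter> dom_of d)" and ?h = "snd d \<circ> chart_inv c"
  note ic = manifoldD(1)[OF A c] and id = manifoldD(1)[OF A d]
  let ?N' = "?N \<inter> ?h -` V"
  have o: "open ?N'" by (rule continuous_open_preimage[OF holo_on_continuous[OF t(4)] t(3) V(1)])
  have hp: "?h (snd c p) = snd d p" using ic p by simp
  have pN: "snd c p \<in> ?N'" using t(2) V(2) hp by simp
  have eq: "(f \<circ> chart_inv d) (?h y) = (f \<circ> chart_inv c) y" if "y \<in> ?N'" for y
    using that ic id by auto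
  have "levi (\<lambda>y. (f \<circ> chart_inv d) (?h y)) (snd c p) u v =
      levi (f \<circ> chart_inv d) (?h (snd c p)) (dd ?h (snd c p) u) (dd ?h (snd c p) v)"
    by (rule levi_compose_holo[OF o pN holo_on_subset[OF t(4)] V(1) _ V(3)]) auto
  moreover have "levi (\<lambda>y. (f \<circ> chart_inv d) (?h y)) (snd c p) u v
      = levi (f \<circ> chart_inv c) (snd c p) u v"
    by (rule levi_eq_open[OF o pN eq])
  ultimately show ?thesis by (simp only: hp tmap_id)
qed

lemma openin_atlas:
  assumes A: "complex_manifold A" and c: "c \<in> A" and U: "openin (atlas_topology A) U"
  shows "open (snd c ` (dom_of c \<inter> U))"
proof -
  note ic = manifoldD(1)[OF A c]
  have "generate_topology_on (dom_of ` A) U"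
    using U by (simp add: atlas_topology_def openin_topology_generated_by_iff)
  then show ?thesis
  proof (induction rule: generate_topology_on.induct)
    case Empty then show ?case by simp
  next
    case (Int a b)
    have "snd c ` (dom_of c \<inter> (a \<inter> b)) = snd c ` (dom_of c \<inter> a) \<inter> snd c ` (dom_of c \<inter> b)"
      using ic by (auto dest: inj_onD)
    then show ?case using Int.IH by (simp add: open_Int)
  next
    case (UN K)
    have "snd c ` (dom_of c \<inter> \<Union>K) = (\<Union>k\<in>K. snd c ` (dom_of c \<inter> k))" by blast
    then show ?case using UN.IH by (simp add: open_UN)
  next
    case (Basis s)
    then obtain d where "d \<in> A" "s = dom_of d" by blast
    then show ?case using manifoldD(3)[OF A c] by (simp add: holo_transition_def)
  qed
qed

lemma openin_dom: "c \<in> A \<Longrightarrow> openin (atlas_topology A) (dom_of c)"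
  unfolding atlas_topology_def by (rule topology_generated_by_Basis) blast

lemma levi_bilinear:
  fixes f :: "complex^'k \<Rightarrow> real"
  assumes S: "open S" "smooth_on S f" "x \<in> S"
  shows "bilinear (levi f x)" "levi f x u u = 0"
proof -
  have l1: "linear (\<lambda>v. dd (\<lambda>y. dd f y w) x v)" for w
    by (rule linear_dd[OF smooth_on_differentiable[OF smooth_on_dd[OF S(2)] S(3)]])
  have "(\<lambda>v. dd (\<lambda>y. dd f y v) x w) = (\<lambda>v. dd (\<lambda>y. dd f y w) x v)" for w
    using dd_symmetric[OF S] by (intro ext) blast
  then have l3: "linear (\<lambda>v. dd (\<lambda>y. dd f y v) x w)" for w using l1[of w] by simp
  have l2: "linear (\<lambda>v. dd (\<lambda>y. dd f y (\<i> *s v)) x w)" for w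
    using linear_compose[OF bounded_linear.linear[OF bounded_linear_i] l3[of w]] by (simp add: o_def)
  show "bilinear (levi f x)"
    unfolding bilinear_def levi_def
    by (intro conjI allI linear_compose_scale_right linear_compose_sub l1 l2)
  show "levi f x u u = 0" by (simp add: levi_def)
qed

context hamiltonian_bundle
begin

text \<open>The point over \<open>y\<close> with fibre coordinates \<open>1\<close>; a section of a line bundle is determined by its
  values at these points.\<close>

definition unit_pt :: "('b, 'm) chart \<Rightarrow> ('a \<Rightarrow> complex^'n) \<Rightarrow> complex^'m \<Rightarrow> 'a" where
  "unit_pt c z y = chart_inv (bchart c z) (join (\<chi> j. 1) y)"

text \<open>The point of the level set is obtained from the unit point by the action of its own fibre
  coordinate \<open>z\<close>, which multiplies sections by \<open>1/z\<^sub>i\<close> and the metric by \<open>|z\<^sub>i|\<close> to the power \<open>-2\<close>.\<close>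

lemma hermitian_section:
  assumes g: "trivial_over c z" and l: "l \<in> \<Lambda>" and y: "y \<in> img_of c" "chart_inv c y \<in> U"
    and s: "line_section M act \<pi> i U s" and t: "line_section M act \<pi> i U t"
  shows "hermitian M \<pi> \<Phi> l s t (chart_inv c y) =
    complex_of_real (exp (- 2 * log_radius c z l y $ i)) *
        (s (unit_pt c z y) * cnj (t (unit_pt c z y)))"
proof -
  let ?q = "unit_pt c z y" and ?p = "level_pt l (chart_inv c y)"
  note w = inv_into_into[OF y(1)]
  note p = level_pt[OF l dom_points[OF g l w]]
  have j: "(join (\<chi> j. 1) y :: complex^('n + 'm)) $ Inl j \<noteq> 0" for j by simp
  have by': "base (join (\<chi> j. 1) y :: complex^('n + 'm)) \<in> img_of c" using y by simp
  note q = inv_bchart[OF g, of "join (\<chi> j. 1) y", folded unit_pt_def, OF j by']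
  have nz: "z ?p $ j \<noteq> 0" for j by (rule z_nonzero[OF g p(3)]) (simp add: p(2) w)
  then have a: "z ?p \<in> complex_torus" by (simp add: complex_torus_def)
  have qM: "?q \<in> points M" "\<pi> ?q = chart_inv c y" using q by (simp_all add: dom_bchart)
  have "act (z ?p) ?q = ?p"
    by (rule act_unique[OF g a]) (use q p qM w in \<open>simp_all add: vec_eq_iff\<close>)
  moreover have "r (act (z ?p) ?q) = inverse (z ?p $ i) * r ?q" if "line_section M act \<pi> i U r" for r
    using that a qM y(2) by (simp add: line_section_def)
  ultimately have "s ?p = inverse (z ?p $ i) * s ?q" "t ?p = inverse (z ?p $ i) * t ?q" using s t
      by metis+
  then have "hermitian M \<pi> \<Phi> l s t (chart_inv c y) = (inverse (z ?p $ i) * cnj (inverse (z ?p $ i)))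
      * (s ?q * cnj (t ?q))"
    by (simp add: hermitian_def restr_level_pt)
  also have "inverse (z ?p $ i) * cnj (inverse (z ?p $ i))
      = complex_of_real ((cmod (inverse (z ?p $ i)))\<^sup>2)"
    by (rule complex_norm_square[symmetric])
  also have "(cmod (inverse (z ?p $ i)))\<^sup>2 = exp (- 2 * log_radius c z l y $ i)"
  proof -
    have "exp (- 2 * log_radius c z l y $ i) = inverse (exp (log_radius c z l y $ i)) ^ 2"
      by (simp add: exp_minus[symmetric] exp_of_nat_mult[symmetric])
    also have "exp (log_radius c z l y $ i) = cmod (z ?p $ i)" using nz by (simp add: log_radius_def)
    finally show ?thesis by (simp add: norm_inverse)
  qed
  finally show ?thesis .
qed

lemma unit_pt_section:
  assumes g: "trivial_over c z" and U: "openin (atlas_topology B) U"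
    and s: "holomorphic_function M (points M \<inter> \<pi> -` U) s" and y: "y \<in> snd c ` (dom_of c \<inter> U)"
  shows "\<exists>D. ((\<lambda>y. s (unit_pt c z y)) has_derivative D) (at y) \<and> (\<forall>a v. D (a *s v) = a * D v)"
    "unit_pt c z y \<in> points M \<inter> \<pi> -` U"
proof -
  let ?J = "\<lambda>y. join (\<chi> j. 1) y :: complex^('n + 'm)"
  have y': "y \<in> img_of c" "chart_inv c y \<in> U"
    using y chart_inv_chart[OF inj_c[OF g]] by auto
  have j: "?J y $ Inl j \<noteq> 0" for j by simp
  have by': "base (?J y) \<in> img_of c" using y' by simp
  note q = inv_bchart[OF g, of "?J y", folded unit_pt_def, OF j by']
  show qU: "unit_pt c z y \<in> points M \<inter> \<pi> -` U" using q y' by (simp add: dom_bchart)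
  have "?J y \<in> snd (bchart c z) ` (dom_of (bchart c z) \<inter> (points M \<inter> \<pi> -` U))"
    using q(1,2) qU by (metis IntI imageI)
  then obtain D where D: "((s \<circ> chart_inv (bchart c z)) has_derivative D) (at (?J y))"
      "\<And>a v. D (a *s v) = a * D v"
    using s bchart_M[OF g] unfolding holomorphic_function_def by blast
  have "linear (\<lambda>v. join 0 v :: complex^('n + 'm))" by (rule linearI) (simp_all add: sum_vec_eq_iff)
  then have "((\<lambda>y. join 0 y + ?J 0) has_derivative (\<lambda>v. join 0 v)) (at y)"
    by (intro has_derivative_add_const bounded_linear_imp_has_derivative)
        (simp add: linear_conv_bounded_linear)
  then have "(?J has_derivative (\<lambda>v. join 0 v)) (at y)" by (simp add: join_add)
  from has_derivative_compose[OF this D(1)]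
  have "((\<lambda>y. s (unit_pt c z y)) has_derivative (\<lambda>v. D (join 0 v))) (at y)" by (simp add: unit_pt_def)
  moreover have "D (join 0 (a *s v)) = a * D (join 0 v)" for a v
    using D(2)[of a "join 0 v"] by (simp add: join_scalar)
  ultimately show "\<exists>D. ((\<lambda>y. s (unit_pt c z y)) has_derivative D) (at y) \<and> (\<forall>a v. D (a *s v) = a * D v)"
    by blast
qed

lemma smooth_log_radius_nth: "trivial_over c z \<Longrightarrow> l \<in> \<Lambda>
    \<Longrightarrow> smooth_on (img_of c) (\<lambda>y. log_radius c z l y $ i)"
  by (rule smooth_on_vec_nth[OF open_img_c smooth_log_radius])

abbreviation log_norm_sq :: "real^'n \<Rightarrow> ('a \<Rightarrow> complex) \<Rightarrow> 'b \<Rightarrow> real" where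
  "log_norm_sq l s w \<equiv> ln (Re (hermitian M \<pi> \<Phi> l s s w))"

text \<open>The sections by which the curvature form is defined.\<close>

definition local_frame :: "'n \<Rightarrow> 'b set \<Rightarrow> ('a \<Rightarrow> complex) \<Rightarrow> bool" where
  "local_frame i U s \<longleftrightarrow> openin (atlas_topology B) U \<and> line_section M act \<pi> i U s \<and>
     holomorphic_function M (points M \<inter> \<pi> -` U) s \<and> (\<forall>p\<in>points M \<inter> \<pi> -` U. s p \<noteq> 0)"

text \<open>The norm is \<open>exp (- 2 \<sigma>\<^sub>i) |g|\<^sup>2\<close> with \<open>g\<close> holomorphic, and \<open>log |g|\<^sup>2\<close> is pluriharmonic. So the
  curvature is the Levi form of \<open>2 \<sigma>\<^sub>i\<close> for each local frame.\<close>

lemma levi_log_norm_sq: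
  assumes g: "trivial_over c z" and l: "l \<in> \<Lambda>" and s: "local_frame i U s"
  shows "open (snd c ` (dom_of c \<inter> U))" "smooth_on (snd c ` (dom_of c \<inter> U))
      (log_norm_sq l s \<circ> chart_inv c)"
    "y \<in> snd c ` (dom_of c \<inter> U) \<Longrightarrow>
      levi (log_norm_sq l s \<circ> chart_inv c) y u v = - 2 * levi (\<lambda>y. log_radius c z l y $ i) y u v"
proof -
  let ?N = "snd c ` (dom_of c \<inter> U)"
  have s': "openin (atlas_topology B) U" "line_section M act \<pi> i U s"
      "holomorphic_function M (points M \<inter> \<pi> -` U) s"
    "\<And>p. p \<in> points M \<inter> \<pi> -` U \<Longrightarrow> s p \<noteq> 0"
    using s by (auto simp: local_frame_def)
  show oN: "open ?N" by (rule openin_atlas[OF manifold_B c_B[OF g] s'(1)])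
  define G where "G y = s (unit_pt c z y)" for y
  have holo: "\<exists>D. (G has_derivative D) (at y) \<and> (\<forall>a v. D (a *s v) = a * D v)" if "y \<in> ?N" for y
    unfolding G_def[abs_def] by (rule unit_pt_section(1)[OF g s'(1,3) that])
  have nz: "G y \<noteq> 0" if "y \<in> ?N" for y
    unfolding G_def by (rule s'(4)[OF unit_pt_section(2)[OF g s'(1,3) that]])
  have sN: "smooth_on ?N (\<lambda>y. log_radius c z l y $ i)"
    by (rule smooth_on_subset[OF smooth_log_radius_nth[OF g l]]) auto
  have s1: "smooth_on ?N (\<lambda>y. ln (Re (G y * cnj (G y))))" if "y \<in> ?N" for y
    by (rule levi_ln_norm_holo(1)[OF oN that holo nz])
  have sm: "smooth_on ?N (\<lambda>y. ln (Re (G y * cnj (G y))) - 2 * log_radius c z l y $ i)"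
  proof (cases "?N = {}")
    case True then show ?thesis by (intro smooth_on_local) blast
  next
    case False
    then obtain y where "y \<in> ?N" by blast
    then show ?thesis by (intro smooth_intros oN sN s1)
  qed
  have eq: "ln (Re (G y * cnj (G y))) - 2 * log_radius c z l y $ i = (log_norm_sq l s \<circ> chart_inv c)
      y" if y: "y \<in> ?N" for y
  proof -
    have y': "y \<in> img_of c" "chart_inv c y \<in> U"
      using y chart_inv_chart[OF inj_c[OF g]] by auto
    have pos: "Re (G y * cnj (G y)) > 0"
      using nz[OF y] by (simp add: complex_eq_iff sum_power2_gt_zero_iff flip: power2_eq_square)
    have "(log_norm_sq l s \<circ> chart_inv c) y
        = ln (exp (- 2 * log_radius c z l y $ i) * Re (G y * cnj (G y)))"
      unfolding o_def hermitian_section[OF g l y' s'(2) s'(2)] G_def[symmetric]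
      by (simp only: times_complex.sel Re_complex_of_real Im_complex_of_real mult_zero_left
          diff_0_right)
    also have "\<dots> = - 2 * log_radius c z l y $ i + ln (Re (G y * cnj (G y)))"
      by (simp only: ln_mult_pos[OF exp_gt_zero pos] ln_exp)
    finally show ?thesis by simp
  qed
  show "smooth_on ?N (log_norm_sq l s \<circ> chart_inv c)" by (rule smooth_on_eq[OF oN eq sm])
  assume y: "y \<in> ?N"
  have "levi (log_norm_sq l s \<circ> chart_inv c) y u v
      = levi (\<lambda>y. ln (Re (G y * cnj (G y))) - 2 * log_radius c z l y $ i) y u v"
    by (rule levi_eq_open[OF oN y eq[symmetric]])
  also have "\<dots> = levi (\<lambda>y. ln (Re (G y * cnj (G y)))) y u v - levi (\<lambda>y. 2 * log_radius c z l y $ i)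
      y u v"
    by (rule levi_diff[OF oN s1[OF y] _ y]) (intro smooth_intros oN sN)
  also have "levi (\<lambda>y. ln (Re (G y * cnj (G y)))) y u v = 0"
      by (rule levi_ln_norm_holo(2)[OF oN y holo nz])
  also have "levi (\<lambda>y. 2 * log_radius c z l y $ i) y u v = 2 * levi (\<lambda>y. log_radius c z l y $ i) y u v"
    by (rule levi_cmult[OF oN sN y])
  finally show "levi (log_norm_sq l s \<circ> chart_inv c) y u v = - 2 * levi (\<lambda>y. log_radius c z l y $ i)
      y u v" by (simp add: o_def)
qed

lemma local_frame_inverse:
  assumes g: "trivial_over c z" shows "local_frame i (dom_of c) (\<lambda>p. inverse (z p $ i))"
  unfolding local_frame_def
proof (intro conjI)
  show "openin (atlas_topology B) (dom_of c)" by (rule openin_dom[OF c_B[OF g]])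
  show "line_section M act \<pi> i (dom_of c) (\<lambda>p. inverse (z p $ i))"
    using z_act[OF g] by (simp add: line_section_def)
  show "\<forall>p\<in>points M \<inter> \<pi> -` dom_of c. inverse (z p $ i) \<noteq> 0"
    using z_nonzero[OF g] by simp
  show "holomorphic_function M (points M \<inter> \<pi> -` dom_of c) (\<lambda>p. inverse (z p $ i))"
    unfolding holomorphic_function_def
  proof (intro ballI)
    let ?b = "bchart c z"
    fix d x assume d: "d \<in> M" and "x \<in> snd d ` (dom_of d \<inter> (points M \<inter> \<pi> -` dom_of c))"
    then obtain p where p: "p \<in> dom_of d" "p \<in> dom_of ?b" and x: "x = snd d p"
        by (auto simp: dom_bchart)
    note t = transition_differentiable[OF manifold_M d bchart_M[OF g] p]
    let ?h = "snd ?b \<circ> chart_inv d" and ?N = "snd d ` (dom_of d \<inter> dom_of ?b)"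
    obtain D where D: "(?h has_derivative D) (at x)" "\<And>a v. D (a *s v) = a *s D v"
      using t(2,4) unfolding holo_on_def x by blast
    have hx: "?h x = snd ?b p" using manifoldD(1)[OF manifold_M d] p by (simp add: x)
    have nz: "?h x $ Inl i \<noteq> 0"
      unfolding hx snd_bchart using z_nonzero[OF g] p by (simp add: dom_bchart)
    have "((\<lambda>x. inverse (?h x $ Inl i)) has_derivative
        (\<lambda>v. - (inverse (?h x $ Inl i) * (D v $ Inl i) * inverse (?h x $ Inl i)))) (at x)"
      by (rule Deriv.has_derivative_inverse[OF nz
          bounded_linear.has_derivative[OF bounded_linear_vec_nth D(1)]])
    moreover have "inverse (?h y $ Inl i) = ((\<lambda>p. inverse (z p $ i)) \<circ> chart_inv d) y" for y
      by (simp add: snd_bchart)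
    ultimately have "(((\<lambda>p. inverse (z p $ i)) \<circ> chart_inv d) has_derivative
        (\<lambda>v. - (inverse (?h x $ Inl i) * (D v $ Inl i) * inverse (?h x $ Inl i)))) (at x)"
      by (simp only: o_def)
    then show "\<exists>D. (((\<lambda>p. inverse (z p $ i)) \<circ> chart_inv d) has_derivative D) (at x)
        \<and> (\<forall>a v. D (a *s v) = a * D v)"
      using D(2) by (intro exI conjI) auto
  qed
qed

lemma trivializes_at_self: "trivial_over c z \<Longrightarrow> x \<in> img_of c \<Longrightarrow> trivializes_at c x (c, z)"
  by (simp add: trivializes_at_def)

lemma deldelbar_log_norm_sq:
  assumes c: "c \<in> B" and sb: "trivializes_at c x0 (c', z)" and y: "y \<in> img_of c'" and
      U: "chart_inv c' y \<in> U"
    and l: "l \<in> \<Lambda>" and s: "local_frame i U s"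
  shows "- \<i> * deldelbar (\<lambda>w. complex_of_real (log_norm_sq l s w)) c y u v =
    complex_of_real (2 * levi (\<lambda>y. log_radius c' z l y $ i) y u v)"
proof -
  have g: "trivial_over c' z" "snd c' = snd c" using sb by (auto simp: trivializes_at_def)
  note L = levi_log_norm_sq[OF g(1) l s]
  let ?N = "snd c' ` (dom_of c' \<inter> U)"
  have yN: "y \<in> ?N" 
    by (rule image_eqI[of _ _ "chart_inv c' y"]) (use U inv_into_into[OF y] f_inv_into_f[OF y] in auto)
  have eq: "(log_norm_sq l s \<circ> chart_inv c') x = (log_norm_sq l s \<circ> chart_inv c) x" if "x \<in> ?N" for x
    using trivializes_at_inv(1)[OF c sb, of x] that by auto
  have sm: "smooth_on ?N (log_norm_sq l s \<circ> chart_inv c)" by (rule smooth_on_eq[OF L(1) eq L(2)])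
  have "\<i> * deldelbar (\<lambda>w. complex_of_real (log_norm_sq l s w)) c y u v
      = complex_of_real (levi (log_norm_sq l s \<circ> chart_inv c) y u v)"
    by (rule deldelbar_of_real[OF L(1) sm yN])
  also have "levi (log_norm_sq l s \<circ> chart_inv c) y u v = levi (log_norm_sq l s \<circ> chart_inv c') y u v"
    by (rule levi_eq_open[OF L(1) yN eq[symmetric]])
  also have "\<dots> = - 2 * levi (\<lambda>y. log_radius c' z l y $ i) y u v" by (rule L(3)[OF yN])
  finally show ?thesis by simp
qed

lemma curvature_form_coeff:
  assumes \<eta>: "is_curvature_form M B act \<pi> \<Phi> i l \<eta>" and l: "l \<in> \<Lambda>"
    and c: "c \<in> B" and sb: "trivializes_at c x0 (c', z)" and y: "y \<in> img_of c'"
  shows "\<eta> c y u v = complex_of_real (2 * levi (\<lambda>y. log_radius c' z l y $ i) y u v)"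
proof -
  have g: "trivial_over c' z" "snd c' = snd c" "dom_of c' \<subseteq> dom_of c" using sb
      by (auto simp: trivializes_at_def)
  have w: "chart_inv c' y \<in> dom_of c'" "snd c (chart_inv c' y) = y"
    using inv_into_into[OF y] f_inv_into_f[OF y] g(2) by auto
  have "y \<in> snd c ` (dom_of c \<inter> dom_of c')" 
    by (rule image_eqI[of _ _ "chart_inv c' y"]) (use w g(3) in auto)
  then have "\<eta> c y u v = - \<i> * deldelbar (\<lambda>w. complex_of_real
      (log_norm_sq l (\<lambda>p. inverse (z p $ i)) w)) c y u v"
    using \<eta> local_frame_inverse[OF g(1), of i] c unfolding is_curvature_form_def local_frame_def
        by blast
  also have "\<dots> = complex_of_real (2 * levi (\<lambda>y. log_radius c' z l y $ i) y u v)"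
    by (rule deldelbar_log_norm_sq[OF c sb y w(1) l local_frame_inverse[OF g(1)]])
  finally show ?thesis .
qed

text \<open>Glued from the local expressions \<open>2 i \<partial>\<partial>\<close>-bar \<open>\<sigma>\<^sub>i\<close>; near each point they agree for all
  trivializations, because they are the curvature computed with one and the same local frame.\<close>

definition glued_curvature :: "'n \<Rightarrow> real^'n \<Rightarrow> ('b, 'm) form2" where
  "glued_curvature i l c x u v = complex_of_real
      (2 * levi (\<lambda>y. log_radius (fst (chosen_triv c x)) (snd (chosen_triv c x)) l y $ i) x u v)"

lemma glued_curvature_log_norm_sq:
  assumes l: "l \<in> \<Lambda>" and s: "local_frame i U s" and c: "c \<in> B" and x: "x \<in> snd c ` (dom_of c \<inter> U)"
  shows "glued_curvature i l c x u v = - \<i> * deldelbar (\<lambda>w. complex_of_real (log_norm_sq l s w)) c x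
      u v"
proof -
  have xc: "x \<in> img_of c" using x by blast
  obtain c' z where q: "chosen_triv c x = (c', z)" by (cases "chosen_triv c x")
  have sb: "trivializes_at c x (c', z)" using trivializes_at_chosen_triv[OF c xc] q by simp
  then have x': "x \<in> img_of c'" unfolding trivializes_at_def fst_conv by blast
  obtain q' where q': "q' \<in> dom_of c" "q' \<in> U" "x = snd c q'" using x by blast
  then have "chart_inv c x = q'" using chart_inv_chart[OF manifoldD(1)[OF manifold_B c]] by simp
  then have "chart_inv c' x \<in> U" using trivializes_at_inv(1)[OF c sb, of x] x' q'(2) by simp
  from deldelbar_log_norm_sq[OF c sb x' this l s] show ?thesis by (simp add: glued_curvature_def q)
qed

lemma glued_curvature_local:
  assumes l: "l \<in> \<Lambda>" and c: "c \<in> B" and sb: "trivializes_at c x0 (c', z)" and y: "y \<in> img_of c'"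
  shows "glued_curvature i l c y u v = complex_of_real (2 * levi (\<lambda>y. log_radius c' z l y $ i) y u v)"
proof -
  have g: "trivial_over c' z" "snd c' = snd c" "dom_of c' \<subseteq> dom_of c" using sb
      by (auto simp: trivializes_at_def)
  have w: "chart_inv c' y \<in> dom_of c'" "snd c (chart_inv c' y) = y"
    using inv_into_into[OF y] f_inv_into_f[OF y] g(2) by auto
  have "y \<in> snd c ` (dom_of c \<inter> dom_of c')" 
    by (rule image_eqI[of _ _ "chart_inv c' y"]) (use w g(3) in auto)
  then show ?thesis
    using glued_curvature_log_norm_sq[OF l local_frame_inverse[OF g(1)] c]
        deldelbar_log_norm_sq[OF c sb y w(1) l local_frame_inverse[OF g(1)]] by metis
qed

lemma is_curvature_form_glued:
  assumes l: "l \<in> \<Lambda>" shows "is_curvature_form M B act \<pi> \<Phi> i l (glued_curvature i l)"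
  unfolding is_curvature_form_def
proof (intro conjI allI impI ballI)
  show "glued_curvature i l c x u v = - \<i> * deldelbar (\<lambda>w. complex_of_real (log_norm_sq l s w)) c x u v"
    if "openin (atlas_topology B) U \<and> line_section M act \<pi> i U s
        \<and> holomorphic_function M (points M \<inter> \<pi> -` U) s \<and>
      (\<forall>p\<in>points M \<inter> \<pi> -` U. s p \<noteq> 0)" "c \<in> B" "x \<in> snd c ` (dom_of c \<inter> U)" for U s c x u v
    by (rule glued_curvature_log_norm_sq[OF l _ that(2,3)]) (use that(1) in \<open>simp add: local_frame_def\<close>)
  show "two_form B (glued_curvature i l)"
    unfolding two_form_def
  proof (intro conjI ballI allI)
    fix c assume c: "c \<in> B"
    show "smooth_on (img_of c) (\<lambda>x. glued_curvature i l c x u v)" for u v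
    proof (rule smooth_on_local)
      fix x assume "x \<in> img_of c"
      then obtain c' z where s: "trivializes_at c x (c', z)" using trivializes_at_exists[OF c] by force
      then have g: "trivial_over c' z" "x \<in> img_of c'" by (auto simp: trivializes_at_def)
      have "smooth_on (img_of c') (\<lambda>y. complex_of_real (2 * levi (\<lambda>y. log_radius c' z l y $ i) y u v))"
        by (intro smooth_on_bounded_linear[OF bounded_linear_of_real] smooth_intros open_img_c[OF g(1)]
              smooth_on_levi smooth_log_radius_nth[OF g(1) l])
      then have "smooth_on (img_of c') (\<lambda>y. glued_curvature i l c y u v)"
        by (rule smooth_on_eq[OF open_img_c[OF g(1)], rotated])
            (simp add: glued_curvature_local[OF l c s])
      then show "\<exists>N. open N \<and> x \<in> N \<and> smooth_on N (\<lambda>y. glued_curvature i l c y u v)"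
        using g open_img_c[OF g(1)] by blast
    qed
    fix x assume x: "x \<in> img_of c"
    have s: "trivializes_at c x (chosen_triv c x)" by (rule trivializes_at_chosen_triv[OF c x])
    then have g: "trivial_over (fst (chosen_triv c x)) (snd (chosen_triv c x))"
        "x \<in> img_of (fst (chosen_triv c x))" by (auto simp: trivializes_at_def)
    note rb = levi_bilinear[OF open_img_c[OF g(1)] smooth_log_radius_nth[OF g(1) l, of i] g(2)]
    have cr: "linear (\<lambda>r. complex_of_real (2 * r))"
      by (rule bounded_linear.linear[OF bounded_linear_compose[OF bounded_linear_of_real
          bounded_linear_mult_right]])
    show "bilinear (glued_curvature i l c x)"
      using rb(1) unfolding bilinear_def glued_curvature_def
      using linear_compose[OF _ cr] by (auto simp: o_def)
    show "glued_curvature i l c x u u = 0" for u using rb(2) by (simp add: glued_curvature_def)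
  next
    fix c d p u v assume c: "c \<in> B" and d: "d \<in> B" and p: "p \<in> dom_of c \<inter> dom_of d"
    let ?x = "snd c p" and ?y = "snd d p"
    have x: "?x \<in> img_of c" "?y \<in> img_of d" using p by auto
    obtain c' z where sc: "trivializes_at c ?x (c', z)" using trivializes_at_exists[OF c x(1)] by force
    obtain d' z' where sd: "trivializes_at d ?y (d', z')" using trivializes_at_exists[OF d x(2)]
        by force
    have gc: "trivial_over c' z" "?x \<in> img_of c'" "snd c' = snd c" and gd: "trivial_over d' z'"
        "?y \<in> img_of d'" "snd d' = snd d"
      using sc sd by (auto simp: trivializes_at_def)
    have ic: "chart_inv c' ?x = p" "chart_inv d' ?y = p"
      using trivializes_at_inv(1)[OF c sc, of ?x] trivializes_at_inv(1)[OF d sd, of ?y] gc(2) gd(2) p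
        chart_inv_chart[OF manifoldD(1)[OF manifold_B c]]
            chart_inv_chart[OF manifoldD(1)[OF manifold_B d]] by auto
    have pd: "p \<in> dom_of c'" "p \<in> dom_of d'"
      using inv_into_into[OF gc(2)] inv_into_into[OF gd(2)] ic by auto
    let ?s = "\<lambda>p. inverse (z p $ i)"
    note s = local_frame_inverse[OF gc(1), of i]
    note Lc = levi_log_norm_sq[OF gc(1) l s] and Ld = levi_log_norm_sq[OF gd(1) l s]
    have xN: "?x \<in> snd c' ` (dom_of c' \<inter> dom_of c')" "?y \<in> snd d' ` (dom_of d' \<inter> dom_of c')"
      using pd by (auto simp: gc(3)[symmetric] gd(3)[symmetric])
    have "levi (log_norm_sq l ?s \<circ> chart_inv c') (snd c' p) u v =
      levi (log_norm_sq l ?s \<circ> chart_inv d') (snd d' p) (tmap c' d' id (snd c' p) u)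
          (tmap c' d' id (snd c' p) v)"
      by (rule levi_transition[OF manifold_B c_B[OF gc(1)] c_B[OF gd(1)] pd Ld(1) _ Ld(2)])
          (use xN gd(3) in simp)
    moreover have "tmap c' d' id ?x = tmap c d id ?x"
      unfolding tmap_id gd(3)
    proof (rule dd_eq_open[OF open_img_c[OF gc(1)] gc(2)])
      fix y assume "y \<in> img_of c'"
      then show "(snd d \<circ> chart_inv c') y = (snd d \<circ> chart_inv c) y"
        using trivializes_at_inv(1)[OF c sc, of y] by simp
    qed
    ultimately have "levi (\<lambda>y. log_radius c' z l y $ i) ?x u v =
        levi (\<lambda>y. log_radius d' z' l y $ i) ?y (tmap c d id ?x u) (tmap c d id ?x v)"
      using Lc(3)[OF xN(1)] Ld(3)[OF xN(2)] by (simp add: gc(3) gd(3))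
    then show "glued_curvature i l c ?x u v = glued_curvature i l d ?y (tmap c d id ?x u)
        (tmap c d id ?x v)"
      by (simp add: glued_curvature_local[OF l c sc gc(2)] glued_curvature_local[OF l d sd gd(2)])
  qed
qed

text \<open>Evaluate both metrics on the frame \<open>1/z\<^sub>i\<close>.\<close>

lemma metric_ratio_exp:
  assumes l1: "l1 \<in> \<Lambda>" and l2: "l2 \<in> \<Lambda>" and g: "trivial_over c z" and y: "y \<in> img_of c"
    and \<kappa>: "metric_ratio M B act \<pi> \<Phi> i l1 l2 \<kappa>"
  shows "ln (\<kappa> (chart_inv c y)) = 2 * log_radius c z l2 y $ i - 2 * log_radius c z l1 y $ i"
proof -
  let ?w = "chart_inv c y" and ?s = "\<lambda>p. inverse (z p $ i)"
  have w: "?w \<in> dom_of c" by (rule inv_into_into[OF y])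
  have s: "line_section M act \<pi> i {?w} ?s"
    using local_frame_inverse[OF g, of i] w unfolding local_frame_def line_section_def by blast
  have j: "(join (\<chi> j. 1) y :: complex^('n + 'm)) $ Inl j \<noteq> 0" for j by simp
  have by': "base (join (\<chi> j. 1) y :: complex^('n + 'm)) \<in> img_of c" using y by simp
  have "z (unit_pt c z y) $ i = 1"
    using inv_bchart(3)[OF g, of "join (\<chi> j. 1) y", folded unit_pt_def, OF j by'] by simp
  then have h: "hermitian M \<pi> \<Phi> l ?s ?s ?w = complex_of_real (exp (- 2 * log_radius c z l y $ i))"
      if "l \<in> \<Lambda>" for l
    using hermitian_section[OF g that y _ s s] by simp
  have "\<kappa> ?w > 0" and "hermitian M \<pi> \<Phi> l1 ?s ?s ?w = complex_of_real (\<kappa> ?w) * hermitian M \<pi> \<Phi> l2 ?s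
      ?s ?w"
    using \<kappa> s dom_points[OF g l1 w] unfolding metric_ratio_def by blast+
  then have "complex_of_real (exp (- 2 * log_radius c z l1 y $ i))
      = complex_of_real (\<kappa> ?w * exp (- 2 * log_radius c z l2 y $ i))"
    unfolding h[OF l1] h[OF l2] by simp
  then have "exp (- 2 * log_radius c z l1 y $ i) = \<kappa> ?w * exp (- 2 * log_radius c z l2 y $ i)"
    by (simp only: of_real_eq_iff)
  then have "ln (exp (- 2 * log_radius c z l1 y $ i)) = ln (\<kappa> ?w)
      + ln (exp (- 2 * log_radius c z l2 y $ i))"
    using ln_mult_pos[OF \<open>\<kappa> ?w > 0\<close> exp_gt_zero] by simp
  then show ?thesis by (simp only: ln_exp)
qed

lemma metric_ratio_exists:
  assumes l1: "l1 \<in> \<Lambda>" and l2: "l2 \<in> \<Lambda>"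
  shows "\<exists>\<kappa>. metric_ratio M B act \<pi> \<Phi> i l1 l2 \<kappa>"
proof -
  have "\<exists>k>0. \<forall>s t. line_section M act \<pi> i {w} s \<and> line_section M act \<pi> i {w} t \<longrightarrow>
           hermitian M \<pi> \<Phi> l1 s t w = complex_of_real k * hermitian M \<pi> \<Phi> l2 s t w" if w: "w \<in>
               points B" for w
  proof -
    obtain c0 where "c0 \<in> B" "w \<in> dom_of c0" using w by (auto simp: points_def)
    then obtain c z where g: "trivial_over c z" "w \<in> dom_of c" using trivial_over_nhd by blast
    let ?y = "snd c w"
    have y: "?y \<in> img_of c" and inv: "chart_inv c ?y = w"
      using g(2) chart_inv_chart[OF inj_c[OF g(1)] g(2)] by auto
    let ?k = "exp (2 * log_radius c z l2 ?y $ i - 2 * log_radius c z l1 ?y $ i)"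
    have "hermitian M \<pi> \<Phi> l1 s t w = complex_of_real ?k * hermitian M \<pi> \<Phi> l2 s t w"
      if "line_section M act \<pi> i {w} s" "line_section M act \<pi> i {w} t" for s t
    proof -
      have "exp (- 2 * log_radius c z l1 ?y $ i) = ?k * exp (- 2 * log_radius c z l2 ?y $ i)"
        by (simp flip: exp_add)
      then show ?thesis
        using hermitian_section[OF g(1) l1 y _ that, unfolded inv]
            hermitian_section[OF g(1) l2 y _ that, unfolded inv]
        by (simp only: singleton_iff of_real_mult mult.assoc)
    qed
    then show ?thesis by (intro exI[of _ ?k]) simp
  qed
  then have "\<exists>k. 0 < k \<and> (\<forall>s t. line_section M act \<pi> i {w} s \<and> line_section M act \<pi> i {w} t \<longrightarrow>
           hermitian M \<pi> \<Phi> l1 s t w = complex_of_real k * hermitian M \<pi> \<Phi> l2 s t w)" if "w \<in> points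
               B" for w
    using that by blast
  then show ?thesis unfolding metric_ratio_def by (intro bchoice) blast
qed

end

section \<open>Potentials and the Duistermaat-Heckman equation\<close>

lemma smooth_function_of_real:
  "complex_manifold A \<Longrightarrow> smooth_function A f \<Longrightarrow> c \<in> A \<Longrightarrow>
    smooth_on (img_of c) ((\<lambda>p. complex_of_real (f p)) \<circ> chart_inv c)"
  using smooth_on_bounded_linear[OF bounded_linear_of_real manifoldD(2)[of A c], of "f \<circ> chart_inv c"]
  by (simp add: smooth_function_def o_def)

text \<open>Covers \<open>\<partial> f\<close> and \<open>\<partial>\<close>-bar \<open>f\<close>: the derivative of a coordinate change commutes with \<open>i\<close>, so every
  combination of \<open>df\<close> and \<open>df \<circ> i\<close> is a form.\<close>

lemma one_form_wirtinger:
  fixes f :: "'a \<Rightarrow> real" and a b :: complex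
  assumes A: "complex_manifold A" and f: "smooth_function A f"
    and \<alpha>: "\<And>c x v. c \<in> A \<Longrightarrow> x \<in> img_of c \<Longrightarrow> \<alpha> c x v =
      a * dd ((\<lambda>p. complex_of_real (f p)) \<circ> chart_inv c) x v + b *
          dd ((\<lambda>p. complex_of_real (f p)) \<circ> chart_inv c) x (\<i> *s v)"
  shows "one_form A \<alpha>"
  unfolding one_form_def
proof (intro conjI ballI allI)
  let ?F = "\<lambda>p. complex_of_real (f p)"
  fix c assume c: "c \<in> A"
  have o: "open (img_of c)" by (rule manifoldD(2)[OF A c])
  have s: "smooth_on (img_of c) (?F \<circ> chart_inv c)" by (rule smooth_function_of_real[OF A f c])
  show "smooth_on (img_of c) (\<lambda>x. \<alpha> c x v)" for v
  proof -
    have "smooth_on (img_of c) (\<lambda>x. a * dd (?F \<circ> chart_inv c) x v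
        + b * dd (?F \<circ> chart_inv c) x (\<i> *s v))"
      by (intro smooth_intros o s)
    then show ?thesis by (rule smooth_on_eq[OF o, rotated]) (simp add: \<alpha>[OF c])
  qed
  fix x assume x: "x \<in> img_of c"
  have l: "linear (dd (?F \<circ> chart_inv c) x)" by (rule linear_dd[OF smooth_on_differentiable[OF s x]])
  have m: "linear (\<lambda>r. k * r)" for k :: complex
      by (rule bounded_linear.linear[OF bounded_linear_mult_right])
  have "linear (\<lambda>v. a * dd (?F \<circ> chart_inv c) x v + b * dd (?F \<circ> chart_inv c) x (\<i> *s v))"
    using linear_compose[OF l m[of a]] linear_compose[OF
        linear_compose[OF bounded_linear.linear[OF bounded_linear_i] l] m[of b]]
    by (intro linear_compose_add) (simp_all add: comp_def)
  moreover have "\<alpha> c x = (\<lambda>v. a * dd (?F \<circ> chart_inv c) x v + b * dd (?F \<circ> chart_inv c) x (\<i> *s v))"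
    by (rule ext) (rule \<alpha>[OF c x])
  ultimately show "linear (\<alpha> c x)" by simp
next
  let ?F = "\<lambda>p. complex_of_real (f p)"
  fix c d p v assume c: "c \<in> A" and d: "d \<in> A" and p: "p \<in> dom_of c \<inter> dom_of d"
  then have p': "p \<in> dom_of c" "p \<in> dom_of d" by auto
  have x: "snd c p \<in> img_of c" "snd d p \<in> img_of d" using p' by auto
  note t = transition_differentiable[OF A c d p']
  have df: "(?F \<circ> chart_inv d) differentiable (at (snd d p))"
    by (rule smooth_on_differentiable[OF smooth_function_of_real[OF A f d] x(2)])
  have i: "tmap c d id (snd c p) (\<i> *s v) = \<i> *s tmap c d id (snd c p) v"
    unfolding tmap_id by (rule holo_on_dd[OF t(4,2)])
  show "\<alpha> c (snd c p) v = \<alpha> d (snd d p) (tmap c d id (snd c p) v)"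
    unfolding \<alpha>[OF c x(1)] \<alpha>[OF d x(2)] dd_transition(1)[OF A c d p' df] i ..
qed

lemma one_form_del:
  assumes A: "complex_manifold A" and f: "smooth_function A (f :: 'a \<Rightarrow> real)"
  shows "one_form A (del (\<lambda>p. complex_of_real (f p)))"
  by (rule one_form_wirtinger[OF A f, where a = "1/2" and b = "- \<i>/2"])
     (simp add: del_eq smooth_on_differentiable[OF smooth_function_of_real[OF A f]] diff_divide_distrib)

lemma one_form_delbar:
  assumes A: "complex_manifold A" and f: "smooth_function A (f :: 'a \<Rightarrow> real)"
  shows "one_form A (\<lambda>c x v. \<i> * delbar (\<lambda>p. complex_of_real (f p)) c x v)"
  by (rule one_form_wirtinger[OF A f, where a = "\<i>/2" and b = "- 1/2"])
     (simp add: delbar_eq smooth_on_differentiable[OF smooth_function_of_real[OF A f]]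
         add_divide_distrib distrib_left)

lemma two_form_combination:
  assumes A: "complex_manifold A" and \<alpha>: "two_form A \<alpha>" and \<beta>: "\<And>i. two_form A (\<beta> i)"
  shows "two_form A (\<lambda>c x u v. \<alpha> c x u v + (\<Sum>i\<in>I. k i * \<beta> i c x u v))"
  unfolding two_form_def
proof (intro conjI ballI allI)
  fix c assume c: "c \<in> A"
  show "smooth_on (img_of c) (\<lambda>x. \<alpha> c x u v + (\<Sum>i\<in>I. k i * \<beta> i c x u v))" for u v
    by (intro smooth_intros manifoldD(2)[OF A c] form2_smooth[OF \<alpha> c] form2_smooth[OF \<beta> c])
  fix x assume x: "x \<in> img_of c"
  have m: "linear (\<lambda>r. k * r)" for k :: complex
      by (rule bounded_linear.linear[OF bounded_linear_mult_right])
  have 1: "linear (\<lambda>v. k i * \<beta> i c x u v)" "linear (\<lambda>v. k i * \<beta> i c x v u)" for i u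
    using linear_compose[OF form2_bilinear(1)[OF \<beta> c x] m]
        linear_compose[OF form2_bilinear(2)[OF \<beta> c x] m]
    by (simp_all add: o_def)
  show "bilinear (\<lambda>u v. \<alpha> c x u v + (\<Sum>i\<in>I. k i * \<beta> i c x u v))"
    unfolding bilinear_def
    by (intro conjI allI linear_compose_add linear_compose_sum ballI 1 form2_bilinear(1,2)[OF \<alpha> c x])
  show "\<alpha> c x u u + (\<Sum>i\<in>I. k i * \<beta> i c x u u) = 0" for u
    by (simp add: form2_bilinear(3)[OF \<alpha> c x] form2_bilinear(3)[OF \<beta> c x])
next
  fix c d p u v assume c: "c \<in> A" and d: "d \<in> A" and p: "p \<in> dom_of c \<inter> dom_of d"
  then have p': "p \<in> dom_of c" "p \<in> dom_of d" by auto
  show "\<alpha> c (snd c p) u v + (\<Sum>i\<in>I. k i * \<beta> i c (snd c p) u v) =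
    \<alpha> d (snd d p) (tmap c d id (snd c p) u) (tmap c d id (snd c p) v) +
    (\<Sum>i\<in>I. k i * \<beta> i d (snd d p) (tmap c d id (snd c p) u) (tmap c d id (snd c p) v))"
    unfolding two_form_transition[OF \<alpha> c d p', of u v] two_form_transition[OF \<beta> c d p', of _ u v] ..
qed

context hamiltonian_bundle
begin

lemma smooth_function_local:
  assumes "\<And>c z. trivial_over c z \<Longrightarrow> smooth_on (img_of c) (f \<circ> chart_inv c)"
  shows "smooth_function B f"
  unfolding smooth_function_def
proof
  fix c assume c: "c \<in> B"
  show "smooth_on (img_of c) (f \<circ> chart_inv c)"
  proof (rule smooth_on_local)
    fix x assume "x \<in> img_of c"
    then obtain c' z where s: "trivializes_at c x (c', z)" using trivializes_at_exists[OF c] by force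
    then have g: "trivial_over c' z" "x \<in> img_of c'" by (auto simp: trivializes_at_def)
    have "smooth_on (img_of c') (f \<circ> chart_inv c)"
      by (rule smooth_on_eq[OF open_img_c[OF g(1)] _ assms[OF g(1)]])
          (use trivializes_at_inv(1)[OF c s] in simp)
    then show "\<exists>N. open N \<and> x \<in> N \<and> smooth_on N (f \<circ> chart_inv c)"
      using g open_img_c[OF g(1)] by blast
  qed
qed

definition real_exp :: "real^'n \<Rightarrow> complex^'n" where
  "real_exp s = (\<chi> j. complex_of_real (exp (s $ j)))"

text \<open>The difference of a fibre potential between the levels \<open>l1\<close> and \<open>l2\<close>, as the integral of
  \<open>2 \<Sum> \<phi>\<^sub>j dt\<^sub>j\<close> along the radial path from the level \<open>l2\<close> to the level \<open>l1\<close>. This expression refers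
  neither to a trivialization nor to a potential, so it is a global function on the base.\<close>

definition potential_gap :: "real^'n \<Rightarrow> real^'n \<Rightarrow> 'b \<Rightarrow> real" where
  "potential_gap l1 l2 w = (let s = SOME s. act (real_exp s) (level_pt l2 w) \<in> level M \<Phi> l1 in
     integral {0..1} (\<lambda>r. \<Sum>j\<in>UNIV. s $ j * (2 * \<Phi> (act (real_exp (r *\<^sub>R s)) (level_pt l2 w)) $ j)))"

abbreviation log_potential :: "('b, 'm) chart \<Rightarrow> ('a \<Rightarrow> complex^'n) \<Rightarrow> (complex^('n + 'm) \<Rightarrow> real)
    \<Rightarrow> bool" where
  "log_potential c z \<rho> \<equiv> log_model.fibre_potential (img_of c) (log_moment c z) \<rho>"

lemma potential_gap_potential:
  assumes g: "trivial_over c z" and l1: "l1 \<in> \<Lambda>" and l2: "l2 \<in> \<Lambda>" and y: "y \<in> img_of c" and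
      \<rho>: "log_potential c z \<rho>"
  shows "potential_gap l1 l2 (chart_inv c y) = \<rho> (graph_of (log_radius c z l1) y)
      - \<rho> (graph_of (log_radius c z l2) y)"
proof -
  interpret log_model "img_of c" "log_moment c z" "log_form c z" by (rule log_model[OF g])
  let ?b = "bchart c z" and ?w = "chart_inv c y"
  let ?p = "level_pt l2 ?w"
  have w: "?w \<in> dom_of c" "snd c ?w = y" using inv_into_into[OF y] f_inv_into_f[OF y] by auto
  note p = level_pt[OF l2 dom_points[OF g l2 w(1)]]
  have pd: "\<pi> ?p \<in> dom_of c" using p w by simp
  have nz: "z ?p $ j \<noteq> 0" for j by (rule z_nonzero[OF g p(3) pd])
  \<comment> \<open>Any logarithm of the fibre coordinates will do: potentials and moment map do not depend on the
      angles.\<close>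
  define x where "x = (join (\<chi> j. Ln (z ?p $ j)) y :: complex^('n + 'm))"
  have T: "real_exp s \<in> complex_torus" for s by (simp add: real_exp_def complex_torus_def)
  have inv: "chart_inv ?b (fibre_exp (x + r *\<^sub>R join (cvec s) 0)) = act (real_exp (r *\<^sub>R s)) ?p" for r s
  proof -
    have "snd ?b (act (real_exp (r *\<^sub>R s)) ?p) = join (real_exp (r *\<^sub>R s) * z ?p) y"
      using p pd w T by (simp add: snd_bchart z_act[OF g] \<pi>_act)
    also have "\<dots> = fibre_exp (x + r *\<^sub>R join (cvec s) 0)"
      using nz by (simp add: sum_vec_eq_iff x_def exp_add real_exp_def exp_of_real
          scaleR_conv_of_real[where 'a = complex]
          flip: of_real_mult)
    finally have e: "fibre_exp (x + r *\<^sub>R join (cvec s) 0) = snd ?b (act (real_exp (r *\<^sub>R s)) ?p)"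
        by simp
    show ?thesis unfolding e
      by (rule chart_inv_chart[OF inj_bchart[OF g]])
          (use p pd T in \<open>simp add: dom_bchart act_points \<pi>_act\<close>)
  qed
  have log_moment: "log_moment c z (x + r *\<^sub>R join (cvec s) 0) = \<Phi> (act (real_exp (r *\<^sub>R s)) ?p)"
      for r s
    by (simp add: log_moment_def[OF g] inv)
  have bx: "base (x + r *\<^sub>R join (cvec s) 0) = y" for r s
    by (simp add: linear_add[OF linear_base] linear_scale[OF linear_base] x_def)
  have r1: "real_exp 0 = 1" by (simp add: real_exp_def vec_eq_iff)
  have phx: "log_moment c z x = l2" using log_moment[of 0 0] p r1 act_one by simp
  have bx0: "base x = y" by (simp add: x_def)
  have sx: "join (cvec (\<chi> j. Re (x $ Inl j))) (base x) = graph_of (log_radius c z l2) (base x)"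
    by (rule level_graph_of[of _ x l2]) (simp_all add: bx0 y log_moment_graph_of[OF g l2] phx)
  define s where "s = (SOME s. act (real_exp s) ?p \<in> level M \<Phi> l1)"
  have "act (real_exp (log_radius c z l1 y - log_radius c z l2 y)) ?p \<in> level M \<Phi> l1"
  proof -
    let ?s = "log_radius c z l1 y - log_radius c z l2 y"
    have "Re (x $ Inl j) = log_radius c z l2 y $ j" for j
      using arg_cong[OF sx, of "\<lambda>q. Re (q $ Inl j)"] by (simp add: graph_of_def bx0)
    then have "log_moment c z (x + 1 *\<^sub>R join (cvec ?s) 0)
        = log_moment c z (graph_of (log_radius c z l1) y)"
      by (intro \<phi>_imaginary) (simp_all add: y bx[of 1, simplified] graph_of_def)
    then have "\<Phi> (act (real_exp ?s) ?p) = l1"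
      using log_moment[of 1 ?s] log_moment_graph_of[OF g l1 y] by simp
    then show ?thesis using act_points[OF T p(3)] by (simp add: level_def)
  qed
  then have "act (real_exp s) ?p \<in> level M \<Phi> l1" unfolding s_def by (rule someI)
  then have ph1: "log_moment c z (x + 1 *\<^sub>R join (cvec s) 0) = l1"
    using log_moment[of 1 s] by (simp add: level_def)
  have \<rho>s: "smooth_on (base -` img_of c) \<rho>" and d\<rho>: "\<And>x j. base x \<in> img_of c \<Longrightarrow> dd \<rho> x (vert j)
      = 2 * log_moment c z x $ j"
    "\<And>x j. base x \<in> img_of c \<Longrightarrow> dd \<rho> x (\<i> *s vert j) = 0"
    using \<rho> by (auto simp: fibre_potential_def)
  have \<rho>d: "\<rho> differentiable (at x)" if "base x \<in> img_of c" for x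
    by (rule smooth_on_differentiable[OF \<rho>s]) (simp add: that)
  have fin: "\<rho> q = \<rho> (graph_of (log_radius c z l) y)"
      if q: "base q = y" "log_moment c z q = l" and l: "l \<in> \<Lambda>" for q l
  proof -
    have E: "join (cvec (\<chi> j. Re (q $ Inl j))) (base q) = graph_of (log_radius c z l) (base q)"
      by (rule level_graph_of[of _ q l]) (simp_all add: q y log_moment_graph_of[OF g l])
    have imag: "Re (graph_of (log_radius c z l) y $ Inl j) = Re (q $ Inl j)" for j
      using arg_cong[OF E, of "\<lambda>t. Re (t $ Inl j)"] by (simp add: q(1))
    have "\<rho> (graph_of (log_radius c z l) y) = \<rho> q"
      by (rule const_along_imaginary[OF _ _ imag \<rho>d d\<rho>(2)]) (simp_all add: q y)
    then show ?thesis by simp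
  qed
  let ?v = "join (cvec s) 0 :: complex^('n + 'm)"
  have "((\<lambda>r. \<rho> (x + r *\<^sub>R ?v)) has_vector_derivative
      (\<Sum>j\<in>UNIV. s $ j * (2 * \<Phi> (act (real_exp (r *\<^sub>R s)) ?p) $ j))) (at r within {0..1})" for r
  proof -
    have b: "base (x + r *\<^sub>R ?v) \<in> img_of c" by (simp add: bx y)
    have "dd \<rho> (x + r *\<^sub>R ?v) ?v = (\<Sum>j\<in>UNIV. s $ j * (2 * \<Phi> (act (real_exp (r *\<^sub>R s)) ?p) $ j))"
      using linear_vertical[OF linear_dd[OF \<rho>d[OF b]], of "cvec s"] by (simp add: d\<rho>[OF b] log_moment)
    then show ?thesis using has_vector_derivative_at_within[OF dd_line[OF \<rho>d[OF b]]] by simp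
  qed
  then have "((\<lambda>r. \<Sum>j\<in>UNIV. s $ j * (2 * \<Phi> (act (real_exp (r *\<^sub>R s)) ?p) $ j)) has_integral
      (\<rho> (x + 1 *\<^sub>R ?v) - \<rho> (x + 0 *\<^sub>R ?v))) {0..1}"
    by (intro fundamental_theorem_of_calculus) auto
  then have "potential_gap l1 l2 ?w = \<rho> (x + 1 *\<^sub>R ?v) - \<rho> (x + 0 *\<^sub>R ?v)"
    unfolding potential_gap_def Let_def s_def[symmetric] by (rule integral_unique)
  also have "\<rho> (x + 1 *\<^sub>R ?v) = \<rho> (graph_of (log_radius c z l1) y)" by (rule fin[OF bx ph1 l1])
  also have "\<rho> (x + 0 *\<^sub>R ?v) = \<rho> (graph_of (log_radius c z l2) y)"
    by (rule fin[OF bx _ l2]) (simp add: phx)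
  finally show ?thesis .
qed

lemma smooth_potential_on_graph:
  assumes g: "trivial_over c z" and l: "l \<in> \<Lambda>" and \<rho>: "log_potential c z \<rho>"
  shows "smooth_on (img_of c) (\<lambda>y. \<rho> (graph_of (log_radius c z l) y))"
proof -
  interpret log_model "img_of c" "log_moment c z" "log_form c z" by (rule log_model[OF g])
  show ?thesis
    by (rule smooth_on_compose[OF open_img_c[OF g] open_\<Omega> _
        smooth_on_graph_of[OF open_img_c[OF g] smooth_log_radius[OF g l]]])
       (use \<rho> in \<open>auto simp: fibre_potential_def\<close>)
qed

lemma smooth_potential_gap: "l1 \<in> \<Lambda> \<Longrightarrow> l2 \<in> \<Lambda> \<Longrightarrow> smooth_function B (potential_gap l1 l2)"
proof (rule smooth_function_local)
  fix c z assume l: "l1 \<in> \<Lambda>" "l2 \<in> \<Lambda>" and g: "trivial_over c z"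
  obtain \<rho> where \<rho>: "log_potential c z \<rho>" using log_model.fibre_potential_exists[OF log_model[OF g]]
      by blast
  have "smooth_on (img_of c) (\<lambda>y. \<rho> (graph_of (log_radius c z l1) y)
      - \<rho> (graph_of (log_radius c z l2) y))"
    by (intro smooth_intros open_img_c[OF g] smooth_potential_on_graph[OF g _ \<rho>] l)
  then show "smooth_on (img_of c) (potential_gap l1 l2 \<circ> chart_inv c)"
    by (rule smooth_on_eq[OF open_img_c[OF g], rotated]) (simp add: potential_gap_potential[OF g l _ \<rho>])
qed

lemma smooth_metric_ratio:
  assumes l: "l1 \<in> \<Lambda>" "l2 \<in> \<Lambda>" and \<kappa>: "metric_ratio M B act \<pi> \<Phi> i l1 l2 \<kappa>"
  shows "smooth_function B (\<lambda>w. ln (\<kappa> w))"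
proof (rule smooth_function_local)
  fix c z assume g: "trivial_over c z"
  have "smooth_on (img_of c) (\<lambda>y. 2 * log_radius c z l2 y $ i - 2 * log_radius c z l1 y $ i)"
    by (intro smooth_intros open_img_c[OF g] smooth_log_radius_nth[OF g] l)
  then show "smooth_on (img_of c) ((\<lambda>w. ln (\<kappa> w)) \<circ> chart_inv c)"
    by (rule smooth_on_eq[OF open_img_c[OF g], rotated]) (simp add: metric_ratio_exp[OF l g _ \<kappa>])
qed

text \<open>In logarithmic coordinates an admissible potential is a fibre potential for which \<open>\<beta> = 0\<close>.\<close>

lemma admissible_log_potential:
  assumes g: "trivial_over c z" and ad: "admissible_potential M act \<pi> \<omega> \<Phi> c z r"
  defines "\<rho> \<equiv> \<lambda>x. (r \<circ> chart_inv (bchart c z)) (fibre_exp x)"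
  shows "log_potential c z \<rho>" "base x \<in> img_of c \<Longrightarrow> log_form c z x u v = levi \<rho> x u v"
proof -
  interpret log_model "img_of c" "log_moment c z" "log_form c z" by (rule log_model[OF g])
  let ?b = "bchart c z"
  let ?r = "r \<circ> chart_inv ?b"
  have sr: "smooth_on (img_of ?b) ?r"
    and om: "\<And>x u v. x \<in> img_of ?b \<Longrightarrow> \<omega> ?b x u v = \<i> * deldelbar (\<lambda>p. complex_of_real (r p)) ?b x u v"
    and mo: "\<And>p j. p \<in> dom_of ?b \<Longrightarrow> complex_of_real (\<Phi> p $ j) =
        z p $ j * dz (Inl j) ((\<lambda>p. complex_of_real (r p)) \<circ> chart_inv ?b) (snd ?b p)"
    using ad unfolding admissible_potential_def Let_def by blast+
  have cs: "fibre_exp ` \<Omega> \<subseteq> img_of ?b" using fibre_exp_img[OF g] by auto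
  have scx: "smooth_on \<Omega> fibre_exp" by (rule smooth_on_subset[OF smooth_on_fibre_exp]) simp
  have s: "smooth_on \<Omega> \<rho>"
    unfolding \<rho>_def by (rule smooth_on_compose[OF open_\<Omega> open_img_bchart[OF g] cs scx sr])
  have fibre: "dd ?r (snd ?b p) (axis (Inl j) (z p $ j)) = 2 * \<Phi> p $ j
      \<and> dd ?r (snd ?b p) (axis (Inl j) (\<i> * z p $ j)) = 0"
    if p: "p \<in> dom_of ?b" for p j
  proof -
    have "snd ?b p \<in> img_of ?b" using p by blast
    then have d: "?r differentiable (at (snd ?b p))" by (rule smooth_on_differentiable[OF sr])
    have lin: "linear (dd ?r (snd ?b p))" by (rule linear_dd[OF d])
    let ?A = "dd ?r (snd ?b p) (axis (Inl j) 1)" and ?B = "dd ?r (snd ?b p) (axis (Inl j) \<i>)"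
    have ax: "dd ?r (snd ?b p) (axis (Inl j) a) = Re a * ?A + Im a * ?B" for a
    proof -
      have "axis (Inl j) a = Re a *\<^sub>R axis (Inl j) 1 + Im a *\<^sub>R (axis (Inl j) \<i> :: complex^('n + 'm))"
        by (simp add: vec_eq_iff axis_def complex_eq_iff)
      then show ?thesis by (simp add: linear_add[OF lin] linear_scale[OF lin])
    qed
    have c: "dd ((\<lambda>p. complex_of_real (r p)) \<circ> chart_inv ?b) (snd ?b p) v
        = complex_of_real (dd ?r (snd ?b p) v)" for v
      using dd_bounded_linear[OF bounded_linear_of_real d] by (simp add: o_def)
    have "complex_of_real (\<Phi> p $ j) = z p $ j * ((complex_of_real ?A - \<i> * complex_of_real ?B) / 2)"
      unfolding mo[OF p] dz_def c ..
    then have "2 * complex_of_real (\<Phi> p $ j) = z p $ j * (complex_of_real ?A - \<i> * complex_of_real ?B)"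
      by (simp add: mult.commute[of _ 2])
    from arg_cong[OF this, of Re] arg_cong[OF this, of Im]
    show ?thesis unfolding ax[of "z p $ j"] ax[of "\<i> * z p $ j"] by simp
  qed
  have "dd \<rho> x (vert j) = 2 * log_moment c z x $ j \<and> dd \<rho> x (\<i> *s vert j) = 0"
      if x: "base x \<in> img_of c" for x j
  proof -
    let ?p = "chart_inv ?b (fibre_exp x)"
    note q = inv_fibre_exp[OF g x]
    have d: "dd \<rho> x v = dd ?r (fibre_exp x) (dd fibre_exp x v)" for v
      unfolding \<rho>_def
      by (rule dd_compose[OF fibre_exp_differentiable
          smooth_on_differentiable[OF sr fibre_exp_img[OF g x]]])
    have "dd fibre_exp x (vert j) = axis (Inl j) (z ?p $ j)" "dd fibre_exp x (\<i> *s vert j)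
        = axis (Inl j) (\<i> * z ?p $ j)"
      unfolding dd_fibre_exp q(3) by (simp_all add: sum_vec_eq_iff axis_def)
    then show ?thesis using fibre[OF q(1), of j] by (simp add: d q(2) log_moment_def[OF g])
  qed
  then show "log_potential c z \<rho>" using s by (simp add: fibre_potential_def)
  assume x: "base x \<in> img_of c"
  have cx: "fibre_exp x \<in> img_of ?b" by (rule fibre_exp_img[OF g x])
  have "log_form c z x u v = levi ?r (fibre_exp x) (dd fibre_exp x u) (dd fibre_exp x v)"
    unfolding log_form_def[OF g] om[OF cx] deldelbar_of_real[OF open_img_bchart[OF g] sr cx] by simp
  also have "\<dots> = levi \<rho> x u v"
    unfolding \<rho>_def
    by (rule levi_compose_holo[OF open_\<Omega> _ holo_on_fibre_exp open_img_bchart[OF g] cs sr,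
        symmetric]) (use x in simp)
  finally show "log_form c z x u v = levi \<rho> x u v" .
qed

text \<open>In \<open>graph_form_decomposition\<close> the sum over \<open>j\<close> is the combination of curvature forms.\<close>

lemma duistermaat_heckman_local:
  assumes graph_form: "is_reduced_form M B \<pi> \<omega> \<Phi> l \<sigma>" and cur: "\<And>i. is_curvature_form M B act \<pi> \<Phi> i
      l (\<eta> i)"
    and l: "l \<in> \<Lambda>" and c: "c \<in> B" and sb: "trivializes_at c x0 (c', z)" and y: "y \<in> img_of c'" and
        \<rho>: "log_potential c' z \<rho>"
  shows "\<sigma> c y u v + (\<Sum>i\<in>UNIV. complex_of_real (l $ i) * \<eta> i c y u v) =
    complex_of_real (log_model.basic_part (log_form c' z) \<rho> (join 0 y) (join 0 u) (join 0 v)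
      + levi (\<lambda>y. \<rho> (graph_of (log_radius c' z l) y)) y u v)"
proof -
  have g: "trivial_over c' z" "snd c' = snd c" "dom_of c' \<subseteq> dom_of c" using sb
      by (auto simp: trivializes_at_def)
  interpret log_model "img_of c'" "log_moment c' z" "log_form c' z" by (rule log_model[OF g(1)])
  have "\<sigma> c y u v = complex_of_real (graph_form (log_radius c' z l) y u v)"
    using reduced_form_coeff[OF graph_form g(1) l c g(2,3) y] by (simp add: reduced_coeff_def)
  moreover have "(\<Sum>i\<in>UNIV. complex_of_real (l $ i) * \<eta> i c y u v) =
      complex_of_real (\<Sum>i\<in>UNIV. 2 * l $ i * levi (\<lambda>y. log_radius c' z l y $ i) y u v)"
    by (simp add: curvature_form_coeff[OF cur l c sb y] mult_ac)
  ultimately show ?thesis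
    by (simp add: graph_form_decomposition[OF log_moment_graph_of[OF g(1) l] \<rho> y])
qed

lemma is_reduced_form_reduced_form: "l \<in> \<Lambda> \<Longrightarrow> is_reduced_form M B \<pi> \<omega> \<Phi> l (reduced_form M B \<pi> \<omega> \<Phi> l)"
  unfolding reduced_form_def by (rule someI[of "is_reduced_form M B \<pi> \<omega> \<Phi> l"
      "glued_reduced_form l"]) (rule is_reduced_form_glued)

lemma is_curvature_form_curvature_form: "l \<in> \<Lambda> \<Longrightarrow> is_curvature_form M B act \<pi> \<Phi> i l
    (curvature_form M B act \<pi> \<Phi> i l)"
  unfolding curvature_form_def by (rule someI[of "is_curvature_form M B act \<pi> \<Phi> i l"
      "glued_curvature i l"]) (rule is_curvature_form_glued)

text \<open>Defined by the Duistermaat-Heckman equation, hence global; the description by potentials is then a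
  local computation.\<close>

definition \<mu> :: "real^'n \<Rightarrow> ('b, 'm) form2" where
  "\<mu> l = (\<lambda>c x u v. reduced_form M B \<pi> \<omega> \<Phi> l c x u v +
     (\<Sum>i\<in>UNIV. complex_of_real (l $ i) * curvature_form M B act \<pi> \<Phi> i l c x u v))"

definition \<nu> :: "real^'n \<Rightarrow> real^'n \<Rightarrow> ('b, 'm) form1" where
  "\<nu> l1 l2 = (\<lambda>c x v. \<i> * delbar (\<lambda>w. complex_of_real (potential_gap l1 l2 w)) c x v)"

lemma \<mu>_potential:
  assumes l: "l \<in> \<Lambda>" and c: "c \<in> B" and sb: "trivializes_at c x0 (c', z)" and y: "y \<in> img_of c'" and
      \<rho>: "log_potential c' z \<rho>"
  shows "\<mu> l c y u v = complex_of_real (log_model.basic_part (log_form c' z) \<rho> (join 0 y) (join 0 u)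
      (join 0 v)
      + levi (\<lambda>y. \<rho> (graph_of (log_radius c' z l) y)) y u v)"
  unfolding \<mu>_def by (rule duistermaat_heckman_local[OF is_reduced_form_reduced_form[OF l]
      is_curvature_form_curvature_form[OF l] l c sb y \<rho>])

lemma two_form_\<mu>: "l \<in> \<Lambda> \<Longrightarrow> two_form B (\<mu> l)"
  unfolding \<mu>_def
  using is_reduced_form_reduced_form is_curvature_form_curvature_form
  by (intro two_form_combination[OF manifold_B]) (auto simp: is_reduced_form_def is_curvature_form_def)

lemma one_form_\<nu>: "l1 \<in> \<Lambda> \<Longrightarrow> l2 \<in> \<Lambda> \<Longrightarrow> one_form B (\<nu> l1 l2)"
  unfolding \<nu>_def by (rule one_form_delbar[OF manifold_B smooth_potential_gap])

text \<open>For a fibre potential \<open>\<rho>\<close> the form \<open>\<beta>\<close> is common to both levels, so only the Levi form of the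
  difference of \<open>\<rho>\<close> along the two graphs remains.\<close>

lemma \<mu>_difference:
  assumes l: "l1 \<in> \<Lambda>" "l2 \<in> \<Lambda>"
  shows "form2_eq B (\<lambda>c x u v. \<mu> l1 c x u v - \<mu> l2 c x u v) (ext_d (\<nu> l1 l2))"
  unfolding form2_eq_def
proof (intro ballI allI)
  fix c x u v assume c: "c \<in> B" and x: "x \<in> img_of c"
  obtain c' z where sb: "trivializes_at c x (c', z)" using trivializes_at_exists[OF c x] by force
  then have g: "trivial_over c' z" "x \<in> img_of c'" by (auto simp: trivializes_at_def)
  obtain \<rho> where \<rho>: "log_potential c' z \<rho>"
      using log_model.fibre_potential_exists[OF log_model[OF g(1)]] by blast
  note oc = manifoldD(2)[OF manifold_B c] and oc' = open_img_c[OF g(1)]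
  note s = smooth_potential_on_graph[OF g(1) l(1) \<rho>] smooth_potential_on_graph[OF g(1) l(2) \<rho>]
  have f: "smooth_on (img_of c) (potential_gap l1 l2 \<circ> chart_inv c)"
      using smooth_potential_gap[OF l] c by (simp add: smooth_function_def)
  have "ext_d (\<nu> l1 l2) c x u v = levi ((\<lambda>w. complex_of_real (potential_gap l1 l2 w)) \<circ> chart_inv c)
      x u v"
    unfolding \<nu>_def by (rule ext_d_delbar[OF oc
        smooth_function_of_real[OF manifold_B smooth_potential_gap[OF l] c] x])
  also have "\<dots> = complex_of_real (levi (potential_gap l1 l2 \<circ> chart_inv c) x u v)"
    using levi_of_real[OF oc f x] by (simp add: o_def)
  also have "levi (potential_gap l1 l2 \<circ> chart_inv c) x u v
      = levi (\<lambda>y. \<rho> (graph_of (log_radius c' z l1) y) - \<rho> (graph_of (log_radius c' z l2) y)) x u v"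
    by (rule levi_eq_open[OF oc' g(2)]) (use trivializes_at_inv(1)[OF c sb]
        potential_gap_potential[OF g(1) l _ \<rho>] in simp)
  also have "\<dots> = levi (\<lambda>y. \<rho> (graph_of (log_radius c' z l1) y)) x u v
      - levi (\<lambda>y. \<rho> (graph_of (log_radius c' z l2) y)) x u v"
    by (rule levi_diff[OF oc' s g(2)])
  finally show "\<mu> l1 c x u v - \<mu> l2 c x u v = ext_d (\<nu> l1 l2) c x u v"
    by (simp add: \<mu>_potential[OF l(1) c sb g(2) \<rho>] \<mu>_potential[OF l(2) c sb g(2) \<rho>])
qed

lemma admissible_forms:
  assumes c: "c \<in> B" and t: "trivialization M act \<pi> c z" and ad: "admissible_potential M act \<pi> \<omega> \<Phi> c
      z r"
    and x: "x \<in> img_of c"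
  shows "l \<in> \<Lambda> \<Longrightarrow> \<mu> l c x u v = \<i> * deldelbar (\<lambda>w. complex_of_real (restr M \<pi> \<Phi> l r w)) c x u v"
    and "l1 \<in> \<Lambda> \<Longrightarrow> l2 \<in> \<Lambda> \<Longrightarrow> \<nu> l1 l2 c x v =
       \<i> * delbar (\<lambda>w. complex_of_real (restr M \<pi> \<Phi> l1 r w)) c x v - \<i> * delbar
           (\<lambda>w. complex_of_real (restr M \<pi> \<Phi> l2 r w)) c x v"
proof -
  have g: "trivial_over c z" using c t by (simp add: trivial_over_def)
  note oc = open_img_c[OF g]
  define \<rho> where "\<rho> x = (r \<circ> chart_inv (bchart c z)) (fibre_exp x)" for x
  note A = admissible_log_potential[OF g ad, folded \<rho>_def]
  have inv: "r (act a p) = r p" if "a \<in> compact_torus" "p \<in> dom_of (bchart c z)" for a p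
    using ad that by (simp add: admissible_potential_def Let_def)
  have rs: "(restr M \<pi> \<Phi> l r \<circ> chart_inv c) y = \<rho> (graph_of (log_radius c z l) y)"
      if "l \<in> \<Lambda>" "y \<in> img_of c" for l y
    using restr_graph_of[OF g that(1), of r, OF inv that(2)] by (simp add: \<rho>_def)
  have sm: "smooth_on (img_of c) (restr M \<pi> \<Phi> l r \<circ> chart_inv c)" if "l \<in> \<Lambda>" for l
    by (rule smooth_on_eq[OF oc _ smooth_potential_on_graph[OF g that A(1)]]) (simp only: rs[OF that])
  have basic_part: "log_model.basic_part (log_form c z) \<rho> (join 0 x) (join 0 u) (join 0 v) = 0"
    by (simp add: log_model.basic_part_def[OF log_model[OF g]] A(2) x)
  show "\<mu> l c x u v = \<i> * deldelbar (\<lambda>w. complex_of_real (restr M \<pi> \<Phi> l r w)) c x u v" if l: "l \<in> \<Lambda>"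
  proof -
    have "\<mu> l c x u v = complex_of_real (levi (\<lambda>y. \<rho> (graph_of (log_radius c z l) y)) x u v)"
      by (simp add: \<mu>_potential[OF l c trivializes_at_self[OF g x] x A(1)] basic_part)
    also have "levi (\<lambda>y. \<rho> (graph_of (log_radius c z l) y)) x u v
        = levi (restr M \<pi> \<Phi> l r \<circ> chart_inv c) x u v"
      by (rule levi_eq_open[OF oc x]) (simp only: rs[OF l])
    also have "complex_of_real \<dots> = \<i> * deldelbar (\<lambda>w. complex_of_real (restr M \<pi> \<Phi> l r w)) c x u v"
      by (rule deldelbar_of_real[OF oc sm[OF l] x, symmetric])
    finally show ?thesis .
  qed
  show "\<nu> l1 l2 c x v = \<i> * delbar (\<lambda>w. complex_of_real (restr M \<pi> \<Phi> l1 r w)) c x v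
      - \<i> * delbar (\<lambda>w. complex_of_real (restr M \<pi> \<Phi> l2 r w)) c x v" if l: "l1 \<in> \<Lambda>" "l2 \<in> \<Lambda>"
  proof -
    let ?F = "\<lambda>l. (\<lambda>w. complex_of_real (restr M \<pi> \<Phi> l r w)) \<circ> chart_inv c"
    let ?G = "(\<lambda>w. complex_of_real (potential_gap l1 l2 w)) \<circ> chart_inv c"
    have d: "?F l differentiable (at x)" if "l \<in> \<Lambda>" for l
      using smooth_on_differentiable[OF smooth_on_bounded_linear[OF bounded_linear_of_real oc
          sm[OF that]] x] by (simp add: o_def)
    have dG: "?G differentiable (at x)"
      by (rule smooth_on_differentiable[OF
          smooth_function_of_real[OF manifold_B smooth_potential_gap[OF l] c] x])
    have "dd ?G x = dd (\<lambda>y. ?F l1 y - ?F l2 y) x"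
    proof (rule dd_eq_open[OF oc x])
      fix y assume y: "y \<in> img_of c"
      show "?G y = ?F l1 y - ?F l2 y"
        using potential_gap_potential[OF g l y A(1)] rs[OF l(1) y] rs[OF l(2) y] by simp
    qed
    then have "dd ?G x v = dd (?F l1) x v - dd (?F l2) x v" for v
      by (simp only: dd_diff[OF d[OF l(1)] d[OF l(2)]])
    then show ?thesis
      unfolding \<nu>_def delbar_eq[OF dG] delbar_eq[OF d[OF l(1)]] delbar_eq[OF d[OF l(2)]]
      by (simp only:) (simp add: algebra_simps diff_divide_distrib add_divide_distrib)
  qed
qed

text \<open>Both sides are twice the Levi form of the difference of the two functions \<open>\<sigma>\<^sub>i\<close>.\<close>

lemma curvature_difference:
  assumes l: "l1 \<in> \<Lambda>" "l2 \<in> \<Lambda>" and \<kappa>: "metric_ratio M B act \<pi> \<Phi> i l1 l2 \<kappa>"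
  shows "form2_eq B (\<lambda>c x u v. curvature_form M B act \<pi> \<Phi> i l1 c x u v
      - curvature_form M B act \<pi> \<Phi> i l2 c x u v)
     (\<lambda>c x u v. \<i> * ext_d (del (\<lambda>w. complex_of_real (ln (\<kappa> w)))) c x u v)"
  unfolding form2_eq_def
proof (intro ballI allI)
  fix c x u v assume c: "c \<in> B" and x: "x \<in> img_of c"
  obtain c' z where sb: "trivializes_at c x (c', z)" using trivializes_at_exists[OF c x] by force
  then have g: "trivial_over c' z" "x \<in> img_of c'" by (auto simp: trivializes_at_def)
  note oc = manifoldD(2)[OF manifold_B c] and oc' = open_img_c[OF g(1)]
  note s = smooth_log_radius_nth[OF g(1) l(1), of i] smooth_log_radius_nth[OF g(1) l(2), of i]
  let ?f = "\<lambda>w. ln (\<kappa> w)"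
  have sf: "smooth_function B ?f" by (rule smooth_metric_ratio[OF l \<kappa>])
  have f: "smooth_on (img_of c) (?f \<circ> chart_inv c)" using sf c by (simp add: smooth_function_def)
  have "\<i> * ext_d (del (\<lambda>w. complex_of_real (?f w))) c x u v =
      - levi ((\<lambda>w. complex_of_real (?f w)) \<circ> chart_inv c) x u v"
    by (rule ext_d_del[OF oc smooth_function_of_real[OF manifold_B sf c] x])
  also have "levi ((\<lambda>w. complex_of_real (?f w)) \<circ> chart_inv c) x u v
      = complex_of_real (levi (?f \<circ> chart_inv c) x u v)"
    using levi_of_real[OF oc f x] by (simp add: o_def)
  also have "levi (?f \<circ> chart_inv c) x u v
      = levi (\<lambda>y. 2 * log_radius c' z l2 y $ i - 2 * log_radius c' z l1 y $ i) x u v"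
    by (rule levi_eq_open[OF oc' g(2)]) (use trivializes_at_inv(1)[OF c sb]
        metric_ratio_exp[OF l g(1) _ \<kappa>] in simp)
  also have "\<dots> = levi (\<lambda>y. 2 * log_radius c' z l2 y $ i) x u v
      - levi (\<lambda>y. 2 * log_radius c' z l1 y $ i) x u v"
    by (rule levi_diff[OF oc' _ _ g(2)]) (intro smooth_intros oc' s)+
  also have "\<dots> = 2 * levi (\<lambda>y. log_radius c' z l2 y $ i) x u v
      - 2 * levi (\<lambda>y. log_radius c' z l1 y $ i) x u v"
    by (simp only: levi_cmult[OF oc' s(1) g(2)] levi_cmult[OF oc' s(2) g(2)])
  finally show "curvature_form M B act \<pi> \<Phi> i l1 c x u v - curvature_form M B act \<pi> \<Phi> i l2 c x u v
      = \<i> * ext_d (del (\<lambda>w. complex_of_real (?f w))) c x u v"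
    by (simp add: curvature_form_coeff[OF is_curvature_form_curvature_form[OF l(1)] l(1) c sb g(2)]
        curvature_form_coeff[OF is_curvature_form_curvature_form[OF l(2)] l(2) c sb g(2)])
qed

end

theorem mainTheorem3:
  fixes M :: "('a, 'n::finite + 'm::finite) chart set"
    and B :: "('b, 'm) chart set"
    and act :: "complex^'n \<Rightarrow> 'a \<Rightarrow> 'a"
    and \<pi> :: "'a \<Rightarrow> 'b"
    and \<omega> :: "('a, 'n + 'm) form2"
    and \<Phi> :: "'a \<Rightarrow> real^'n"
  assumes principal: "principal_bundle M B act \<pi>"
    and kaehler: "kaehler_form M \<omega>"
    and invariant: "invariant_form2 M act \<omega>"
    and moment: "moment_map M act \<omega> \<Phi>"
  shows "let \<Lambda> = Lambda M B act \<pi> \<omega> \<Phi>;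
         \<omega>red = reduced_form M B \<pi> \<omega> \<Phi>;
         curv = curvature_form M B act \<pi> \<Phi>
     in \<exists>(\<mu> :: real^'n \<Rightarrow> ('b, 'm) form2) (\<nu> :: real^'n \<Rightarrow> real^'n \<Rightarrow> ('b, 'm) form1).
     (\<forall>l\<in>\<Lambda>. two_form B (\<mu> l)) \<and>
     (\<forall>l1\<in>\<Lambda>. \<forall>l2\<in>\<Lambda>. one_form B (\<nu> l1 l2)) \<and>
     (\<forall>c\<in>B. \<forall>z \<rho>. convex (img_of c) \<and> trivialization M act \<pi> c z \<and>
          admissible_potential M act \<pi> \<omega> \<Phi> c z \<rho> \<longrightarrow>
        (\<forall>l\<in>\<Lambda>. \<forall>x\<in>img_of c. \<forall>u v.
           \<mu> l c x u v = \<i> * deldelbar (\<lambda>w. complex_of_real (restr M \<pi> \<Phi> l \<rho> w)) c x u v) \<and>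
        (\<forall>l1\<in>\<Lambda>. \<forall>l2\<in>\<Lambda>. \<forall>x\<in>img_of c. \<forall>v.
           \<nu> l1 l2 c x v =
             \<i> * delbar (\<lambda>w. complex_of_real (restr M \<pi> \<Phi> l1 \<rho> w)) c x v
           - \<i> * delbar (\<lambda>w. complex_of_real (restr M \<pi> \<Phi> l2 \<rho> w)) c x v)) \<and>
     (\<forall>l1\<in>\<Lambda>. \<forall>l2\<in>\<Lambda>.
        form2_eq B (\<lambda>c x u v. \<mu> l1 c x u v - \<mu> l2 c x u v) (ext_d (\<nu> l1 l2))) \<and>
     (\<forall>i. \<forall>l\<in>\<Lambda>. is_curvature_form M B act \<pi> \<Phi> i l (curv i l)) \<and>
     (\<forall>i. \<forall>l1\<in>\<Lambda>. \<forall>l2\<in>\<Lambda>.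
        (\<exists>\<kappa>. metric_ratio M B act \<pi> \<Phi> i l1 l2 \<kappa>) \<and>
        (\<forall>\<kappa>. metric_ratio M B act \<pi> \<Phi> i l1 l2 \<kappa> \<longrightarrow>
           one_form B (del (\<lambda>w. complex_of_real (ln (\<kappa> w)))) \<and>
           form2_eq B (\<lambda>c x u v. curv i l1 c x u v - curv i l2 c x u v)
             (\<lambda>c x u v. \<i> * ext_d (del (\<lambda>w. complex_of_real (ln (\<kappa> w)))) c x u v))) \<and>
     (\<forall>l\<in>\<Lambda>. is_reduced_form M B \<pi> \<omega> \<Phi> l (\<omega>red l) \<and>
        form2_eq B (\<omega>red l)
          (\<lambda>c x u v. \<mu> l c x u v - (\<Sum>i\<in>UNIV. complex_of_real (l $ i) * curv i l c x u v)))"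
proof -
  interpret hamiltonian_bundle M B act \<pi> \<omega> \<Phi>
    by unfold_locales (rule principal, rule kaehler, rule moment)
  show ?thesis
    unfolding Let_def
  proof (intro exI[of _ \<mu>] exI[of _ \<nu>] conjI ballI allI impI; (elim conjE)?)
    show "one_form B (del (\<lambda>w. complex_of_real (ln (\<kappa> w))))"
      if "l1 \<in> \<Lambda>" "l2 \<in> \<Lambda>" "metric_ratio M B act \<pi> \<Phi> i l1 l2 \<kappa>" for i l1 l2 \<kappa>
      by (rule one_form_del[OF manifold_B smooth_metric_ratio[OF that]])
    show "form2_eq B (reduced_form M B \<pi> \<omega> \<Phi> l)
        (\<lambda>c x u v. \<mu> l c x u v - (\<Sum>i\<in>UNIV. complex_of_real (l $ i) * curvature_form M B act \<pi> \<Phi> i l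
            c x u v))" for l
      by (simp add: form2_eq_def \<mu>_def)
  qed (assumption | rule two_form_\<mu> one_form_\<nu> admissible_forms \<mu>_difference
      is_curvature_form_curvature_form metric_ratio_exists curvature_difference
      is_reduced_form_reduced_form)+
qed

end
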